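(* Suppose that $\Theta$ is an inner function with the property that each bounded truncated Toeplitz operator on $K_\Theta$ has a bounded symbol. Then for each real $p>2$ we have $$\sup_{\lambda\in\mathbb D}\frac{\|k_\lambda^\Theta\|_p}{\|k_\lambda^\Theta\|_2^2}<\infty.$$
   Context: $\mathbb D$ is the open unit disc, $\mathbb T$ the unit circle with normalized Lebesgue measure $m$, $L^p=L^p(\mathbb T,m)$ with norm $\|\cdot\|_p$, and $H^p$ is the Hardy space, regarded as a subspace of $L^p$ via boundary values. An inner function is a nonconstant $\Theta\in H^\infty$ with $|\Theta|=1$ a.e. on $\mathbb T$. $K_\Theta=H^2\ominus\Theta H^2$, $P_\Theta$ is the orthogonal projection of $L^2$ onto $K_\Theta$, and $k_\lambda^\Theta(z)=\frac{1-\overline{\Theta(\lambda)}\Theta(z)}{1-\bar\lambda z}$ is the reproducing kernel of $K_\Theta$ at $\lambda\in\mathbb D$. For $\phi\in L^2$, the truncated Toeplitz operator $A_\phi^\Theta$ is the (possibly unbounded) densely defined operator in $K_\Theta$ with domain $K_\Theta\cap H^\infty$, $A_\phi^\Theta f=P_\Theta(\phi f)$. It is called bounded if it extends to a bounded operator on $K_\Theta$ (with which it is then identified). A symbol of a truncated Toeplitz operator $A$ is any $\phi\in L^2$ with $A=A_\phi^\Theta$; it is not unique. A bounded symbol is a symbol in $L^\infty$. *)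

theory Defs
  imports "HOL-Complex_Analysis.Complex_Analysis"
begin

text \<open>
  Elements of the Lebesgue and Hardy spaces are represented by functions on the unit circle,
  two functions representing the same element iff they agree almost everywhere.
  All sets of functions below are closed under this equivalence.
\<close>

definition circle_measure :: "complex measure" where
  "circle_measure =
     distr (uniform_measure lborel {0..2 * pi}) (restrict_space borel (sphere 0 1)) cis"

definition Lp :: "real \<Rightarrow> (complex \<Rightarrow> complex) set" where
  "Lp p = {f \<in> borel_measurable circle_measure.
             integrable circle_measure (\<lambda>z. norm (f z) powr p)}"

definition Linf :: "(complex \<Rightarrow> complex) set" where
  "Linf = {f \<in> borel_measurable circle_measure. \<exists>C. AE z in circle_measure. norm (f z) \<le> C}"

text \<open>Outside \<open>Lp p\<close> the value of \<open>lpnorm p\<close> is junk (the Bochner integral defaults to 0).\<close>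

definition lpnorm :: "real \<Rightarrow> (complex \<Rightarrow> complex) \<Rightarrow> real" where
  "lpnorm p f = (LINT z|circle_measure. norm (f z) powr p) powr (1 / p)"

definition l2inner :: "(complex \<Rightarrow> complex) \<Rightarrow> (complex \<Rightarrow> complex) \<Rightarrow> complex" where
  "l2inner f g = (LINT z|circle_measure. f z * cnj (g z))"

definition disc_hardy :: "real \<Rightarrow> (complex \<Rightarrow> complex) set" where
  "disc_hardy p = {F. F holomorphic_on ball 0 1 \<and>
     (\<exists>C. \<forall>r\<in>{0..<1}. (LINT z|circle_measure. norm (F (of_real r * z)) powr p) \<le> C)}"

definition disc_hardy_inf :: "(complex \<Rightarrow> complex) set" where
  "disc_hardy_inf = {F. F holomorphic_on ball 0 1 \<and> bounded (F ` ball 0 1)}"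

text \<open>Boundary values are radial limits, which exist almost everywhere for functions in
  Hardy spaces.\<close>

definition has_boundary_values :: "(complex \<Rightarrow> complex) \<Rightarrow> (complex \<Rightarrow> complex) \<Rightarrow> bool" where
  "has_boundary_values F f \<longleftrightarrow>
     (AE z in circle_measure. ((\<lambda>r::real. F (of_real r * z)) \<longlongrightarrow> f z) (at_left 1))"

text \<open>\<open>bv F z\<close> is unspecified at those \<open>z\<close> where the radial limit does not exist.\<close>

definition bv :: "(complex \<Rightarrow> complex) \<Rightarrow> complex \<Rightarrow> complex" where
  "bv F z = Lim (at_left 1) (\<lambda>r::real. F (of_real r * z))"

definition Hp :: "real \<Rightarrow> (complex \<Rightarrow> complex) set" where
  "Hp p = {f \<in> Lp p. \<exists>F \<in> disc_hardy p. has_boundary_values F f}"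

definition Hinf :: "(complex \<Rightarrow> complex) set" where
  "Hinf = {f \<in> Linf. \<exists>F \<in> disc_hardy_inf. has_boundary_values F f}"

text \<open>An inner function is a function on the open disc; its values elsewhere are irrelevant.
  The first conjunct under the quantifier prevents an unspecified value of \<open>bv\<close> from counting.\<close>

definition inner_function :: "(complex \<Rightarrow> complex) \<Rightarrow> bool" where
  "inner_function \<Theta> \<longleftrightarrow>
     \<Theta> \<in> disc_hardy_inf \<and> \<not> \<Theta> constant_on ball 0 1 \<and>
     (AE z in circle_measure.
        ((\<lambda>r::real. \<Theta> (of_real r * z)) \<longlongrightarrow> bv \<Theta> z) (at_left 1) \<and> norm (bv \<Theta> z) = 1)"

definition model_space :: "(complex \<Rightarrow> complex) \<Rightarrow> (complex \<Rightarrow> complex) set" where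
  "model_space \<Theta> = {f \<in> Hp 2. \<forall>h \<in> Hp 2. l2inner f (\<lambda>z. bv \<Theta> z * h z) = 0}"

text \<open>\<open>model_proj \<Theta> f g\<close>: the function \<open>g\<close> represents the orthogonal projection of
  \<open>f \<in> Lp 2\<close> onto the model space. It is a relation since \<open>g\<close> is determined only up to
  almost everywhere equality.\<close>

definition model_proj :: "(complex \<Rightarrow> complex) \<Rightarrow> (complex \<Rightarrow> complex) \<Rightarrow> (complex \<Rightarrow> complex) \<Rightarrow> bool"
  where
  "model_proj \<Theta> f g \<longleftrightarrow>
     g \<in> model_space \<Theta> \<and> (\<forall>h \<in> model_space \<Theta>. l2inner (\<lambda>z. f z - g z) h = 0)"

definition model_kernel :: "(complex \<Rightarrow> complex) \<Rightarrow> complex \<Rightarrow> complex \<Rightarrow> complex" where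
  "model_kernel \<Theta> w z = (1 - cnj (\<Theta> w) * \<Theta> z) / (1 - cnj w * z)"

text \<open>Linearity and boundedness together force \<open>A\<close> to respect almost everywhere equality.\<close>

definition bounded_operator_on ::
  "(complex \<Rightarrow> complex) set \<Rightarrow> ((complex \<Rightarrow> complex) \<Rightarrow> complex \<Rightarrow> complex) \<Rightarrow> bool" where
  "bounded_operator_on K A \<longleftrightarrow>
     (\<forall>f\<in>K. A f \<in> K) \<and>
     (\<forall>f\<in>K. \<forall>g\<in>K. AE z in circle_measure. A (\<lambda>w. f w + g w) z = A f z + A g z) \<and>
     (\<forall>c. \<forall>f\<in>K. AE z in circle_measure. A (\<lambda>w. c * f w) z = c * A f z) \<and>
     (\<exists>C. \<forall>f\<in>K. lpnorm 2 (A f) \<le> C * lpnorm 2 f)"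

text \<open>\<open>\<phi>\<close> is a symbol of the operator \<open>A\<close> on the model space if \<open>A\<close> extends the truncated
  Toeplitz operator \<open>f \<mapsto> P(\<phi> f)\<close>, whose domain consists of the bounded functions in
  the model space.\<close>

definition tto_symbol ::
  "(complex \<Rightarrow> complex) \<Rightarrow> ((complex \<Rightarrow> complex) \<Rightarrow> complex \<Rightarrow> complex) \<Rightarrow> (complex \<Rightarrow> complex) \<Rightarrow> bool"
  where
  "tto_symbol \<Theta> A \<phi> \<longleftrightarrow>
     \<phi> \<in> Lp 2 \<and> (\<forall>f \<in> model_space \<Theta> \<inter> Hinf. model_proj \<Theta> (\<lambda>z. \<phi> z * f z) (A f))"

definition bounded_tto ::
  "(complex \<Rightarrow> complex) \<Rightarrow> ((complex \<Rightarrow> complex) \<Rightarrow> complex \<Rightarrow> complex) \<Rightarrow> bool" where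
  "bounded_tto \<Theta> A \<longleftrightarrow> bounded_operator_on (model_space \<Theta>) A \<and> (\<exists>\<phi>. tto_symbol \<Theta> A \<phi>)"

end

theory Submission
  imports Defs
begin

text \<open>
Write \<open>k\<^sub>a\<close> for the kernel at \<open>a\<close> and \<open>t\<^sub>a(z) = (\<Theta>(z) - \<Theta>(a)) / (z - a)\<close> for its conjugate in the
model space; on the circle \<open>|t\<^sub>a| = |k\<^sub>a|\<close>, so both have the same norm in every Lebesgue space.
The rank one operator \<open>f \<mapsto> f(a) t\<^sub>a\<close> is a truncated Toeplitz operator of norm \<open>\<parallel>k\<^sub>a\<parallel>\<^sub>2\<^sup>2\<close>, with an explicit
symbol of \<open>L\<^sup>2\<close> norm at most \<open>2 \<parallel>k\<^sub>a\<parallel>\<^sub>2\<close> (\<open>rank_one_symbol\<close>).  Suppose that it also has a bounded symbol \<open>\<phi>\<close>.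
Applying the operator to the bounded function \<open>k\<^sub>0\<close> gives \<open>k\<^sub>0(a) t\<^sub>a = P(\<phi> k\<^sub>0)\<close>: up to a factor bounded
below by \<open>1 - |\<Theta>(0)|\<close>, the function \<open>t\<^sub>a\<close> is the projection of a bounded function.  The projection of a bounded
\<open>g\<close> onto the model space is \<open>C(g) - \<Theta> C(g cnj \<Theta>)\<close> with the Cauchy transform \<open>C\<close>, and \<open>C\<close> maps bounded
functions into \<open>H\<^sup>p\<close> for every finite \<open>p\<close> (\<open>cauchy_transform_disc_hardy\<close>).  Hence the \<open>L\<^sup>p\<close> norm of \<open>k\<^sub>a\<close>
is controlled by the size of \<open>\<phi>\<close>.

What remains is to control \<open>\<phi>\<close> uniformly in \<open>a\<close>.  To this end the qualitative statement is applied to sums of the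
rank one operators at points \<open>a\<^sub>0, a\<^sub>1, \<dots>\<close>, the \<open>k\<close>-th one normalized and weighted by \<open>4\<^sup>-\<^sup>k\<close>.
Such a sum is again a bounded truncated
Toeplitz operator, so that the corresponding sum of the functions \<open>k\<^sub>0(a\<^sub>k) t / \<parallel>k\<parallel>\<^sub>2\<^sup>2\<close> lies in \<open>L\<^sup>p\<close>
(\<open>rank_one_sum_boundary_kernel_0_Lp\<close>).  A gliding hump (\<open>gliding_hump\<close>), tested against the unit ball of the dual
Lebesgue space, turns this into a uniform bound for the \<open>L\<^sup>p\<close> norms of the single terms.

If the quotients in question were unbounded, they would be unbounded along a sequence converging to some point \<open>\<zeta>\<close>,
so it suffices to treat points \<open>a\<^sub>k\<close> taken from such a sequence.  This restriction has a purpose.  Elements of Hardy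
spaces are represented by functions that have radial limits almost everywhere, and the sums above have to be
recognized as such.  If the \<open>a\<^sub>k\<close> can only accumulate at \<open>\<zeta>\<close>, the functions \<open>t\<close> are uniformly bounded near the end of
every radius that does not end at \<open>\<zeta>\<close>, and the radial limits of the sum can be taken termwise.
\<close>

section \<open>Normalized Lebesgue measure on the circle\<close>

abbreviation \<mm> :: "complex measure" where
  "\<mm> \<equiv> circle_measure"

lemma space_circle [simp]: "space \<mm> = sphere 0 1"
  by (simp add: circle_measure_def space_restrict_space)

lemma sets_circle [measurable_cong]: "sets \<mm> = sets (restrict_space borel (sphere 0 1))"
  by (simp add: circle_measure_def)

lemma cis_measurable [measurable]: "cis \<in> borel \<rightarrow>\<^sub>M restrict_space borel (sphere 0 1)"
  by (intro measurable_restrict_space2 borel_measurable_continuous_onI continuous_intros) auto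

lemma uniform_2pi:
  "uniform_measure lborel {0..2 * pi} = density lborel (\<lambda>t. ennreal (indicator {0..2*pi} t / (2*pi)))"
  unfolding uniform_measure_def
  by (rule arg_cong[where f="density lborel"])
     (auto simp: fun_eq_iff indicator_def divide_ennreal ennreal_1[symmetric] simp del: ennreal_1)

lemma emeasure_circle [simp]: "emeasure \<mm> (sphere 0 1) = 1"
proof -
  have "emeasure \<mm> (sphere 0 1) = emeasure (uniform_measure lborel {0..2*pi}) UNIV"
    unfolding circle_measure_def
    by (subst emeasure_distr) (auto simp: sets_restrict_space vimage_def)
  also have "\<dots> = 1"
    by (subst emeasure_uniform_measure) (auto simp: ennreal_divide_self)
  finally show ?thesis .
qed

lemma finite_measure_circle: "finite_measure \<mm>"
  by (rule finite_measureI) simp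

interpretation circle: finite_measure circle_measure
  by (rule finite_measure_circle)

lemma measure_circle [simp]: "measure \<mm> (sphere 0 1) = 1"
  by (simp add: measure_def)

lemma integral_circle:
  fixes f :: "complex \<Rightarrow> 'a :: {banach, second_countable_topology}"
  assumes "f \<in> borel_measurable \<mm>"
  shows "integral\<^sup>L \<mm> f = (LINT t:{0..2*pi}|lborel. f (cis t)) /\<^sub>R (2 * pi)"
proof -
  have [measurable]: "f \<in> borel_measurable (restrict_space borel (sphere 0 1))"
    using assms by (simp add: measurable_cong_sets[OF sets_circle refl])
  have [measurable]: "(\<lambda>t. f (cis t)) \<in> borel_measurable borel"
    by measurable
  have "integral\<^sup>L \<mm> f = (LINT t|uniform_measure lborel {0..2*pi}. f (cis t))"
    unfolding circle_measure_def by (rule integral_distr) simp_all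
  also have "\<dots> = (LINT t|lborel. (indicator {0..2*pi} t / (2*pi)) *\<^sub>R f (cis t))"
    unfolding uniform_2pi by (rule integral_density) simp_all
  also have "\<dots> = (LINT t|lborel. inverse (2*pi) *\<^sub>R (indicator {0..2*pi} t *\<^sub>R f (cis t)))"
    by (rule Bochner_Integration.integral_cong[OF refl]) (simp only: scaleR_scaleR divide_inverse_commute)
  finally show ?thesis
    by (simp only: set_lebesgue_integral_def Bochner_Integration.integral_scaleR_right)
qed

lemma continuous_imp_measurable_circle:
  "continuous_on (sphere 0 1) f \<Longrightarrow> f \<in> borel_measurable \<mm>"
  by (simp add: measurable_cong_sets[OF sets_circle refl] borel_measurable_continuous_on_restrict)

lemma AE_circle_norm: "AE z in \<mm>. norm z = 1"
  by (rule AE_I2) simp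

lemma AE_circle_neq: "AE z in \<mm>. z \<noteq> \<zeta>"
proof -
  have "countable {t. cis t = \<zeta>}"
  proof (cases "\<exists>t0. cis t0 = \<zeta>")
    case True
    then obtain t0 where t0: "cis t0 = \<zeta>" by blast
    have "{t. cis t = \<zeta>} \<subseteq> range (\<lambda>n::int. t0 + 2 * pi * of_int n)"
    proof
      fix t assume "t \<in> {t. cis t = \<zeta>}"
      with t0 have "sin t = sin t0 \<and> cos t = cos t0" by (auto simp: complex_eq_iff)
      then obtain n :: int where "t = t0 + 2 * pi * of_int n"
        using sin_cos_eq_iff[of t t0] by auto
      then show "t \<in> range (\<lambda>n::int. t0 + 2 * pi * of_int n)" by blast
    qed
    then show ?thesis by (rule countable_subset) auto
  qed auto
  then have "AE t in lborel. t \<notin> {t. cis t = \<zeta>}"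
    by (intro AE_not_in countable_imp_null_set_lborel)
  then have "AE t in uniform_measure lborel {0..2*pi}. cis t \<noteq> \<zeta>"
    by (intro AE_uniform_measureI) auto
  then show ?thesis
    unfolding circle_measure_def
    by (subst AE_distr_iff) (auto simp: sets_restrict_space)
qed

lemma integral_circle_power:
  assumes "0 < n"
  shows "(LINT z|\<mm>. z ^ n) = 0"
proof -
  have "(LINT z|\<mm>. z ^ n) = (LINT t:{0..2*pi}|lborel. cis t ^ n) /\<^sub>R (2 * pi)"
    by (intro integral_circle continuous_imp_measurable_circle continuous_intros)
  also have "(LINT t:{0..2*pi}|lborel. cis t ^ n) = cis (2*pi) ^ n / (\<i> * of_nat n) - cis 0 ^ n / (\<i> * of_nat n)"
    unfolding set_lebesgue_integral_def
  proof (rule integral_FTC_atLeastAtMost)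
    fix x assume "0 \<le> x" "x \<le> 2 * pi"
    show "((\<lambda>x. cis x ^ n / (\<i> * of_nat n)) has_vector_derivative cis x ^ n) (at x within {0..2 * pi})"
    proof -
      have D: "((\<lambda>w. exp (\<i> * w) ^ n / (\<i> * of_nat n)) has_field_derivative exp (\<i> * of_real x) ^ n)
              (at (of_real x))"
      proof -
        have "((\<lambda>w. exp (of_nat n * (\<i> * w)) / (\<i> * of_nat n)) has_field_derivative
                exp (of_nat n * (\<i> * of_real x))) (at (of_real x))"
          using assms by (auto intro!: derivative_eq_intros)
        then show ?thesis by (simp only: exp_of_nat_mult)
      qed
      show ?thesis
        using has_vector_derivative_real_field[OF D] by (simp add: cis_conv_exp)
    qed
  qed (auto intro!: continuous_intros)
  finally show ?thesis by simp
qed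

lemma circle_integrable_bounded:
  fixes f :: "complex \<Rightarrow> 'a :: {banach, second_countable_topology}"
  assumes "f \<in> borel_measurable \<mm>" "AE z in \<mm>. norm (f z) \<le> B"
  shows "integrable \<mm> f"
  using circle.integrable_const_bound[OF assms(2,1)] .

lemma circle_continuous_integrable:
  fixes f :: "complex \<Rightarrow> 'a :: {banach, second_countable_topology}"
  assumes "continuous_on (sphere 0 1) f"
  shows "integrable \<mm> f"
proof -
  have "compact (f ` sphere 0 1)" by (intro compact_continuous_image assms) auto
  then obtain B where "\<forall>x\<in>f ` sphere 0 1. norm x \<le> B"
    using compact_imp_bounded bounded_iff by metis
  then show ?thesis
    by (intro circle_integrable_bounded[of _ B] continuous_imp_measurable_circle assms AE_I2) auto
qed

lemma integral_circle_monomials: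
  "(LINT z|\<mm>. z ^ n * cnj z ^ m) = (if n = m then 1 else 0)"
proof -
  have zz: "z ^ k * cnj z ^ k = 1" if "norm z = 1" for z :: complex and k
    using that by (simp add: flip: power_mult_distrib complex_norm_square)
  have 1: "(LINT z|\<mm>. z ^ n * cnj z ^ m) = 0" if "m < n" for n m
  proof -
    have "(LINT z|\<mm>. z ^ n * cnj z ^ m) = (LINT z|\<mm>. z ^ (n - m))"
    proof (intro Bochner_Integration.integral_cong refl)
      fix z :: complex assume "z \<in> space \<mm>"
      then have "norm z = 1" by simp
      then show "z ^ n * cnj z ^ m = z ^ (n - m)"
        using zz[of z m] that power_add[of z "n - m" m] by (simp add: mult.assoc)
    qed
    with that show ?thesis by (simp add: integral_circle_power)
  qed
  consider "n = m" | "m < n" | "n < m" by linarith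
  then show ?thesis
  proof cases
    case 1
    have "(LINT z|\<mm>. z ^ n * cnj z ^ m) = (LINT z|\<mm>. 1)"
      using 1 by (intro Bochner_Integration.integral_cong) (auto simp: zz)
    then show ?thesis using 1 by simp
  next
    case 2 then show ?thesis using 1[of m n] by simp
  next
    case 3
    have "(LINT z|\<mm>. z ^ n * cnj z ^ m) = (LINT z|\<mm>. cnj (z ^ m * cnj z ^ n))"
      by (simp add: mult.commute)
    also have "\<dots> = cnj (LINT z|\<mm>. z ^ m * cnj z ^ n)" by (rule Bochner_Integration.integral_cnj)
    finally show ?thesis using 3 1[of n m] by simp
  qed
qed

section \<open>Power series on circles inside the disc\<close>

definition taylor_coeff :: "(complex \<Rightarrow> complex) \<Rightarrow> nat \<Rightarrow> complex" where
  "taylor_coeff F n = (deriv ^^ n) F 0 / fact n"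

lemma taylor_sums:
  "F holomorphic_on ball 0 1 \<Longrightarrow> norm w < 1 \<Longrightarrow> (\<lambda>n. taylor_coeff F n * w ^ n) sums F w"
  using holomorphic_power_series[of F 0 1 w] by (simp add: taylor_coeff_def)

lemma taylor_abs_summable:
  assumes "F holomorphic_on ball 0 1" "0 \<le> r" "r < 1"
  shows "summable (\<lambda>n. norm (taylor_coeff F n) * r ^ n)"
proof -
  obtain R where R: "r < R" "R < 1" using dense assms by blast
  have "summable (\<lambda>n. taylor_coeff F n * of_real R ^ n)"
    using taylor_sums[OF assms(1), of "of_real R"] R assms by (auto simp: sums_iff)
  from powser_insidea[OF this, of "of_real r"] show ?thesis
    using R assms by (simp add: norm_mult norm_power)
qed

lemma dilation_continuous:
  fixes F :: "complex \<Rightarrow> complex"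
  assumes "continuous_on (ball 0 1) F" "0 \<le> r" "r < 1"
  shows "continuous_on (sphere 0 1) (\<lambda>z. F (of_real r * z))"
proof (rule continuous_on_compose2[OF assms(1)])
  show "continuous_on (sphere 0 1) (\<lambda>z::complex. of_real r * z)" by (intro continuous_intros)
qed (use assms in \<open>auto simp: norm_mult\<close>)

lemma dilation_bounded:
  fixes F :: "complex \<Rightarrow> complex"
  assumes "F holomorphic_on ball 0 1" "0 \<le> r" "r < 1"
  obtains B where "\<And>z. norm z = 1 \<Longrightarrow> norm (F (of_real r * z)) \<le> B"
proof -
  have "compact ((\<lambda>z. F (of_real r * z)) ` sphere 0 1)"
    using assms by (intro compact_continuous_image dilation_continuous holomorphic_on_imp_continuous_on) auto
  then obtain B where "\<forall>x\<in>(\<lambda>z. F (of_real r * z)) ` sphere 0 1. norm x \<le> B"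
    using compact_imp_bounded bounded_iff by metis
  then show ?thesis by (intro that[of B]) auto
qed

lemma dilation_measurable:
  assumes "F holomorphic_on ball 0 1" "0 \<le> r" "r < 1"
  shows "(\<lambda>z. F (of_real r * z)) \<in> borel_measurable \<mm>"
  using assms by (intro continuous_imp_measurable_circle dilation_continuous holomorphic_on_imp_continuous_on)

lemma circle_sums_integral:
  fixes u :: "nat \<Rightarrow> complex \<Rightarrow> complex"
  assumes meas: "\<And>n. u n \<in> borel_measurable \<mm>"
    and bound: "\<And>n z. norm z = 1 \<Longrightarrow> norm (u n z) \<le> c n" and "summable c"
    and sums: "\<And>z. norm z = 1 \<Longrightarrow> (\<lambda>n. u n z) sums f z"
  shows "(\<lambda>n. LINT z|\<mm>. u n z) sums (LINT z|\<mm>. f z)"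
proof -
  have int: "integrable \<mm> (u n)" for n
    using bound by (intro circle_integrable_bounded[of _ "c n"] meas AE_I2) auto
  have "(\<lambda>n. LINT z|\<mm>. u n z) sums (LINT z|\<mm>. (\<Sum>n. u n z))"
  proof (rule sums_integral)
    show "AE z in \<mm>. summable (\<lambda>n. norm (u n z))"
      using bound by (intro AE_I2 summable_comparison_test'[OF \<open>summable c\<close>]) auto
    have "(LINT z|\<mm>. norm (u n z)) \<le> (LINT z|\<mm>. c n)" for n
      using int bound by (intro integral_mono) auto
    then show "summable (\<lambda>n. LINT z|\<mm>. norm (u n z))"
      by (intro summable_comparison_test'[OF \<open>summable c\<close>]) auto
  qed (rule int)
  also have "(LINT z|\<mm>. (\<Sum>n. u n z)) = (LINT z|\<mm>. f z)"
    using sums by (intro Bochner_Integration.integral_cong) (auto simp: sums_iff)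
  finally show ?thesis .
qed

text \<open>
The Taylor series converges uniformly on the circle of radius \<open>r\<close>, so it may be integrated termwise against
a monomial.
\<close>

lemma fourier_coeff_dilation:
  assumes F: "F holomorphic_on ball 0 1" and r: "0 \<le> r" "r < 1"
  shows "(LINT z|\<mm>. F (of_real r * z) * cnj z ^ m) = taylor_coeff F m * of_real r ^ m"
proof -
  define u where "u = (\<lambda>n z. taylor_coeff F n * of_real r ^ n * (z ^ n * cnj z ^ m))"
  have "(\<lambda>n. LINT z|\<mm>. u n z) sums (LINT z|\<mm>. F (of_real r * z) * cnj z ^ m)"
  proof (rule circle_sums_integral)
    show "u n \<in> borel_measurable \<mm>" for n
      unfolding u_def by (intro continuous_imp_measurable_circle continuous_intros)
    show "norm (u n z) \<le> norm (taylor_coeff F n) * r ^ n" if "norm z = 1" for n z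
      using that r by (simp add: u_def norm_mult norm_power)
    show "summable (\<lambda>n. norm (taylor_coeff F n) * r ^ n)"
      by (rule taylor_abs_summable[OF F r])
    show "(\<lambda>n. u n z) sums (F (of_real r * z) * cnj z ^ m)" if "norm z = 1" for z
      using sums_mult2[OF taylor_sums[OF F, of "of_real r * z"], of "cnj z ^ m"] that r
      by (simp add: u_def norm_mult power_mult_distrib mult_ac)
  qed
  moreover have "(LINT z|\<mm>. u n z) = (if n = m then taylor_coeff F n * of_real r ^ n else 0)" for n
    unfolding u_def by (simp add: integral_circle_monomials)
  ultimately show ?thesis
    using sums_single[of m "\<lambda>n. taylor_coeff F n * of_real r ^ n"] by (simp add: sums_iff)
qed

lemma parseval_dilation:
  assumes F: "F holomorphic_on ball 0 1" and r: "0 \<le> r" "r < 1"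
  shows "(\<lambda>n. (norm (taylor_coeff F n) * r ^ n)\<^sup>2) sums (LINT z|\<mm>. (norm (F (of_real r * z)))\<^sup>2)"
proof -
  define u where "u = (\<lambda>n z. cnj (taylor_coeff F n) * of_real r ^ n * (F (of_real r * z) * cnj z ^ n))"
  have cont: "continuous_on (sphere 0 1) (\<lambda>z. F (of_real r * z))"
    using dilation_continuous F r holomorphic_on_imp_continuous_on by blast
  obtain B where B: "\<And>z. norm z = 1 \<Longrightarrow> norm (F (of_real r * z)) \<le> B"
    using dilation_bounded[OF F r] by blast
  have "(\<lambda>n. LINT z|\<mm>. u n z) sums (LINT z|\<mm>. F (of_real r * z) * cnj (F (of_real r * z)))"
  proof (rule circle_sums_integral)
    show "u n \<in> borel_measurable \<mm>" for n
      unfolding u_def by (intro continuous_imp_measurable_circle continuous_intros cont)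
    show "norm (u n z) \<le> norm (taylor_coeff F n) * r ^ n * B" if "norm z = 1" for n z
      using that r B[OF that] by (simp add: u_def norm_mult norm_power divide_right_mono mult_left_mono)
    show "summable (\<lambda>n. norm (taylor_coeff F n) * r ^ n * B)"
      by (intro summable_mult2 taylor_abs_summable[OF F r])
    show "(\<lambda>n. u n z) sums (F (of_real r * z) * cnj (F (of_real r * z)))" if "norm z = 1" for z
    proof -
      have "(\<lambda>n. taylor_coeff F n * (of_real r * z) ^ n) sums F (of_real r * z)"
        using that r by (intro taylor_sums F) (simp add: norm_mult)
      then have "(\<lambda>n. cnj (taylor_coeff F n * (of_real r * z) ^ n)) sums cnj (F (of_real r * z))"
        by (subst sums_cnj)
      from sums_mult[OF this, of "F (of_real r * z)"] show ?thesis
        by (simp add: u_def power_mult_distrib mult_ac)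
    qed
  qed
  moreover have "(LINT z|\<mm>. u n z) = of_real ((norm (taylor_coeff F n) * r ^ n)\<^sup>2)" for n
  proof -
    have "(LINT z|\<mm>. u n z)
        = (taylor_coeff F n * cnj (taylor_coeff F n)) * (of_real r ^ n * of_real r ^ n)"
      unfolding u_def using fourier_coeff_dilation[OF F r, of n] by simp
    then show ?thesis
      by (simp add: complex_norm_square[symmetric] power2_eq_square)
  qed
  moreover have "(LINT z|\<mm>. F (of_real r * z) * cnj (F (of_real r * z)))
      = of_real (LINT z|\<mm>. (norm (F (of_real r * z)))\<^sup>2)"
    by (simp add: complex_norm_square[symmetric] del: of_real_power)
  ultimately show ?thesis
    by (simp only: sums_of_real_iff)
qed

text \<open>
By Parseval's identity the quadratic mean over a circle is a power series in the radius with nonnegative coefficients.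
\<close>

lemma dilation_norm_mono:
  assumes F: "F holomorphic_on ball 0 1" and r: "0 \<le> r" "r \<le> s" "s < 1"
  shows "(LINT z|\<mm>. (norm (F (of_real r * z)))\<^sup>2) \<le> (LINT z|\<mm>. (norm (F (of_real s * z)))\<^sup>2)"
proof (rule sums_le)
  show "(norm (taylor_coeff F n) * r ^ n)\<^sup>2 \<le> (norm (taylor_coeff F n) * s ^ n)\<^sup>2" for n
    using r by (intro power_mono mult_left_mono) auto
qed (use r in \<open>auto intro!: parseval_dilation[OF F]\<close>)

lemma geometric_circle_sums:
  assumes "norm w < 1" "norm z = 1"
  shows "(\<lambda>n. w ^ n * cnj z ^ n) sums (1 / (1 - w * cnj z))"
  using geometric_sums[of "w * cnj z"] assms by (simp add: norm_mult power_mult_distrib)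

lemma cauchy_kernel_nonzero:
  fixes w z :: complex
  assumes "norm w < 1" "norm z \<le> 1"
  shows "1 - w * z \<noteq> 0"
proof -
  have "norm w * norm z \<le> norm w * 1" using assms by (intro mult_left_mono) auto
  with assms have "norm (w * z) < 1" by (simp add: norm_mult)
  then show ?thesis by auto
qed

text \<open>
On the unit circle \<open>1 / (1 - w cnj z)\<close> is the sum of the \<open>w\<^sup>n (cnj z)\<^sup>n\<close>, so the integral recovers the Taylor
series of the dilated function at \<open>w\<close>.
\<close>

lemma cauchy_formula_dilation:
  assumes F: "F holomorphic_on ball 0 1" and r: "0 \<le> r" "r < 1" and w: "norm w < 1"
  shows "(LINT z|\<mm>. F (of_real r * z) / (1 - w * cnj z)) = F (of_real r * w)"
proof -
  define u where "u = (\<lambda>n z. w ^ n * (F (of_real r * z) * cnj z ^ n))"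
  have cont: "continuous_on (sphere 0 1) (\<lambda>z. F (of_real r * z))"
    using dilation_continuous F r holomorphic_on_imp_continuous_on by blast
  obtain B where B: "\<And>z. norm z = 1 \<Longrightarrow> norm (F (of_real r * z)) \<le> B"
    using dilation_bounded[OF F r] by blast
  have "(\<lambda>n. LINT z|\<mm>. u n z) sums (LINT z|\<mm>. F (of_real r * z) / (1 - w * cnj z))"
  proof (rule circle_sums_integral)
    show "u n \<in> borel_measurable \<mm>" for n
      unfolding u_def by (intro continuous_imp_measurable_circle continuous_intros cont)
    show "norm (u n z) \<le> norm w ^ n * B" if "norm z = 1" for n z
      using that r B[OF that] by (simp add: u_def norm_mult norm_power mult_left_mono)
    show "summable (\<lambda>n. norm w ^ n * B)"
      using w by (intro summable_mult2 summable_geometric) auto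
    show "(\<lambda>n. u n z) sums (F (of_real r * z) / (1 - w * cnj z))" if "norm z = 1" for z
      using sums_mult[OF geometric_circle_sums[OF w that], of "F (of_real r * z)"]
      by (simp add: u_def mult_ac)
  qed
  moreover have "(LINT z|\<mm>. u n z) = taylor_coeff F n * (of_real r * w) ^ n" for n
    unfolding u_def using fourier_coeff_dilation[OF F r, of n] by (simp add: power_mult_distrib)
  moreover have "(\<lambda>n. taylor_coeff F n * (of_real r * w) ^ n) sums F (of_real r * w)"
  proof (intro taylor_sums F)
    have "r * norm w \<le> 1 * norm w" using r by (intro mult_right_mono) auto
    with w have "r * norm w < 1" by simp
    then show "norm (of_real r * w) < 1" using r by (simp add: norm_mult)
  qed
  ultimately show ?thesis by (simp add: sums_iff)
qed

lemma mean_value_dilation: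
  assumes F: "F holomorphic_on ball 0 1" and r: "0 \<le> r" "r < 1"
  shows "(LINT z|\<mm>. F (of_real r * z)) = F 0"
  using cauchy_formula_dilation[OF assms, of 0] by simp

section \<open>Square integrable functions\<close>

lemma Lp2_iff: "f \<in> Lp 2 \<longleftrightarrow> f \<in> borel_measurable \<mm> \<and> integrable \<mm> (\<lambda>z. (norm (f z))\<^sup>2)"
  by (simp add: Lp_def)

lemma lpnorm2: "lpnorm 2 f = sqrt (LINT z|\<mm>. (norm (f z))\<^sup>2)"
  by (simp add: lpnorm_def powr_half_sqrt)

lemma lpnorm2_square: "(lpnorm 2 f)\<^sup>2 = (LINT z|\<mm>. (norm (f z))\<^sup>2)"
  by (simp add: lpnorm2)

lemma lpnorm_nonneg [simp]: "0 \<le> lpnorm p f"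
  by (simp add: lpnorm_def)

lemma L2_mult_integrable:
  assumes "f \<in> Lp 2" "g \<in> Lp 2"
  shows "integrable \<mm> (\<lambda>z. f z * g z)"
proof (rule Bochner_Integration.integrable_bound)
  show "integrable \<mm> (\<lambda>z. (norm (f z))\<^sup>2 + (norm (g z))\<^sup>2)"
    using assms by (auto simp: Lp2_iff)
  show "(\<lambda>z. f z * g z) \<in> borel_measurable \<mm>"
    using assms by (auto simp: Lp2_iff)
  have "norm (f z * g z) \<le> norm ((norm (f z))\<^sup>2 + (norm (g z))\<^sup>2)" for z
  proof -
    have "2 * (norm (f z) * norm (g z)) \<le> (norm (f z))\<^sup>2 + (norm (g z))\<^sup>2"
      using sum_squares_bound[of "norm (f z)" "norm (g z)"] by (simp add: power2_eq_square)
    moreover have "0 \<le> norm (f z) * norm (g z)" by simp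
    ultimately have "norm (f z) * norm (g z) \<le> (norm (f z))\<^sup>2 + (norm (g z))\<^sup>2" by linarith
    then show ?thesis by (simp add: norm_mult)
  qed
  then show "AE z in \<mm>. norm (f z * g z) \<le> norm ((norm (f z))\<^sup>2 + (norm (g z))\<^sup>2)"
    by (intro AE_I2)
qed

text \<open>
For \<open>t > 0\<close> one has \<open>2 x y \<le> t x\<^sup>2 + y\<^sup>2 / t\<close>; integrating and choosing \<open>t\<close> as the quotient of two numbers slightly
larger than the norms gives the claim without a case distinction on vanishing norms.
\<close>

lemma L2_cauchy_schwarz_abs:
  assumes f: "f \<in> Lp 2" and g: "g \<in> Lp 2"
  shows "(LINT z|\<mm>. norm (f z * g z)) \<le> lpnorm 2 f * lpnorm 2 g"
proof -
  define I where "I = (LINT z|\<mm>. norm (f z * g z))"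
  have intf: "integrable \<mm> (\<lambda>z. (norm (f z))\<^sup>2)"
    and intg: "integrable \<mm> (\<lambda>z. (norm (g z))\<^sup>2)"
    using f g by (auto simp: Lp2_iff)
  have key: "I \<le> \<alpha> * \<beta>" if "lpnorm 2 f < \<alpha>" "lpnorm 2 g < \<beta>" for \<alpha> \<beta>
  proof -
    have pos: "0 < \<alpha>" "0 < \<beta>" using that lpnorm_nonneg by (metis le_less_trans)+
    \<comment> \<open>this choice minimizes the right-hand side of the inequality for the integrals\<close>
    define t where "t = \<beta> / \<alpha>"
    have t: "0 < t" using pos by (simp add: t_def)
    have pt: "norm (f z * g z) \<le> (t * (norm (f z))\<^sup>2 + (norm (g z))\<^sup>2 / t) / 2" for z
    proof -
      have "0 \<le> (t * norm (f z) - norm (g z))\<^sup>2 / t" using t by simp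
      also have "\<dots> = t * (norm (f z))\<^sup>2 + (norm (g z))\<^sup>2 / t - 2 * (norm (f z) * norm (g z))"
        using t by (simp add: power2_eq_square field_simps)
      finally show ?thesis by (simp add: norm_mult)
    qed
    have "I \<le> (LINT z|\<mm>. (t * (norm (f z))\<^sup>2 + (norm (g z))\<^sup>2 / t) / 2)"
      unfolding I_def using pt L2_mult_integrable[OF f g] intf intg
      by (intro integral_mono) auto
    also have "\<dots> = (t * (lpnorm 2 f)\<^sup>2 + (lpnorm 2 g)\<^sup>2 / t) / 2"
      using intf intg by (simp add: lpnorm2_square)
    also have "\<dots> \<le> (t * \<alpha>\<^sup>2 + \<beta>\<^sup>2 / t) / 2"
      using that t by (intro divide_right_mono add_mono mult_left_mono power_mono) auto
    also have "\<dots> = \<alpha> * \<beta>"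
      using pos by (simp add: t_def power2_eq_square field_simps)
    finally show ?thesis .
  qed
  have "I \<le> lpnorm 2 f * lpnorm 2 g"
  proof (rule tendsto_lowerbound)
    show "((\<lambda>e. (lpnorm 2 f + e) * (lpnorm 2 g + e)) \<longlongrightarrow> lpnorm 2 f * lpnorm 2 g) (at_right 0)"
      by (auto intro!: tendsto_eq_intros)
    show "\<forall>\<^sub>F e in at_right 0. I \<le> (lpnorm 2 f + e) * (lpnorm 2 g + e)"
      using eventually_at_right_less[of "0::real"] by eventually_elim (rule key, auto)
  qed simp
  then show ?thesis by (simp add: I_def)
qed

lemma L2_cauchy_schwarz:
  assumes "f \<in> Lp 2" "g \<in> Lp 2"
  shows "norm (LINT z|\<mm>. f z * g z) \<le> lpnorm 2 f * lpnorm 2 g"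
  using integral_norm_bound[of \<mm> "\<lambda>z. f z * g z"] L2_cauchy_schwarz_abs[OF assms]
  by linarith

lemma borel_measurable_cnj [measurable (raw)]:
  "f \<in> borel_measurable M \<Longrightarrow> (\<lambda>z. cnj (f z)) \<in> borel_measurable M"
  by (rule borel_measurable_continuous_on[of cnj]) (intro continuous_intros)

lemma Lp2_cnj: "f \<in> Lp 2 \<Longrightarrow> (\<lambda>z. cnj (f z)) \<in> Lp 2"
  by (auto simp: Lp2_iff)

lemma lpnorm_cnj [simp]: "lpnorm p (\<lambda>z. cnj (f z)) = lpnorm p f"
  by (simp add: lpnorm_def)

lemma Lp2_cmult: "f \<in> Lp 2 \<Longrightarrow> (\<lambda>z. c * f z) \<in> Lp 2"
  by (auto simp: Lp2_iff norm_mult power_mult_distrib)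

lemma Lp2_add:
  assumes f: "f \<in> Lp 2" and g: "g \<in> Lp 2"
  shows "(\<lambda>z. f z + g z) \<in> Lp 2"
  unfolding Lp2_iff
proof
  show "(\<lambda>z. f z + g z) \<in> borel_measurable \<mm>" using f g by (auto simp: Lp2_iff)
  show "integrable \<mm> (\<lambda>z. (norm (f z + g z))\<^sup>2)"
  proof (rule Bochner_Integration.integrable_bound)
    show "integrable \<mm> (\<lambda>z. 2 * ((norm (f z))\<^sup>2 + (norm (g z))\<^sup>2))"
      using assms by (auto simp: Lp2_iff)
    have "(norm (f z + g z))\<^sup>2 \<le> 2 * ((norm (f z))\<^sup>2 + (norm (g z))\<^sup>2)" for z
    proof -
      have "(norm (f z + g z))\<^sup>2 \<le> (norm (f z) + norm (g z))\<^sup>2"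
        by (intro power_mono norm_triangle_ineq) auto
      also have "\<dots> \<le> 2 * ((norm (f z))\<^sup>2 + (norm (g z))\<^sup>2)"
        using sum_squares_bound[of "norm (f z)" "norm (g z)"] by (simp add: power2_sum)
      finally show ?thesis .
    qed
    then show "AE z in \<mm>. norm ((norm (f z + g z))\<^sup>2) \<le> norm (2 * ((norm (f z))\<^sup>2 + (norm (g z))\<^sup>2))"
      by (intro AE_I2) (metis abs_of_nonneg real_norm_def zero_le_power2 order_trans)
  qed (use assms in \<open>auto simp: Lp2_iff\<close>)
qed

lemma Lp2_bounded_mult:
  assumes f: "f \<in> borel_measurable \<mm>" "AE z in \<mm>. norm (f z) \<le> B" and g: "g \<in> Lp 2"
  shows "(\<lambda>z. f z * g z) \<in> Lp 2"
  unfolding Lp2_iff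
proof
  show "integrable \<mm> (\<lambda>z. (norm (f z * g z))\<^sup>2)"
  proof (rule Bochner_Integration.integrable_bound)
    show "integrable \<mm> (\<lambda>z. B\<^sup>2 * (norm (g z))\<^sup>2)"
      using g by (auto simp: Lp2_iff)
    show "AE z in \<mm>. norm ((norm (f z * g z))\<^sup>2) \<le> norm (B\<^sup>2 * (norm (g z))\<^sup>2)"
      using f(2) by eventually_elim (simp add: norm_mult power_mult_distrib mult_right_mono power_mono)
  qed (use f g in \<open>auto simp: Lp2_iff\<close>)
qed (use f g in \<open>auto simp: Lp2_iff\<close>)

section \<open>Radial boundary values\<close>

text \<open>
A fixed sequence of radii tending to 1: the convergence theorems for integrals are about sequences.
\<close>

definition radius_seq :: "nat \<Rightarrow> real" where
  "radius_seq n = 1 - 1 / real (n + 2)"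

lemma radius_seq: "0 \<le> radius_seq n" "radius_seq n < 1"
  by (auto simp: radius_seq_def)

lemma filterlim_radius_seq: "filterlim radius_seq (at_left 1) sequentially"
  unfolding filterlim_at
proof
  have "(\<lambda>n. 1 / real (n + 2)) \<longlonglongrightarrow> 0"
    by (rule LIMSEQ_ignore_initial_segment[OF lim_1_over_n])
  from tendsto_diff[OF tendsto_const this, of 1] show "radius_seq \<longlonglongrightarrow> 1"
    by (simp add: radius_seq_def[abs_def])
qed (use radius_seq in \<open>auto simp: less_imp_neq\<close>)

lemma boundary_values_radius_seq:
  assumes "has_boundary_values F f"
  shows "AE z in \<mm>. (\<lambda>n. F (of_real (radius_seq n) * z)) \<longlonglongrightarrow> f z"
  using assms unfolding has_boundary_values_def
  by eventually_elim (rule filterlim_compose[OF _ filterlim_radius_seq])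

lemma boundary_values_cong:
  assumes "has_boundary_values F f" "AE z in \<mm>. f z = g z"
  shows "has_boundary_values F g"
  using assms unfolding has_boundary_values_def by (auto elim: eventually_elim2)

lemma bv_eq:
  assumes "((\<lambda>r::real. F (of_real r * z)) \<longlongrightarrow> l) (at_left 1)"
  shows "bv F z = l"
  unfolding bv_def using assms by (intro tendsto_Lim) auto

lemma AE_bv_eq:
  assumes "has_boundary_values F f"
  shows "AE z in \<mm>. bv F z = f z"
  using assms unfolding has_boundary_values_def by eventually_elim (rule bv_eq)

lemma has_boundary_values_bv:
  assumes "has_boundary_values F f"
  shows "has_boundary_values F (bv F)"
  by (rule boundary_values_cong[OF assms]) (use AE_bv_eq[OF assms] in eventually_elim, simp)

text \<open>
For a continuous function the approach to a left limit can be tested on rational arguments.  This expresses the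
existence of a radial limit by countably many conditions.
\<close>

lemma radial_limit_dense:
  fixes g :: "real \<Rightarrow> complex"
  assumes cont: "continuous_on {0..<1} g"
  shows "(g \<longlongrightarrow> l) (at_left 1) \<longleftrightarrow>
    (\<forall>n. \<exists>m. \<forall>q::rat. 1 - 1 / real (Suc m) < of_rat q \<and> of_rat q < (1::real) \<longrightarrow>
       norm (g (of_rat q) - l) \<le> 1 / real (Suc n))" (is "?L \<longleftrightarrow> ?R")
proof
  assume ?L
  show ?R
  proof
    fix n
    have "\<forall>\<^sub>F r in at_left 1. dist (g r) l < 1 / real (Suc n)"
      using \<open>?L\<close> by (rule tendstoD) simp
    then obtain b where b: "b < 1" "\<And>r. b < r \<Longrightarrow> r < 1 \<Longrightarrow> dist (g r) l < 1 / real (Suc n)"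
      unfolding eventually_at_left_field by blast
    obtain m where m: "1 / real (Suc m) < 1 - b"
      using reals_Archimedean[of "1 - b"] b(1) by (auto simp: inverse_eq_divide)
    show "\<exists>m. \<forall>q::rat. 1 - 1 / real (Suc m) < of_rat q \<and> of_rat q < (1::real) \<longrightarrow>
       norm (g (of_rat q) - l) \<le> 1 / real (Suc n)"
    proof (intro exI allI impI)
      fix q :: rat assume "1 - 1 / real (Suc m) < of_rat q \<and> of_rat q < (1::real)"
      then have "dist (g (of_rat q)) l < 1 / real (Suc n)" using m by (intro b) auto
      then show "norm (g (of_rat q) - l) \<le> 1 / real (Suc n)" by (simp add: dist_norm)
    qed
  qed
next
  assume R: ?R
  show ?L
  proof (rule tendstoI)
    fix e :: real assume "0 < e"
    then obtain n where n: "1 / real (Suc n) < e"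
      using reals_Archimedean[of e] by (auto simp: inverse_eq_divide)
    obtain m where m: "\<And>q::rat. 1 - 1 / real (Suc m) < of_rat q \<Longrightarrow> of_rat q < (1::real) \<Longrightarrow>
       norm (g (of_rat q) - l) \<le> 1 / real (Suc n)"
      using R by meson
    have "norm (g r - l) \<le> 1 / real (Suc n)" if r: "1 - 1 / real (Suc m) < r" "r < 1" for r
    proof (rule ccontr)
      assume neg: "\<not> norm (g r - l) \<le> 1 / real (Suc n)"
      have "1 / real (Suc m) \<le> 1" by simp
      with r have "0 < r" by linarith
      have "continuous_on {0<..<1} g" by (rule continuous_on_subset[OF cont]) auto
      then have "isCont g r"
        using \<open>0 < r\<close> r by (simp add: continuous_on_eq_continuous_at)
      then have "isCont (\<lambda>x. norm (g x - l)) r" by (intro continuous_intros)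
      then have "\<forall>\<^sub>F x in at r. 1 / real (Suc n) < norm (g x - l)"
        using neg by (intro order_tendstoD) (auto simp: isCont_def)
      then have "\<forall>\<^sub>F x in at_left r. 1 / real (Suc n) < norm (g x - l)"
        by (rule filter_leD[OF at_within_le_at])
      then obtain b where b: "b < r" "\<And>x. b < x \<Longrightarrow> x < r \<Longrightarrow> 1 / real (Suc n) < norm (g x - l)"
        unfolding eventually_at_left_field by blast
      obtain q where q: "max b (1 - 1 / real (Suc m)) < of_rat q" "of_rat q < r"
        using of_rat_dense[of "max b (1 - 1 / real (Suc m))" r] b r by auto
      with r have "of_rat q < (1::real)" by (meson less_trans)
      with q m[of q] b(2)[of "of_rat q"] show False by auto
    qed
    then show "\<forall>\<^sub>F x in at_left 1. dist (g x) l < e"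
      unfolding eventually_at_left_field
      using n by (intro exI[of _ "1 - 1 / real (Suc m)"]) (force simp: dist_norm)
  qed
qed

text \<open>
Where the radial limit exists it is the limit along a fixed sequence of radii, and elsewhere \<open>bv F\<close> has one constant
value.  So the point is that the set where the radial limit exists is measurable.
\<close>

lemma bv_measurable:
  assumes F: "F holomorphic_on ball 0 1"
  shows "bv F \<in> borel_measurable \<mm>"
proof -
  define L where "L z = lim (\<lambda>n. F (of_real (radius_seq n) * z))" for z
  define P where "P z \<longleftrightarrow> (\<forall>n. \<exists>m. \<forall>q::rat. 1 - 1 / real (Suc m) < of_rat q \<and> of_rat q < (1::real) \<longrightarrow>
       norm (F (of_real (of_rat q) * z) - L z) \<le> 1 / real (Suc n))" for z
  have [measurable]: "L \<in> borel_measurable \<mm>"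
    unfolding L_def[abs_def] by (intro borel_measurable_lim_metric dilation_measurable F radius_seq)
  have [measurable]: "Measurable.pred \<mm> P"
    unfolding P_def[abs_def]
  proof (intro pred_intros_countable)
    fix n m :: nat and q :: rat
    show "Measurable.pred \<mm> (\<lambda>z. 1 - 1 / real (Suc m) < of_rat q \<and> of_rat q < (1::real) \<longrightarrow>
       norm (F (of_real (of_rat q) * z) - L z) \<le> 1 / real (Suc n))"
    proof (cases "1 - 1 / real (Suc m) < of_rat q \<and> of_rat q < (1::real)")
      case True
      have "1 / real (Suc m) \<le> 1" by simp
      with True have "0 \<le> (of_rat q :: real)" by linarith
      with True have [measurable]: "(\<lambda>z. F (of_real (of_rat q) * z)) \<in> borel_measurable \<mm>"
        by (intro dilation_measurable F) auto
      have "Measurable.pred \<mm> (\<lambda>z. norm (F (of_real (of_rat q) * z) - L z) \<le> 1 / real (Suc n))"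
        by measurable
      then show ?thesis by (simp only: True simp_thms)
    next
      case False
      show ?thesis by (simp only: False simp_thms) simp
    qed
  qed
  have cont: "continuous_on {0..<1} (\<lambda>r. F (of_real r * z))" if "norm z = 1" for z
    by (rule continuous_on_compose2[OF holomorphic_on_imp_continuous_on[OF F]])
       (use that in \<open>auto intro!: continuous_intros simp: norm_mult\<close>)
  have eq: "bv F z = (if P z then L z else (THE l. False))" if z: "norm z = 1" for z
  proof (cases "\<exists>l. ((\<lambda>r. F (of_real r * z)) \<longlongrightarrow> l) (at_left 1)")
    case True
    then obtain l where l: "((\<lambda>r. F (of_real r * z)) \<longlongrightarrow> l) (at_left 1)" by blast
    have "L z = l"
      unfolding L_def by (intro limI filterlim_compose[OF l filterlim_radius_seq])
    moreover from l have "P z"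
      unfolding P_def radial_limit_dense[OF cont[OF z]] \<open>L z = l\<close> .
    ultimately show ?thesis using bv_eq[OF l] by simp
  next
    case False
    then have "\<not> P z"
      unfolding P_def using radial_limit_dense[OF cont[OF z]] by blast
    moreover have "bv F z = (THE l. False)"
      unfolding bv_def Topological_Spaces.Lim_def using False by (intro arg_cong[where f=The]) auto
    ultimately show ?thesis by simp
  qed
  have "(\<lambda>z. if P z then L z else (THE l. False)) \<in> borel_measurable \<mm>"
    by measurable
  moreover have "bv F \<in> borel_measurable \<mm> \<longleftrightarrow>
      (\<lambda>z. if P z then L z else (THE l. False)) \<in> borel_measurable \<mm>"
    by (rule measurable_cong) (simp add: eq)
  ultimately show ?thesis by blast
qed

section \<open>Bounded analytic functions\<close>

text \<open>
An element of \<open>H\<^sup>\<infinity>\<close>, represented by its two incarnations: \<open>F\<close> on the disc and \<open>f\<close> on the circle.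
\<close>

definition bdd_hardy :: "(complex \<Rightarrow> complex) \<Rightarrow> (complex \<Rightarrow> complex) \<Rightarrow> bool" where
  "bdd_hardy F f \<longleftrightarrow> F \<in> disc_hardy_inf \<and> has_boundary_values F f \<and> f \<in> borel_measurable \<mm>"

lemma bdd_hardy_holomorphic: "bdd_hardy F f \<Longrightarrow> F holomorphic_on ball 0 1"
  by (simp add: bdd_hardy_def disc_hardy_inf_def)

lemma bdd_hardy_measurable: "bdd_hardy F f \<Longrightarrow> f \<in> borel_measurable \<mm>"
  by (simp add: bdd_hardy_def)

lemma bdd_hardy_boundary: "bdd_hardy F f \<Longrightarrow> has_boundary_values F f"
  by (simp add: bdd_hardy_def)

lemma boundary_values_bound:
  assumes "has_boundary_values F f" "\<And>w. norm w < 1 \<Longrightarrow> norm (F w) \<le> B"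
  shows "AE z in \<mm>. norm (f z) \<le> B"
  using boundary_values_radius_seq[OF assms(1)] AE_circle_norm
proof eventually_elim
  case (elim z)
  from tendsto_norm[OF elim(1)] show ?case
  proof (rule LIMSEQ_le_const2, intro exI allI impI)
    fix n show "norm (F (of_real (radius_seq n) * z)) \<le> B"
      using elim(2) radius_seq[of n] by (intro assms(2)) (simp add: norm_mult)
  qed
qed

lemma bdd_hardy_bound:
  assumes "bdd_hardy F f"
  shows "\<exists>B\<ge>0. (\<forall>w. norm w < 1 \<longrightarrow> norm (F w) \<le> B) \<and> (AE z in \<mm>. norm (f z) \<le> B)"
proof -
  have "bounded (F ` ball 0 1)" using assms by (simp add: bdd_hardy_def disc_hardy_inf_def)
  then obtain B where "\<forall>x\<in>F ` ball 0 1. norm x \<le> B" using bounded_iff by metis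
  then have B: "norm (F w) \<le> B" if "norm w < 1" for w using that by simp
  moreover have "0 \<le> B" using B[of 0] norm_ge_zero[of "F 0"] by (simp del: norm_ge_zero)
  moreover have "AE z in \<mm>. norm (f z) \<le> B"
    using boundary_values_bound[OF bdd_hardy_boundary[OF assms] B] .
  ultimately show ?thesis by blast
qed

lemma bdd_hardyI:
  assumes "F holomorphic_on ball 0 1" "\<And>w. norm w < 1 \<Longrightarrow> norm (F w) \<le> B"
    "has_boundary_values F f" "f \<in> borel_measurable \<mm>"
  shows "bdd_hardy F f"
proof -
  have "bounded (F ` ball 0 1)" unfolding bounded_iff using assms(2) by (intro exI[of _ B]) simp
  with assms show ?thesis by (simp add: bdd_hardy_def disc_hardy_inf_def)
qed

lemma bdd_hardy_mult:
  assumes F: "bdd_hardy F f" and G: "bdd_hardy G g"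
  shows "bdd_hardy (\<lambda>w. F w * G w) (\<lambda>z. f z * g z)"
proof -
  obtain A where A: "0 \<le> A" "\<And>w. norm w < 1 \<Longrightarrow> norm (F w) \<le> A"
    "AE z in \<mm>. norm (f z) \<le> A"
    using bdd_hardy_bound[OF F] by metis
  obtain B where B: "0 \<le> B" "\<And>w. norm w < 1 \<Longrightarrow> norm (G w) \<le> B"
    "AE z in \<mm>. norm (g z) \<le> B"
    using bdd_hardy_bound[OF G] by metis
  show ?thesis
  proof (rule bdd_hardyI)
    show "norm (F w * G w) \<le> A * B" if "norm w < 1" for w
      using A B that by (simp add: norm_mult mult_mono)
    show "has_boundary_values (\<lambda>w. F w * G w) (\<lambda>z. f z * g z)"
      using bdd_hardy_boundary[OF F] bdd_hardy_boundary[OF G] unfolding has_boundary_values_def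
      by eventually_elim (rule tendsto_mult)
  qed (use bdd_hardy_holomorphic[OF F] bdd_hardy_holomorphic[OF G] bdd_hardy_measurable[OF F] bdd_hardy_measurable[OF G]
       in \<open>auto intro!: holomorphic_intros\<close>)
qed

lemma bdd_hardy_diff:
  assumes F: "bdd_hardy F f" and G: "bdd_hardy G g"
  shows "bdd_hardy (\<lambda>w. F w - G w) (\<lambda>z. f z - g z)"
proof -
  obtain A where A: "0 \<le> A" "\<And>w. norm w < 1 \<Longrightarrow> norm (F w) \<le> A"
    "AE z in \<mm>. norm (f z) \<le> A"
    using bdd_hardy_bound[OF F] by metis
  obtain B where B: "0 \<le> B" "\<And>w. norm w < 1 \<Longrightarrow> norm (G w) \<le> B"
    "AE z in \<mm>. norm (g z) \<le> B"
    using bdd_hardy_bound[OF G] by metis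
  show ?thesis
  proof (rule bdd_hardyI)
    show "norm (F w - G w) \<le> A + B" if "norm w < 1" for w
      using norm_triangle_ineq4[of "F w" "G w"] A(2)[OF that] B(2)[OF that] by linarith
    show "has_boundary_values (\<lambda>w. F w - G w) (\<lambda>z. f z - g z)"
      using bdd_hardy_boundary[OF F] bdd_hardy_boundary[OF G] unfolding has_boundary_values_def
      by eventually_elim (rule tendsto_diff)
  qed (use bdd_hardy_holomorphic[OF F] bdd_hardy_holomorphic[OF G] bdd_hardy_measurable[OF F] bdd_hardy_measurable[OF G]
       in \<open>auto intro!: holomorphic_intros\<close>)
qed

lemma of_real_mult_at_left: "((\<lambda>r::real. of_real r * z) \<longlongrightarrow> (z::complex)) (at_left 1)"
  by (auto intro!: tendsto_eq_intros)

lemma eventually_at_left_1: "\<forall>\<^sub>F r in at_left (1::real). 0 < r \<and> r < 1"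
  unfolding eventually_at_left_field by (intro exI[of _ 0]) auto

lemma continuous_radial_limit:
  fixes F :: "complex \<Rightarrow> complex"
  assumes "continuous_on (cball 0 1) F" "norm z = 1"
  shows "((\<lambda>r::real. F (of_real r * z)) \<longlongrightarrow> F z) (at_left 1)"
proof (rule continuous_on_tendsto_compose[OF assms(1) of_real_mult_at_left])
  show "\<forall>\<^sub>F r in at_left 1. of_real r * z \<in> cball 0 1"
    using eventually_at_left_1 by eventually_elim (use assms in \<open>simp add: norm_mult\<close>)
qed (use assms in simp)

lemma bdd_hardy_continuous:
  assumes "F holomorphic_on ball 0 1" "continuous_on (cball 0 1) F"
  shows "bdd_hardy F F"
proof -
  have "compact (F ` cball 0 1)" by (intro compact_continuous_image assms) auto
  then obtain B where B: "\<forall>x\<in>F ` cball 0 1. norm x \<le> B"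
    using compact_imp_bounded bounded_iff by metis
  show ?thesis
  proof (rule bdd_hardyI)
    show "norm (F w) \<le> B" if "norm w < 1" for w using that B by auto
    show "has_boundary_values F F"
      unfolding has_boundary_values_def
      using AE_circle_norm by eventually_elim (rule continuous_radial_limit[OF assms(2)])
    show "F \<in> borel_measurable \<mm>"
      by (intro continuous_imp_measurable_circle continuous_on_subset[OF assms(2)]) auto
  qed fact
qed

lemma bdd_hardy_ident: "bdd_hardy (\<lambda>z. z) (\<lambda>z. z)"
  by (intro bdd_hardy_continuous holomorphic_intros continuous_intros)

lemma bdd_hardy_const: "bdd_hardy (\<lambda>_. c) (\<lambda>_. c)"
  by (intro bdd_hardy_continuous holomorphic_intros continuous_intros)

lemma bdd_hardy_szego:
  assumes "norm w < 1"
  shows "bdd_hardy (\<lambda>z. 1 / (1 - w * z)) (\<lambda>z. 1 / (1 - w * z))"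
  using cauchy_kernel_nonzero[OF assms]
  by (intro bdd_hardy_continuous holomorphic_intros continuous_intros) (auto simp: less_imp_le)

lemma bdd_hardy_integrable:
  assumes "bdd_hardy F f"
  shows "integrable \<mm> f"
proof -
  obtain B where B: "0 \<le> B" "\<And>w. norm w < 1 \<Longrightarrow> norm (F w) \<le> B"
    "AE z in \<mm>. norm (f z) \<le> B"
    using bdd_hardy_bound[OF assms] by metis
  from B(3) show ?thesis by (intro circle_integrable_bounded bdd_hardy_measurable[OF assms])
qed

lemma bdd_hardy_Linf: "bdd_hardy F f \<Longrightarrow> f \<in> Linf"
  unfolding Linf_def using bdd_hardy_bound[of F f] by (auto intro: bdd_hardy_measurable)

lemma bdd_hardy_Hinf: "bdd_hardy F f \<Longrightarrow> f \<in> Hinf"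
  using bdd_hardy_Linf[of F f] by (auto simp: Hinf_def bdd_hardy_def)

lemma Linf_Lp:
  assumes "f \<in> Linf" "0 \<le> p"
  shows "f \<in> Lp p"
proof -
  obtain C where C: "AE z in \<mm>. norm (f z) \<le> C" and [measurable]: "f \<in> borel_measurable \<mm>"
    using assms by (auto simp: Linf_def)
  have "AE z in \<mm>. norm (norm (f z) powr p) \<le> C powr p"
    using C by eventually_elim (use assms in \<open>auto intro!: powr_mono2\<close>)
  then have "integrable \<mm> (\<lambda>z. norm (f z) powr p)"
    by (intro circle_integrable_bounded) measurable
  then show ?thesis by (simp add: Lp_def)
qed

lemma bdd_hardy_Lp2: "bdd_hardy F f \<Longrightarrow> f \<in> Lp 2"
  by (intro Linf_Lp bdd_hardy_Linf) auto

lemma bounded_disc_hardy: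
  assumes "F holomorphic_on ball 0 1" "\<And>w. norm w < 1 \<Longrightarrow> norm (F w) \<le> B" "0 \<le> p"
  shows "F \<in> disc_hardy p"
  unfolding disc_hardy_def
proof (intro CollectI conjI exI ballI)
  fix r :: real assume "r \<in> {0..<1}"
  then have r: "0 \<le> r" "r < 1" by auto
  have b: "norm (F (of_real r * z)) powr p \<le> B powr p" if "norm z = 1" for z
    using that r assms by (intro powr_mono2 assms) (auto simp: norm_mult)
  have "(LINT z|\<mm>. norm (F (of_real r * z)) powr p) \<le> (LINT z|\<mm>. B powr p)"
  proof (rule integral_mono)
    have [measurable]: "(\<lambda>z. F (of_real r * z)) \<in> borel_measurable \<mm>"
      by (rule dilation_measurable[OF assms(1) r])
    show "integrable \<mm> (\<lambda>z. norm (F (of_real r * z)) powr p)"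
      using b by (intro circle_integrable_bounded[of _ "B powr p"] AE_I2) auto
  qed (use b in auto)
  then show "(LINT z|\<mm>. norm (F (of_real r * z)) powr p) \<le> B powr p" by simp
qed fact

lemma bdd_hardy_Hp2:
  assumes "bdd_hardy F f"
  shows "f \<in> Hp 2"
proof -
  obtain B where B: "0 \<le> B" "\<And>w. norm w < 1 \<Longrightarrow> norm (F w) \<le> B"
    "AE z in \<mm>. norm (f z) \<le> B"
    using bdd_hardy_bound[OF assms] by metis
  have "F \<in> disc_hardy 2" using bdd_hardy_holomorphic[OF assms] B(2) by (intro bounded_disc_hardy) auto
  then show ?thesis
    using bdd_hardy_Lp2[OF assms] bdd_hardy_boundary[OF assms] by (auto simp: Hp_def)
qed

lemma bdd_hardy_bv:
  assumes "bdd_hardy F f"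
  shows "bdd_hardy F (bv F)"
  using assms bv_measurable[OF bdd_hardy_holomorphic[OF assms]] has_boundary_values_bv
  by (auto simp: bdd_hardy_def)

lemma bdd_hardy_cauchy:
  assumes F: "bdd_hardy F f" and w: "norm w < 1"
  shows "(LINT z|\<mm>. f z / (1 - w * cnj z)) = F w"
proof -
  note hol = bdd_hardy_holomorphic[OF F]
  obtain B where B: "0 \<le> B" "\<And>w. norm w < 1 \<Longrightarrow> norm (F w) \<le> B"
    "AE z in \<mm>. norm (f z) \<le> B"
    using bdd_hardy_bound[OF F] by metis
  have nz: "1 - w * cnj z \<noteq> 0" if "norm z = 1" for z
    using cauchy_kernel_nonzero[OF w, of "cnj z"] that by simp
  have K: "continuous_on (sphere 0 1) (\<lambda>z. 1 / (1 - w * cnj z))"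
    using nz by (intro continuous_intros) auto
  have Km: "(\<lambda>z. 1 / (1 - w * cnj z)) \<in> borel_measurable \<mm>"
    by (rule continuous_imp_measurable_circle[OF K])
  have "(\<lambda>n. LINT z|\<mm>. F (of_real (radius_seq n) * z) * (1 / (1 - w * cnj z)))
      \<longlonglongrightarrow> (LINT z|\<mm>. f z * (1 / (1 - w * cnj z)))"
  proof (rule integral_dominated_convergence)
    show "(\<lambda>z. f z * (1 / (1 - w * cnj z))) \<in> borel_measurable \<mm>"
      by (intro borel_measurable_times bdd_hardy_measurable[OF F] Km)
    show "(\<lambda>z. F (of_real (radius_seq n) * z) * (1 / (1 - w * cnj z))) \<in> borel_measurable \<mm>" for n
      by (intro borel_measurable_times dilation_measurable[OF hol] Km radius_seq)
    show "integrable \<mm> (\<lambda>z. B * norm (1 / (1 - w * cnj z)))"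
      by (intro circle_continuous_integrable continuous_intros K)
    show "AE z in \<mm>. (\<lambda>n. F (of_real (radius_seq n) * z) * (1 / (1 - w * cnj z)))
        \<longlonglongrightarrow> f z * (1 / (1 - w * cnj z))"
      using boundary_values_radius_seq[OF bdd_hardy_boundary[OF F]]
      by eventually_elim (intro tendsto_intros)
    show "AE z in \<mm>. norm (F (of_real (radius_seq n) * z) * (1 / (1 - w * cnj z)))
        \<le> B * norm (1 / (1 - w * cnj z))" for n
      using AE_circle_norm
    proof eventually_elim
      case (elim z)
      have "norm (F (of_real (radius_seq n) * z)) \<le> B"
        using elim radius_seq[of n] by (intro B(2)) (simp add: norm_mult)
      then show ?case by (simp only: norm_mult mult_right_mono norm_ge_zero)
    qed
  qed
  then have "(\<lambda>n. F (of_real (radius_seq n) * w)) \<longlonglongrightarrow> (LINT z|\<mm>. f z / (1 - w * cnj z))"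
    using cauchy_formula_dilation[OF hol radius_seq w] by simp
  moreover have "(\<lambda>n. F (of_real (radius_seq n) * w)) \<longlonglongrightarrow> F w"
  proof (rule continuous_on_tendsto_compose[OF holomorphic_on_imp_continuous_on[OF hol]])
    show "(\<lambda>n. of_real (radius_seq n) * w) \<longlonglongrightarrow> w"
      by (rule filterlim_compose[OF of_real_mult_at_left filterlim_radius_seq])
    have "radius_seq n * norm w \<le> 1 * norm w" for n
      using radius_seq[of n] by (intro mult_right_mono) auto
    then have "norm (of_real (radius_seq n) * w) < 1" for n
      using w radius_seq[of n] by (simp add: norm_mult) (meson le_less_trans)
    then show "\<forall>\<^sub>F n in sequentially. of_real (radius_seq n) * w \<in> ball 0 1" by simp
  qed (use w in simp)
  ultimately show ?thesis by (rule LIMSEQ_unique)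
qed

text \<open>
The quadratic means increase with the radius, and by dominated convergence they tend to the one of the boundary function.
\<close>

lemma bdd_hardy_dilation_norm_le:
  assumes F: "bdd_hardy F f" and r: "0 \<le> r" "r < 1"
  shows "(LINT z|\<mm>. (norm (F (of_real r * z)))\<^sup>2) \<le> (LINT z|\<mm>. (norm (f z))\<^sup>2)"
proof -
  note hol = bdd_hardy_holomorphic[OF F]
  obtain B where B: "0 \<le> B" "\<And>w. norm w < 1 \<Longrightarrow> norm (F w) \<le> B"
    "AE z in \<mm>. norm (f z) \<le> B"
    using bdd_hardy_bound[OF F] by metis
  have "(\<lambda>n. LINT z|\<mm>. (norm (F (of_real (radius_seq n) * z)))\<^sup>2)
      \<longlonglongrightarrow> (LINT z|\<mm>. (norm (f z))\<^sup>2)"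
  proof (rule integral_dominated_convergence)
    show "(\<lambda>z. (norm (f z))\<^sup>2) \<in> borel_measurable \<mm>"
      using bdd_hardy_measurable[OF F] by simp
    show "(\<lambda>z. (norm (F (of_real (radius_seq n) * z)))\<^sup>2) \<in> borel_measurable \<mm>" for n
      using dilation_measurable[OF hol radius_seq] by simp
    show "AE z in \<mm>. (\<lambda>n. (norm (F (of_real (radius_seq n) * z)))\<^sup>2) \<longlonglongrightarrow> (norm (f z))\<^sup>2"
      using boundary_values_radius_seq[OF bdd_hardy_boundary[OF F]]
      by eventually_elim (intro tendsto_intros)
    show "AE z in \<mm>. norm ((norm (F (of_real (radius_seq n) * z)))\<^sup>2) \<le> B\<^sup>2" for n
      using AE_circle_norm
    proof eventually_elim
      case (elim z)
      have "norm (F (of_real (radius_seq n) * z)) \<le> B"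
        using elim radius_seq[of n] by (intro B(2)) (simp add: norm_mult)
      then show ?case by (simp add: power_mono)
    qed
  qed simp
  moreover have "\<forall>\<^sub>F n in sequentially. r < radius_seq n"
    using filterlim_radius_seq r by (auto simp: filterlim_at intro: order_tendstoD)
  then have "\<forall>\<^sub>F n in sequentially. (LINT z|\<mm>. (norm (F (of_real r * z)))\<^sup>2)
      \<le> (LINT z|\<mm>. (norm (F (of_real (radius_seq n) * z)))\<^sup>2)"
    by eventually_elim (intro dilation_norm_mono[OF hol r(1)] radius_seq, simp)
  ultimately show ?thesis
    by (intro tendsto_lowerbound) auto
qed

section \<open>Hardy spaces\<close>

lemma disc_hardy_dilation_integrable:
  assumes F: "F holomorphic_on ball 0 1" and r: "0 \<le> r" "r < 1" and "0 \<le> p"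
  shows "integrable \<mm> (\<lambda>z. norm (F (of_real r * z)) powr p)"
proof -
  obtain B where B: "\<And>z. norm z = 1 \<Longrightarrow> norm (F (of_real r * z)) \<le> B"
    using dilation_bounded[OF F r] by blast
  have [measurable]: "(\<lambda>z. F (of_real r * z)) \<in> borel_measurable \<mm>"
    by (rule dilation_measurable[OF F r])
  show ?thesis
    using B \<open>0 \<le> p\<close> by (intro circle_integrable_bounded[of _ "B powr p"] AE_I2) (auto intro!: powr_mono2)
qed

lemma disc_hardyI:
  assumes "F holomorphic_on ball 0 1"
    and "\<And>r. 0 \<le> r \<Longrightarrow> r < 1 \<Longrightarrow> (LINT z|\<mm>. norm (F (of_real r * z)) powr p) \<le> C"
  shows "F \<in> disc_hardy p"
  unfolding disc_hardy_def using assms by (intro CollectI conjI exI[of _ C] ballI) auto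

lemma disc_hardyE:
  assumes "F \<in> disc_hardy p"
  obtains C where "F holomorphic_on ball 0 1"
    "\<forall>r. 0 \<le> r \<longrightarrow> r < 1 \<longrightarrow> (LINT z|\<mm>. norm (F (of_real r * z)) powr p) \<le> C"
  using assms unfolding disc_hardy_def by (auto simp: Ball_def)

text \<open>
The constant comes from \<open>|a + b| \<le> 2 max |a| |b|\<close>, which works for all exponents at once.
\<close>

lemma disc_hardy_add:
  assumes F: "F \<in> disc_hardy p" and G: "G \<in> disc_hardy p" and p: "0 \<le> p"
  shows "(\<lambda>w. F w + G w) \<in> disc_hardy p"
proof -
  obtain A where hF: "F holomorphic_on ball 0 1" and
    A: "\<forall>r. 0 \<le> r \<longrightarrow> r < 1 \<longrightarrow> (LINT z|\<mm>. norm (F (of_real r * z)) powr p) \<le> A"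
    using F by (rule disc_hardyE)
  obtain B where hG: "G holomorphic_on ball 0 1" and
    B: "\<forall>r. 0 \<le> r \<longrightarrow> r < 1 \<longrightarrow> (LINT z|\<mm>. norm (G (of_real r * z)) powr p) \<le> B"
    using G by (rule disc_hardyE)
  have pt: "norm (a + b) powr p \<le> 2 powr p * (norm a powr p + norm b powr p)" for a b :: complex
  proof -
    have "norm (a + b) \<le> 2 * max (norm a) (norm b)"
      using norm_triangle_ineq[of a b] by (simp add: max_def)
    then have "norm (a + b) powr p \<le> (2 * max (norm a) (norm b)) powr p"
      using p by (intro powr_mono2) auto
    also have "\<dots> = 2 powr p * max (norm a) (norm b) powr p" by (simp add: powr_mult)
    also have "max (norm a) (norm b) powr p \<le> norm a powr p + norm b powr p" by (simp add: max_def)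
    finally show ?thesis by simp
  qed
  show ?thesis
  proof (rule disc_hardyI)
    show "(\<lambda>w. F w + G w) holomorphic_on ball 0 1" by (intro holomorphic_intros hF hG)
  next
    fix r :: real assume r: "0 \<le> r" "r < 1"
    have "(LINT z|\<mm>. norm (F (of_real r * z) + G (of_real r * z)) powr p)
      \<le> (LINT z|\<mm>. 2 powr p * (norm (F (of_real r * z)) powr p + norm (G (of_real r * z)) powr p))"
      using disc_hardy_dilation_integrable[OF hF r p] disc_hardy_dilation_integrable[OF hG r p]
        disc_hardy_dilation_integrable[OF holomorphic_on_add[OF hF hG] r p] pt
      by (intro integral_mono) auto
    also have "\<dots> = 2 powr p * ((LINT z|\<mm>. norm (F (of_real r * z)) powr p)
        + (LINT z|\<mm>. norm (G (of_real r * z)) powr p))"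
      using disc_hardy_dilation_integrable[OF hF r p] disc_hardy_dilation_integrable[OF hG r p] by simp
    also have "\<dots> \<le> 2 powr p * (A + B)"
      using A B r by (intro mult_left_mono add_mono) auto
    finally show "(LINT z|\<mm>. norm (F (of_real r * z) + G (of_real r * z)) powr p) \<le> 2 powr p * (A + B)" .
  qed
qed

lemma disc_hardy_bounded_mult:
  assumes G: "G \<in> disc_hardy p" and F: "F holomorphic_on ball 0 1" "\<And>w. norm w < 1 \<Longrightarrow> norm (F w) \<le> B"
    and p: "0 \<le> p"
  shows "(\<lambda>w. F w * G w) \<in> disc_hardy p"
proof -
  obtain A where hG: "G holomorphic_on ball 0 1" and
    A: "\<forall>r. 0 \<le> r \<longrightarrow> r < 1 \<longrightarrow> (LINT z|\<mm>. norm (G (of_real r * z)) powr p) \<le> A"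
    using G by (rule disc_hardyE)
  show ?thesis
  proof (rule disc_hardyI)
    show hol: "(\<lambda>w. F w * G w) holomorphic_on ball 0 1" by (intro holomorphic_intros hG F)
    fix r :: real assume r: "0 \<le> r" "r < 1"
    have "(LINT z|\<mm>. norm (F (of_real r * z) * G (of_real r * z)) powr p)
      \<le> (LINT z|\<mm>. B powr p * norm (G (of_real r * z)) powr p)"
    proof (rule integral_mono)
      fix z assume "z \<in> space \<mm>"
      then have "norm (F (of_real r * z)) powr p \<le> B powr p"
        using r p by (intro powr_mono2 F(2)) (auto simp: norm_mult)
      then show "norm (F (of_real r * z) * G (of_real r * z)) powr p \<le> B powr p * norm (G (of_real r * z)) powr p"
        by (simp add: norm_mult powr_mult mult_right_mono)
    qed (use disc_hardy_dilation_integrable[OF hG r p] disc_hardy_dilation_integrable[OF hol r p] in auto)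
    also have "\<dots> = B powr p * (LINT z|\<mm>. norm (G (of_real r * z)) powr p)" by simp
    also have "\<dots> \<le> B powr p * A" using A r by (intro mult_left_mono) auto
    finally show "(LINT z|\<mm>. norm (F (of_real r * z) * G (of_real r * z)) powr p) \<le> B powr p * A" .
  qed
qed

lemma bdd_hardy_mult_Hp2:
  assumes F: "bdd_hardy F f" and h: "h \<in> Hp 2"
  shows "(\<lambda>z. f z * h z) \<in> Hp 2"
proof -
  obtain B where B: "0 \<le> B" "\<And>w. norm w < 1 \<Longrightarrow> norm (F w) \<le> B" "AE z in \<mm>. norm (f z) \<le> B"
    using bdd_hardy_bound[OF F] by metis
  obtain H where H: "H \<in> disc_hardy 2" "has_boundary_values H h" and hL: "h \<in> Lp 2"
    using h by (auto simp: Hp_def)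
  have "has_boundary_values (\<lambda>w. F w * H w) (\<lambda>z. f z * h z)"
    using bdd_hardy_boundary[OF F] H(2) unfolding has_boundary_values_def
    by eventually_elim (rule tendsto_mult)
  moreover have "(\<lambda>w. F w * H w) \<in> disc_hardy 2"
    by (rule disc_hardy_bounded_mult[OF H(1) bdd_hardy_holomorphic[OF F] B(2)]) auto
  moreover have "(\<lambda>z. f z * h z) \<in> Lp 2"
    by (rule Lp2_bounded_mult[OF bdd_hardy_measurable[OF F] B(3) hL])
  ultimately show ?thesis by (auto simp: Hp_def)
qed

text \<open>
Almost everywhere convergence and bounded \<open>L\<^sup>2\<close> norms imply convergence in \<open>L\<^sup>1\<close>.  The differences \<open>d\<close> are split by
\<open>d \<le> min d l + d\<^sup>2 / l\<close> for a large number \<open>l\<close>: the first term is handled by dominated convergence,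
the integral of the second is of order \<open>1 / l\<close>.
\<close>

lemma Hp2_dilates_L1:
  assumes F: "F \<in> disc_hardy 2" "has_boundary_values F f" and f: "f \<in> Lp 2"
  shows "(\<lambda>n. LINT z|\<mm>. norm (F (of_real (radius_seq n) * z) - f z)) \<longlonglongrightarrow> 0"
proof -
  obtain C where hF: "F holomorphic_on ball 0 1" and
    C: "\<forall>r. 0 \<le> r \<longrightarrow> r < 1 \<longrightarrow> (LINT z|\<mm>. norm (F (of_real r * z)) powr 2) \<le> C"
    using F(1) by (rule disc_hardyE)
  define d where "d n z = norm (F (of_real (radius_seq n) * z) - f z)" for n z
  have F2: "(\<lambda>z. F (of_real (radius_seq n) * z)) \<in> Lp 2" for n
    unfolding Lp_def using disc_hardy_dilation_integrable[OF hF radius_seq, of 2] dilation_measurable[OF hF radius_seq]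
    by simp
  have D2: "(\<lambda>z. F (of_real (radius_seq n) * z) - f z) \<in> Lp 2" for n
    using Lp2_add[OF F2[of n] Lp2_cmult[OF f, of "-1"]] by simp
  have [measurable]: "d n \<in> borel_measurable \<mm>" for n
    using D2[of n] by (auto simp: d_def[abs_def] Lp2_iff)
  have d2int: "integrable \<mm> (\<lambda>z. (d n z)\<^sup>2)" for n
    using D2[of n] by (simp add: d_def Lp2_iff)
  have d1int: "integrable \<mm> (d n)" for n
    using L2_mult_integrable[OF D2[of n] bdd_hardy_Lp2[OF bdd_hardy_const[of 1]]]
    by (auto simp: d_def[abs_def])
  define K where "K = 2 * (C + (LINT z|\<mm>. (norm (f z))\<^sup>2)) + 1"
  have dK: "(LINT z|\<mm>. (d n z)\<^sup>2) \<le> K" for n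
  proof -
    have pt: "(d n z)\<^sup>2 \<le> 2 * ((norm (F (of_real (radius_seq n) * z)))\<^sup>2 + (norm (f z))\<^sup>2)" for z
    proof -
      have "(d n z)\<^sup>2 \<le> (norm (F (of_real (radius_seq n) * z)) + norm (f z))\<^sup>2"
        unfolding d_def by (intro power_mono norm_triangle_ineq4) auto
      also have "\<dots> \<le> 2 * ((norm (F (of_real (radius_seq n) * z)))\<^sup>2 + (norm (f z))\<^sup>2)"
        using sum_squares_bound[of "norm (F (of_real (radius_seq n) * z))" "norm (f z)"] by (simp add: power2_sum)
      finally show ?thesis .
    qed
    have "(LINT z|\<mm>. (d n z)\<^sup>2)
      \<le> (LINT z|\<mm>. 2 * ((norm (F (of_real (radius_seq n) * z)))\<^sup>2 + (norm (f z))\<^sup>2))"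
      using pt d2int F2[of n] f by (intro integral_mono) (auto simp: Lp2_iff)
    also have "\<dots> = 2 * ((LINT z|\<mm>. (norm (F (of_real (radius_seq n) * z)))\<^sup>2) + (LINT z|\<mm>. (norm (f z))\<^sup>2))"
      using F2[of n] f by (simp add: Lp2_iff)
    also have "\<dots> \<le> K"
      using C[rule_format, OF radius_seq(1)[of n] radius_seq(2)[of n]] by (simp add: K_def)
    finally show ?thesis .
  qed
  have "0 \<le> (LINT z|\<mm>. (d 0 z)\<^sup>2)" by simp
  then have K0: "0 < K + 1" using dK[of 0] by linarith
  have min0: "(\<lambda>n. LINT z|\<mm>. min (d n z) L) \<longlonglongrightarrow> 0" if L: "0 < L" for L :: real
  proof -
    have "(\<lambda>n. LINT z|\<mm>. min (d n z) L) \<longlonglongrightarrow> (LINT z|\<mm>. 0)"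
    proof (rule integral_dominated_convergence)
      show "AE z in \<mm>. (\<lambda>n. min (d n z) L) \<longlonglongrightarrow> 0"
        using boundary_values_radius_seq[OF F(2)]
      proof eventually_elim
        case (elim z)
        then have "(\<lambda>n. d n z) \<longlonglongrightarrow> 0" unfolding d_def by (intro tendsto_norm_zero) (simp add: LIM_zero)
        from tendsto_min[OF this tendsto_const[of L]] show ?case using L by simp
      qed
      show "AE z in \<mm>. norm (min (d n z) L) \<le> L" for n
        using L by (intro AE_I2) (auto simp: d_def)
    qed auto
    then show ?thesis by simp
  qed
  show ?thesis
  proof (rule LIMSEQ_I)
    fix e :: real assume e: "0 < e"
    define L where "L = 2 * (K + 1) / e"
    have L: "0 < L" using K0 e by (simp add: L_def)
    have pt: "d n z \<le> min (d n z) L + (d n z)\<^sup>2 / L" for n z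
    proof (cases "d n z \<le> L")
      case False
      then have "d n z * L \<le> d n z * d n z" using L by (intro mult_left_mono) auto
      then have "d n z \<le> (d n z)\<^sup>2 / L" using L by (simp add: pos_le_divide_eq power2_eq_square)
      then show ?thesis using L False by (simp add: min_def)
    qed (use L in simp)
    have mint: "integrable \<mm> (\<lambda>z. min (d n z) L)" for n
    proof (rule circle_integrable_bounded[of _ L])
      show "AE z in \<mm>. norm (min (d n z) L) \<le> L"
        using L by (intro AE_I2) (auto simp: d_def min_def)
    qed measurable
    obtain N where N: "\<forall>n\<ge>N. norm ((LINT z|\<mm>. min (d n z) L) - 0) < e / 2"
      using LIMSEQ_D[OF min0[OF L], of "e/2"] e by auto
    show "\<exists>N. \<forall>n\<ge>N. norm ((LINT z|\<mm>. norm (F (of_real (radius_seq n) * z) - f z)) - 0) < e"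
    proof (intro exI allI impI)
      fix n assume "N \<le> n"
      with N have "norm ((LINT z|\<mm>. min (d n z) L) - 0) < e / 2" by blast
      then have n: "(LINT z|\<mm>. min (d n z) L) < e / 2" by simp
      have "(LINT z|\<mm>. d n z) \<le> (LINT z|\<mm>. min (d n z) L + (d n z)\<^sup>2 / L)"
        using pt d1int d2int mint by (intro integral_mono) auto
      also have "\<dots> = (LINT z|\<mm>. min (d n z) L) + (LINT z|\<mm>. (d n z)\<^sup>2) / L"
        using d2int mint by simp
      also have "\<dots> \<le> (LINT z|\<mm>. min (d n z) L) + (K + 1) / L"
        using dK[of n] L by (intro add_left_mono divide_right_mono) auto
      also have "\<dots> < e / 2 + e / 2"
      proof -
        have "K + 1 = e / 2 * L" using e by (simp add: L_def)
        then have "(K + 1) / L = e / 2" using L by (simp add: nonzero_divide_eq_eq)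
        with n show ?thesis by linarith
      qed
      finally have "(LINT z|\<mm>. d n z) < e" by simp
      then show "norm ((LINT z|\<mm>. norm (F (of_real (radius_seq n) * z) - f z)) - 0) < e"
        unfolding d_def by simp
    qed
  qed
qed

text \<open>
A product of analytic functions has mean value 0 if one of them vanishes at the origin.  This is clear on smaller
circles, and \<open>L\<^sup>1\<close> convergence of the dilates of \<open>h\<close> carries it over to the boundary.
\<close>

lemma integral_bdd_hardy_mult_Hp2:
  assumes G: "bdd_hardy G g" "G 0 = 0" and h: "h \<in> Hp 2"
  shows "(LINT z|\<mm>. g z * h z) = 0"
proof -
  obtain B where B: "0 \<le> B" "\<And>w. norm w < 1 \<Longrightarrow> norm (G w) \<le> B" "AE z in \<mm>. norm (g z) \<le> B"
    using bdd_hardy_bound[OF G(1)] by metis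
  obtain H where H: "H \<in> disc_hardy 2" "has_boundary_values H h" and hL: "h \<in> Lp 2"
    using h by (auto simp: Hp_def)
  have hG: "G holomorphic_on ball 0 1" by (rule bdd_hardy_holomorphic[OF G(1)])
  have hH: "H holomorphic_on ball 0 1" using H(1) by (simp add: disc_hardy_def)
  define \<rho> where "\<rho> n z = of_real (radius_seq n) * (z::complex)" for n z
  have hint: "integrable \<mm> h"
    using L2_mult_integrable[OF hL bdd_hardy_Lp2[OF bdd_hardy_const[of 1]]] by simp
  have [measurable]: "(\<lambda>z. G (\<rho> n z)) \<in> borel_measurable \<mm>" for n
    unfolding \<rho>_def by (rule dilation_measurable[OF hG radius_seq])
  have [measurable]: "(\<lambda>z. H (\<rho> n z)) \<in> borel_measurable \<mm>" for n
    unfolding \<rho>_def by (rule dilation_measurable[OF hH radius_seq])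
  have [measurable]: "g \<in> borel_measurable \<mm>" "h \<in> borel_measurable \<mm>"
    using bdd_hardy_measurable[OF G(1)] hL by (auto simp: Lp2_iff)
  have GB: "norm (G (\<rho> n z)) \<le> B" if "norm z = 1" for n z
    using that radius_seq[of n] by (intro B(2)) (simp add: \<rho>_def norm_mult)
  have Hint: "integrable \<mm> (\<lambda>z. H (\<rho> n z))" for n
    unfolding \<rho>_def by (intro circle_continuous_integrable dilation_continuous holomorphic_on_imp_continuous_on[OF hH] radius_seq)
  have Dint: "integrable \<mm> (\<lambda>z. H (\<rho> n z) - h z)" for n
    using Hint hint by auto
  have GDint: "integrable \<mm> (\<lambda>z. G (\<rho> n z) * (H (\<rho> n z) - h z))" for n
    by (rule Bochner_Integration.integrable_bound[of _ "\<lambda>z. B * norm (H (\<rho> n z) - h z)"])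
       (use Dint GB B(1) in \<open>auto simp: norm_mult intro!: mult_right_mono\<close>)
  have Ghint: "integrable \<mm> (\<lambda>z. G (\<rho> n z) * h z)" for n
    by (rule Bochner_Integration.integrable_bound[of _ "\<lambda>z. B * norm (h z)"])
       (use hint GB B(1) in \<open>auto simp: norm_mult intro!: mult_right_mono\<close>)
  have zero: "(LINT z|\<mm>. G (\<rho> n z) * (H (\<rho> n z) - h z)) + (LINT z|\<mm>. G (\<rho> n z) * h z) = 0" for n
  proof -
    have "(LINT z|\<mm>. G (\<rho> n z) * H (\<rho> n z)) = 0"
      using mean_value_dilation[OF holomorphic_on_mult[OF hG hH] radius_seq[of n]] G(2) by (simp add: \<rho>_def)
    moreover have "(LINT z|\<mm>. G (\<rho> n z) * H (\<rho> n z))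
        = (LINT z|\<mm>. G (\<rho> n z) * (H (\<rho> n z) - h z) + G (\<rho> n z) * h z)"
      by (simp add: algebra_simps)
    ultimately show ?thesis using GDint Ghint by simp
  qed
  have "(\<lambda>n. LINT z|\<mm>. G (\<rho> n z) * (H (\<rho> n z) - h z)) \<longlonglongrightarrow> 0"
  proof (rule Lim_null_comparison)
    have "norm (LINT z|\<mm>. G (\<rho> n z) * (H (\<rho> n z) - h z)) \<le> B * (LINT z|\<mm>. norm (H (\<rho> n z) - h z))" for n
    proof -
      have "norm (LINT z|\<mm>. G (\<rho> n z) * (H (\<rho> n z) - h z)) \<le> (LINT z|\<mm>. norm (G (\<rho> n z) * (H (\<rho> n z) - h z)))"
        by (rule integral_norm_bound)
      also have "\<dots> \<le> (LINT z|\<mm>. B * norm (H (\<rho> n z) - h z))"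
        using integrable_norm[OF GDint] Dint GB
        by (intro integral_mono) (auto simp only: norm_mult space_circle mem_sphere_0 norm_ge_zero
              intro!: mult_right_mono integrable_mult_right integrable_norm)
      finally show ?thesis by simp
    qed
    then show "\<forall>\<^sub>F n in sequentially. norm (LINT z|\<mm>. G (\<rho> n z) * (H (\<rho> n z) - h z))
        \<le> B * (LINT z|\<mm>. norm (H (\<rho> n z) - h z))" by simp
    show "(\<lambda>n. B * (LINT z|\<mm>. norm (H (\<rho> n z) - h z))) \<longlonglongrightarrow> 0"
      unfolding \<rho>_def by (rule tendsto_mult_right_zero[OF Hp2_dilates_L1[OF H hL]])
  qed
  moreover have "(\<lambda>n. LINT z|\<mm>. G (\<rho> n z) * h z) \<longlonglongrightarrow> (LINT z|\<mm>. g z * h z)"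
  proof (rule integral_dominated_convergence)
    show "integrable \<mm> (\<lambda>z. B * norm (h z))" using hint by simp
    show "AE z in \<mm>. (\<lambda>n. G (\<rho> n z) * h z) \<longlonglongrightarrow> g z * h z"
      using boundary_values_radius_seq[OF bdd_hardy_boundary[OF G(1)]]
      unfolding \<rho>_def by eventually_elim (intro tendsto_intros)
    show "AE z in \<mm>. norm (G (\<rho> n z) * h z) \<le> B * norm (h z)" for n
      using GB by (intro AE_I2) (auto simp: norm_mult intro!: mult_right_mono)
  qed auto
  ultimately have "(\<lambda>n. (LINT z|\<mm>. G (\<rho> n z) * (H (\<rho> n z) - h z)) + (LINT z|\<mm>. G (\<rho> n z) * h z))
      \<longlonglongrightarrow> 0 + (LINT z|\<mm>. g z * h z)"
    by (rule tendsto_add)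
  then show ?thesis unfolding zero by (simp add: LIMSEQ_const_iff)
qed

text \<open>
Fatou's lemma along a sequence of radii.
\<close>

lemma disc_hardy_boundary_Lp:
  assumes F: "F \<in> disc_hardy p" "has_boundary_values F f" and f: "f \<in> borel_measurable \<mm>" and p: "0 < p"
  shows "f \<in> Lp p"
proof -
  obtain C where hF: "F holomorphic_on ball 0 1" and
    C: "\<forall>r. 0 \<le> r \<longrightarrow> r < 1 \<longrightarrow> (LINT z|\<mm>. norm (F (of_real r * z)) powr p) \<le> C"
    using F(1) by (rule disc_hardyE)
  define u where "u n z = ennreal (norm (F (of_real (radius_seq n) * z)) powr p)" for n z
  note [measurable] = f dilation_measurable[OF hF radius_seq]
  have "(\<integral>\<^sup>+ z. ennreal (norm (f z) powr p) \<partial>\<mm>) = (\<integral>\<^sup>+ z. liminf (\<lambda>n. u n z) \<partial>\<mm>)"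
  proof (rule nn_integral_cong_AE)
    show "AE z in \<mm>. ennreal (norm (f z) powr p) = liminf (\<lambda>n. u n z)"
      using boundary_values_radius_seq[OF F(2)]
    proof eventually_elim
      case (elim z)
      have "(\<lambda>n. u n z) \<longlonglongrightarrow> ennreal (norm (f z) powr p)"
        unfolding u_def using p by (intro tendsto_ennrealI tendsto_powr2 tendsto_norm elim tendsto_const) auto
      then show ?case by (intro lim_imp_Liminf[symmetric]) auto
    qed
  qed
  also have "\<dots> \<le> liminf (\<lambda>n. \<integral>\<^sup>+ z. u n z \<partial>\<mm>)"
    by (rule nn_integral_liminf) (simp add: u_def)
  also have "\<dots> \<le> liminf (\<lambda>n. ennreal C)"
  proof (intro Liminf_mono always_eventually allI)
    fix n
    have "(\<integral>\<^sup>+ z. u n z \<partial>\<mm>) = ennreal (LINT z|\<mm>. norm (F (of_real (radius_seq n) * z)) powr p)"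
      unfolding u_def using p by (intro nn_integral_eq_integral disc_hardy_dilation_integrable[OF hF radius_seq]) auto
    also have "\<dots> \<le> ennreal C" using C radius_seq[of n] by (intro ennreal_leI) auto
    finally show "(\<integral>\<^sup>+ z. u n z \<partial>\<mm>) \<le> ennreal C" .
  qed
  also have "liminf (\<lambda>n. ennreal C) = ennreal C" by (intro lim_imp_Liminf) auto
  also have "\<dots> < \<infinity>" by simp
  finally have "integrable \<mm> (\<lambda>z. norm (f z) powr p)"
    by (intro integrableI_bounded) (use f in auto)
  then show ?thesis using f by (simp add: Lp_def)
qed

section \<open>Cauchy transforms of bounded functions\<close>

definition cauchy_transform :: "(complex \<Rightarrow> complex) \<Rightarrow> complex \<Rightarrow> complex" where
  "cauchy_transform \<psi> w = (LINT z|\<mm>. \<psi> z / (1 - w * cnj z))"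

lemma szego_measurable [measurable]:
  "norm w < 1 \<Longrightarrow> (\<lambda>z. 1 / (1 - w * cnj z)) \<in> borel_measurable \<mm>"
  using cauchy_kernel_nonzero[of w "cnj _"]
  by (intro continuous_imp_measurable_circle continuous_intros) auto

lemma cauchy_transform_integrable:
  assumes \<psi>: "integrable \<mm> \<psi>" and w: "norm w < 1"
  shows "integrable \<mm> (\<lambda>z. \<psi> z / (1 - w * cnj z))"
proof -
  have c: "continuous_on (sphere 0 1) (\<lambda>z. 1 / (1 - w * cnj z))"
    using cauchy_kernel_nonzero[OF w, of "cnj _"] by (intro continuous_intros) auto
  have "compact ((\<lambda>z. 1 / (1 - w * cnj z)) ` sphere 0 1)" by (intro compact_continuous_image c) auto
  then obtain B where B: "\<forall>x\<in>(\<lambda>z. 1 / (1 - w * cnj z)) ` sphere 0 1. norm x \<le> B"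
    using compact_imp_bounded bounded_iff by metis
  have "integrable \<mm> (\<lambda>z. (1 / (1 - w * cnj z)) * \<psi> z)"
  proof (rule Bochner_Integration.integrable_bound[of _ "\<lambda>z. B * norm (\<psi> z)"])
    show "AE z in \<mm>. norm ((1 / (1 - w * cnj z)) * \<psi> z) \<le> norm (B * norm (\<psi> z))"
    proof (rule AE_I2)
      fix z assume "z \<in> space \<mm>"
      then have "norm (1 / (1 - w * cnj z)) \<le> B" using B by auto
      then have "norm (1 / (1 - w * cnj z)) * norm (\<psi> z) \<le> \<bar>B\<bar> * norm (\<psi> z)"
        by (intro mult_right_mono) auto
      then show "norm ((1 / (1 - w * cnj z)) * \<psi> z) \<le> norm (B * norm (\<psi> z))"
        by (simp only: norm_mult real_norm_def abs_mult abs_norm_cancel)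
    qed
    show "(\<lambda>z. (1 / (1 - w * cnj z)) * \<psi> z) \<in> borel_measurable \<mm>"
      using \<psi> by (intro borel_measurable_times szego_measurable[OF w]) auto
  qed (use \<psi> in auto)
  then show ?thesis by simp
qed

text \<open>
Expanding the kernel into a geometric series exhibits the transform as a power series.
\<close>

lemma cauchy_transform_holomorphic:
  assumes \<psi>: "integrable \<mm> \<psi>"
  shows "cauchy_transform \<psi> holomorphic_on ball 0 1"
proof (rule power_series_holomorphic)
  fix w :: complex assume "w \<in> ball 0 1"
  then have w: "norm w < 1" by simp
  define u where "u n z = w ^ n * (\<psi> z * cnj z ^ n)" for n z
  have int: "integrable \<mm> (\<lambda>z. \<psi> z * cnj z ^ n)" for n
  proof (rule Bochner_Integration.integrable_bound[OF \<psi>])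
    have "(\<lambda>z. cnj z ^ n) \<in> borel_measurable \<mm>"
      by (intro continuous_imp_measurable_circle continuous_intros)
    then show "(\<lambda>z. \<psi> z * cnj z ^ n) \<in> borel_measurable \<mm>"
      using \<psi> by (intro borel_measurable_times) auto
  qed (auto simp: norm_mult norm_power)
  have "(\<lambda>n. LINT z|\<mm>. u n z) sums (LINT z|\<mm>. (\<Sum>n. u n z))"
  proof (rule sums_integral)
    show "integrable \<mm> (u n)" for n
      unfolding u_def using int by (rule integrable_mult_right)
    show "AE z in \<mm>. summable (\<lambda>n. norm (u n z))"
      using AE_circle_norm
      by eventually_elim (use w in \<open>auto simp: u_def norm_mult norm_power intro!: summable_mult2 summable_geometric\<close>)
    have "(LINT z|\<mm>. norm (u n z)) = norm w ^ n * (LINT z|\<mm>. norm (\<psi> z))" for n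
    proof -
      have "(LINT z|\<mm>. norm (u n z)) = (LINT z|\<mm>. norm w ^ n * norm (\<psi> z))"
        by (intro Bochner_Integration.integral_cong) (auto simp: u_def norm_mult norm_power)
      then show ?thesis by simp
    qed
    then show "summable (\<lambda>n. LINT z|\<mm>. norm (u n z))"
      using w by (simp add: summable_mult2 summable_geometric)
  qed
  also have "(LINT z|\<mm>. (\<Sum>n. u n z)) = cauchy_transform \<psi> w"
    unfolding cauchy_transform_def
  proof (intro Bochner_Integration.integral_cong refl)
    fix z assume "z \<in> space \<mm>"
    then have "(\<lambda>n. \<psi> z * (w ^ n * cnj z ^ n)) sums (\<psi> z * (1 / (1 - w * cnj z)))"
      by (intro sums_mult geometric_circle_sums w) simp
    then show "(\<Sum>n. u n z) = \<psi> z / (1 - w * cnj z)"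
      by (simp add: u_def mult_ac sums_iff)
  qed
  also have "(\<lambda>n. LINT z|\<mm>. u n z) = (\<lambda>n. (LINT z|\<mm>. \<psi> z * cnj z ^ n) * (w - 0) ^ n)"
    by (simp add: u_def mult.commute)
  finally show "(\<lambda>n. (LINT z|\<mm>. \<psi> z * cnj z ^ n) * (w - 0) ^ n) sums cauchy_transform \<psi> w" .
qed

lemma Re_herglotz_nonneg:
  assumes "norm (u::complex) < 1"
  shows "0 \<le> Re (2 / (1 - u) - 1)"
proof -
  have "u \<noteq> 1" using assms by auto
  then have "2 / (1 - u) - 1 = (1 + u) / (1 - u)" by (simp add: field_simps)
  moreover have "0 \<le> Re (1 + u) * Re (1 - u) + Im (1 + u) * Im (1 - u)"
  proof -
    have "(norm u)\<^sup>2 \<le> 1" using assms by (simp add: power_le_one)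
    then show ?thesis unfolding cmod_power2 by (simp add: power2_eq_square algebra_simps)
  qed
  ultimately show ?thesis
    by (simp add: Re_divide del: plus_complex.sel minus_complex.sel one_complex.sel)
qed

text \<open>
The real part of \<open>2 / (1 - w cnj z) - 1\<close> is the Poisson kernel, which is nonnegative and has integral 1.  So the
real part of \<open>2 C(\<phi>) - C(\<phi>)(0)\<close> is the Poisson integral of \<open>\<phi>\<close>.
\<close>

lemma herglotz_bound:
  fixes \<phi> :: "complex \<Rightarrow> real"
  assumes \<phi>: "\<phi> \<in> borel_measurable \<mm>" "AE z in \<mm>. \<bar>\<phi> z\<bar> \<le> M" and w: "norm w < 1"
  shows "\<bar>Re (2 * cauchy_transform (\<lambda>z. of_real (\<phi> z)) w - cauchy_transform (\<lambda>z. of_real (\<phi> z)) 0)\<bar> \<le> M"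
proof -
  define P where "P z = Re (2 / (1 - w * cnj z) - 1)" for z
  have int\<phi>: "integrable \<mm> (\<lambda>z. complex_of_real (\<phi> z))"
    using \<phi> by (intro circle_integrable_bounded[of _ M]) auto
  have int1: "integrable \<mm> (\<lambda>z. 1 / (1 - w * cnj z))"
    using cauchy_transform_integrable[OF _ w, of "\<lambda>_. 1"] by simp
  have P0: "0 \<le> P z" if "norm z = 1" for z
    unfolding P_def using that w by (intro Re_herglotz_nonneg) (simp add: norm_mult)
  have int2: "integrable \<mm> (\<lambda>z. 2 / (1 - w * cnj z))"
    using integrable_mult_right[OF int1, where c=2] by simp
  have Pint: "integrable \<mm> P"
    unfolding P_def by (intro integrable_Re Bochner_Integration.integrable_diff int2) simp
  have "(LINT z|\<mm>. 2 / (1 - w * cnj z) - 1) = (LINT z|\<mm>. 2 / (1 - w * cnj z)) - 1"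
    using int2 by simp
  also have "(LINT z|\<mm>. 2 / (1 - w * cnj z)) = 2 * (LINT z|\<mm>. 1 / (1 - w * cnj z))"
    by (simp flip: Bochner_Integration.integral_mult_right_zero)
  also have "(LINT z|\<mm>. 1 / (1 - w * cnj z)) = 1"
    using bdd_hardy_cauchy[OF bdd_hardy_const w] .
  finally have P1: "(LINT z|\<mm>. P z) = 1"
    unfolding P_def using int2 by (subst integral_Re) auto
  have "2 * cauchy_transform (\<lambda>z. of_real (\<phi> z)) w - cauchy_transform (\<lambda>z. of_real (\<phi> z)) 0
      = (LINT z|\<mm>. 2 * (of_real (\<phi> z) / (1 - w * cnj z)) - of_real (\<phi> z))"
    using int\<phi> cauchy_transform_integrable[OF int\<phi> w]
    by (simp add: cauchy_transform_def del: times_divide_eq_right)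
  moreover have "Re (LINT z|\<mm>. 2 * (of_real (\<phi> z) / (1 - w * cnj z)) - of_real (\<phi> z))
      = (LINT z|\<mm>. Re (2 * (of_real (\<phi> z) / (1 - w * cnj z)) - of_real (\<phi> z)))"
    by (intro integral_Re[symmetric] Bochner_Integration.integrable_diff integrable_mult_right
        cauchy_transform_integrable[OF int\<phi> w] int\<phi>)
  moreover have "Re (2 * (of_real (\<phi> z) / (1 - w * cnj z)) - of_real (\<phi> z)) = \<phi> z * P z" for z
  proof -
    have "2 * (of_real (\<phi> z) / (1 - w * cnj z)) - of_real (\<phi> z) = of_real (\<phi> z) * (2 / (1 - w * cnj z) - 1)"
      by (simp add: algebra_simps)
    then show ?thesis unfolding P_def by simp
  qed
  ultimately have eq: "Re (2 * cauchy_transform (\<lambda>z. of_real (\<phi> z)) w - cauchy_transform (\<lambda>z. of_real (\<phi> z)) 0)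
      = (LINT z|\<mm>. \<phi> z * P z)" by simp
  have bd: "AE z in \<mm>. \<bar>\<phi> z * P z\<bar> \<le> M * P z"
    using \<phi>(2) AE_circle_norm by eventually_elim (auto simp: abs_mult P0 intro!: mult_right_mono)
  have int: "integrable \<mm> (\<lambda>z. \<phi> z * P z)"
  proof (rule Bochner_Integration.integrable_bound[of _ "\<lambda>z. M * P z"])
    show "AE z in \<mm>. norm (\<phi> z * P z) \<le> norm (M * P z)" using bd by eventually_elim auto
  qed (use Pint \<phi> in auto)
  have "\<bar>LINT z|\<mm>. \<phi> z * P z\<bar> \<le> (LINT z|\<mm>. \<bar>\<phi> z * P z\<bar>)"
    by (rule integral_abs_bound)
  also have "\<dots> \<le> (LINT z|\<mm>. M * P z)"
    using int Pint bd by (intro integral_mono_AE) auto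
  also have "\<dots> = M" using P1 by simp
  finally show ?thesis unfolding eq .
qed

text \<open>
Zygmund's exponential integrability of conjugate functions.  Since \<open>H / M\<close> takes values in the strip of real parts in
\<open>[-1, 1]\<close>, the function \<open>exp (\<plusminus> \<i> H / M)\<close> has real part at least \<open>exp (\<mp> Im H / M) cos 1\<close>, and the mean value of its real
part over a circle is its value at the origin, which is at most 1.
\<close>

lemma zygmund_exponential:
  assumes H: "H holomorphic_on ball 0 1" and M: "0 < M" "\<And>w. norm w < 1 \<Longrightarrow> \<bar>Re (H w)\<bar> \<le> M"
    and 0: "Im (H 0) = 0" and r: "0 \<le> r" "r < 1"
  shows "(LINT z|\<mm>. exp (\<bar>Im (H (of_real r * z))\<bar> / M)) \<le> 2 / cos 1"
proof -
  have cos1: "0 < cos (1::real)" using pi_half_gt_zero pi_gt3 by (intro cos_gt_zero) auto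
  have cont: "continuous_on (sphere 0 1) (\<lambda>z. H (of_real r * z))"
    using dilation_continuous H r holomorphic_on_imp_continuous_on by blast
  have one: "(LINT z|\<mm>. exp (s * Im (H (of_real r * z)) / M)) \<le> 1 / cos 1"
    if s: "s = 1 \<or> s = -1" for s :: real
  proof -
    \<comment> \<open>of modulus \<open>exp (s Im H / M)\<close>; both signs are needed to reach the absolute value of \<open>Im H\<close>\<close>
    define g where "g w = exp (- \<i> * of_real (s / M) * H w)" for w
    have hg: "g holomorphic_on ball 0 1" unfolding g_def by (intro holomorphic_intros H)
    have Reg: "Re (g w) = exp (s * Im (H w) / M) * cos (Re (H w) / M)" for w
      using s by (auto simp: g_def Re_exp)
    have ge: "exp (s * Im (H w) / M) * cos 1 \<le> Re (g w)" if "norm w < 1" for w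
    proof -
      have "\<bar>Re (H w) / M\<bar> \<le> 1" using M(1) M(2)[OF that] by (simp add: field_simps)
      then have "cos 1 \<le> cos \<bar>Re (H w) / M\<bar>" using pi_gt3 by (intro cos_monotone_0_pi_le) auto
      then have "cos 1 \<le> cos (Re (H w) / M)" by (simp only: cos_abs_real)
      then show ?thesis unfolding Reg by (intro mult_left_mono) auto
    qed
    have gint: "integrable \<mm> (\<lambda>z. g (of_real r * z))"
      unfolding g_def by (intro circle_continuous_integrable continuous_intros cont)
    have eint: "integrable \<mm> (\<lambda>z. exp (s * Im (H (of_real r * z)) / M))"
      using M(1) by (intro circle_continuous_integrable continuous_intros cont) auto
    have "(LINT z|\<mm>. exp (s * Im (H (of_real r * z)) / M)) * cos 1
        = (LINT z|\<mm>. exp (s * Im (H (of_real r * z)) / M) * cos 1)" by simp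
    also have "\<dots> \<le> (LINT z|\<mm>. Re (g (of_real r * z)))"
      using gint eint r by (intro integral_mono ge integrable_Re) (auto simp: norm_mult)
    also have "\<dots> = Re (LINT z|\<mm>. g (of_real r * z))" by (rule integral_Re[OF gint])
    also have "\<dots> = Re (g 0)" by (simp add: mean_value_dilation[OF hg r])
    also have "\<dots> \<le> 1" unfolding Reg 0 by simp
    finally show ?thesis using cos1 by (simp add: field_simps)
  qed
  have eint: "integrable \<mm> (\<lambda>z. exp (s * Im (H (of_real r * z)) / M))" for s
    using M(1) by (intro circle_continuous_integrable continuous_intros cont) auto
  have "(LINT z|\<mm>. exp (\<bar>Im (H (of_real r * z))\<bar> / M))
      \<le> (LINT z|\<mm>. exp (1 * Im (H (of_real r * z)) / M) + exp (-1 * Im (H (of_real r * z)) / M))"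
  proof (rule integral_mono)
    show "integrable \<mm> (\<lambda>z. exp (\<bar>Im (H (of_real r * z))\<bar> / M))"
      using M(1) by (intro circle_continuous_integrable continuous_intros cont) auto
    show "exp (\<bar>Im (H (of_real r * z))\<bar> / M) \<le> exp (1 * Im (H (of_real r * z)) / M) + exp (-1 * Im (H (of_real r * z)) / M)" for z
      by (auto simp: abs_if)
  qed (intro Bochner_Integration.integrable_add eint)
  also have "\<dots> = (LINT z|\<mm>. exp (1 * Im (H (of_real r * z)) / M)) + (LINT z|\<mm>. exp (-1 * Im (H (of_real r * z)) / M))"
    by (intro Bochner_Integration.integral_add eint)
  also have "\<dots> \<le> 1 / cos 1 + 1 / cos 1"
    by (intro add_mono one) auto
  finally show ?thesis by simp
qed

lemma powr_le_exp:
  assumes "0 < p" "0 \<le> (y::real)"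
  shows "y powr p \<le> p powr p * exp y"
proof (cases "y = 0")
  case False
  with assms have y: "0 < y" by simp
  have "ln (y / p) \<le> y / p - 1" using y assms by (intro ln_le_minus_one) auto
  then have "p * (ln y - ln p) \<le> p * (y / p - 1)"
    using y assms by (intro mult_left_mono) (auto simp: ln_div)
  also have "\<dots> \<le> y" using assms by (simp add: field_simps)
  finally have "p * ln y \<le> p * ln p + y" by (simp add: algebra_simps)
  then have "exp (p * ln y) \<le> exp (p * ln p + y)" by simp
  then show ?thesis using y assms by (simp add: powr_def exp_add)
qed (use assms in auto)

lemma strip_disc_hardy:
  assumes H: "H holomorphic_on ball 0 1" and M: "0 < M" "\<And>w. norm w < 1 \<Longrightarrow> \<bar>Re (H w)\<bar> \<le> M"
    and 0: "Im (H 0) = 0" and p: "0 < p"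
  shows "H \<in> disc_hardy p"
proof (rule disc_hardyI[OF H])
  fix r :: real assume r: "0 \<le> r" "r < 1"
  have cont: "continuous_on (sphere 0 1) (\<lambda>z. H (of_real r * z))"
    using dilation_continuous H r holomorphic_on_imp_continuous_on by blast
  define K where "K = M powr p * (p powr p * exp 1)"
  have "(LINT z|\<mm>. norm (H (of_real r * z)) powr p)
      \<le> (LINT z|\<mm>. K * exp (\<bar>Im (H (of_real r * z))\<bar> / M))"
  proof (rule integral_mono)
    show "integrable \<mm> (\<lambda>z. norm (H (of_real r * z)) powr p)"
      using p by (intro disc_hardy_dilation_integrable[OF H r]) auto
    show "integrable \<mm> (\<lambda>z. K * exp (\<bar>Im (H (of_real r * z))\<bar> / M))"
      using M(1) by (intro circle_continuous_integrable continuous_intros cont) auto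
    fix z assume "z \<in> space \<mm>"
    then have "norm (of_real r * z) < 1" using r by (simp add: norm_mult)
    define h where "h = H (of_real r * z)"
    have "norm h \<le> \<bar>Re h\<bar> + \<bar>Im h\<bar>" by (rule cmod_le)
    also have "\<dots> \<le> M + \<bar>Im h\<bar>" unfolding h_def using M(2)[OF \<open>norm (of_real r * z) < 1\<close>] by simp
    finally have le: "norm h / M \<le> 1 + \<bar>Im h\<bar> / M" using M(1) by (simp add: field_simps)
    have "norm h powr p = M powr p * (norm h / M) powr p"
      using M(1) by (simp flip: powr_mult)
    also have "\<dots> \<le> M powr p * (p powr p * exp (norm h / M))"
      using p M(1) by (intro mult_left_mono powr_le_exp) auto
    also have "\<dots> \<le> M powr p * (p powr p * exp (1 + \<bar>Im h\<bar> / M))"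
      using le by (intro mult_left_mono) auto
    also have "\<dots> = K * exp (\<bar>Im h\<bar> / M)" by (simp add: K_def exp_add)
    finally show "norm (H (of_real r * z)) powr p \<le> K * exp (\<bar>Im (H (of_real r * z))\<bar> / M)"
      unfolding h_def .
  qed
  also have "\<dots> = K * (LINT z|\<mm>. exp (\<bar>Im (H (of_real r * z))\<bar> / M))" by simp
  also have "\<dots> \<le> K * (2 / cos 1)"
    by (intro mult_left_mono zygmund_exponential[OF H M 0 r]) (auto simp: K_def)
  finally show "(LINT z|\<mm>. norm (H (of_real r * z)) powr p) \<le> K * (2 / cos 1)" .
qed

lemma cauchy_transform_real_disc_hardy:
  fixes \<phi> :: "complex \<Rightarrow> real"
  assumes \<phi>: "\<phi> \<in> borel_measurable \<mm>" "AE z in \<mm>. \<bar>\<phi> z\<bar> \<le> M" and p: "0 < p"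
  shows "cauchy_transform (\<lambda>z. of_real (\<phi> z)) \<in> disc_hardy p"
proof -
  define C where "C = cauchy_transform (\<lambda>z. of_real (\<phi> z))"
  define H where "H w = 2 * C w - C 0" for w
  have hC: "C holomorphic_on ball 0 1"
    unfolding C_def using \<phi> by (intro cauchy_transform_holomorphic circle_integrable_bounded[of _ M]) auto
  have bd: "AE z in \<mm>. \<bar>\<phi> z\<bar> \<le> \<bar>M\<bar> + 1" using \<phi>(2) by eventually_elim auto
  have "C 0 = of_real (LINT z|\<mm>. \<phi> z)"
    unfolding C_def cauchy_transform_def by simp
  then have "H \<in> disc_hardy p"
    unfolding H_def
    using herglotz_bound[OF \<phi>(1) bd] p
    by (intro strip_disc_hardy[of _ "\<bar>M\<bar> + 1"] holomorphic_intros hC) (auto simp: C_def)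
  moreover have "(\<lambda>_. C 0) \<in> disc_hardy p"
    using p by (intro bounded_disc_hardy[of _ "norm (C 0)"]) (auto intro!: holomorphic_intros)
  ultimately have "(\<lambda>w. H w + C 0) \<in> disc_hardy p" using p by (intro disc_hardy_add) auto
  then have "(\<lambda>w. (1/2) * (H w + C 0)) \<in> disc_hardy p"
    using p by (intro disc_hardy_bounded_mult[where F="\<lambda>_. 1/2" and B="1/2"]) (auto intro!: holomorphic_intros)
  then show ?thesis by (simp add: H_def C_def)
qed

text \<open>
The part of M. Riesz's theorem on the Cauchy projection that concerns bounded functions.  It follows for all
exponents at once from exponential integrability, applied to real and imaginary parts.
\<close>

lemma cauchy_transform_disc_hardy:
  assumes \<psi>: "\<psi> \<in> borel_measurable \<mm>" "AE z in \<mm>. norm (\<psi> z) \<le> M" and p: "0 < p"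
  shows "cauchy_transform \<psi> \<in> disc_hardy p"
proof -
  have [measurable]: "\<psi> \<in> borel_measurable \<mm>" by fact
  have R: "AE z in \<mm>. \<bar>Re (\<psi> z)\<bar> \<le> M" and I: "AE z in \<mm>. \<bar>Im (\<psi> z)\<bar> \<le> M"
    using \<psi>(2) by (eventually_elim, metis abs_Re_le_cmod order_trans) (use \<psi>(2) in \<open>eventually_elim, metis abs_Im_le_cmod order_trans\<close>)
  have intR: "integrable \<mm> (\<lambda>z. complex_of_real (Re (\<psi> z)))"
    using R by (intro circle_integrable_bounded[of _ M]) auto
  have intI: "integrable \<mm> (\<lambda>z. complex_of_real (Im (\<psi> z)))"
    using I by (intro circle_integrable_bounded[of _ M]) auto
  have "(\<lambda>w. \<i> * cauchy_transform (\<lambda>z. of_real (Im (\<psi> z))) w) \<in> disc_hardy p"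
    using cauchy_transform_real_disc_hardy[OF _ I p] p
    by (intro disc_hardy_bounded_mult[where F="\<lambda>_. \<i>" and B=1]) (auto intro!: holomorphic_intros)
  then have D: "(\<lambda>w. cauchy_transform (\<lambda>z. of_real (Re (\<psi> z))) w + \<i> * cauchy_transform (\<lambda>z. of_real (Im (\<psi> z))) w) \<in> disc_hardy p"
    using cauchy_transform_real_disc_hardy[OF _ R p] p by (intro disc_hardy_add) auto
  have eq: "cauchy_transform (\<lambda>z. of_real (Re (\<psi> z))) w + \<i> * cauchy_transform (\<lambda>z. of_real (Im (\<psi> z))) w = cauchy_transform \<psi> w"
    if w: "norm w < 1" for w
  proof -
    have "cauchy_transform (\<lambda>z. of_real (Re (\<psi> z))) w + \<i> * cauchy_transform (\<lambda>z. of_real (Im (\<psi> z))) w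
      = (LINT z|\<mm>. of_real (Re (\<psi> z)) / (1 - w * cnj z) + \<i> * (of_real (Im (\<psi> z)) / (1 - w * cnj z)))"
      unfolding cauchy_transform_def
      using cauchy_transform_integrable[OF intR w] cauchy_transform_integrable[OF intI w]
      by (subst Bochner_Integration.integral_add) (auto simp del: times_divide_eq_right)
    also have "\<dots> = cauchy_transform \<psi> w"
      unfolding cauchy_transform_def
      by (intro Bochner_Integration.integral_cong refl)
         (metis (no_types, lifting) add_divide_distrib complex_eq times_divide_eq_right)
    finally show ?thesis .
  qed
  obtain C where hol: "(\<lambda>w. cauchy_transform (\<lambda>z. of_real (Re (\<psi> z))) w + \<i> * cauchy_transform (\<lambda>z. of_real (Im (\<psi> z))) w) holomorphic_on ball 0 1"
    and C: "\<forall>r. 0 \<le> r \<longrightarrow> r < 1 \<longrightarrow> (LINT z|\<mm>. norm (cauchy_transform (\<lambda>z. of_real (Re (\<psi> z))) (of_real r * z) + \<i> * cauchy_transform (\<lambda>z. of_real (Im (\<psi> z))) (of_real r * z)) powr p) \<le> C"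
    using D by (rule disc_hardyE)
  show ?thesis
  proof (rule disc_hardyI[of _ _ C])
    show "cauchy_transform \<psi> holomorphic_on ball 0 1"
      using \<psi> by (intro cauchy_transform_holomorphic circle_integrable_bounded[of _ M])
    fix r :: real assume r: "0 \<le> r" "r < 1"
    have "(LINT z|\<mm>. norm (cauchy_transform \<psi> (of_real r * z)) powr p)
      = (LINT z|\<mm>. norm (cauchy_transform (\<lambda>z. of_real (Re (\<psi> z))) (of_real r * z) + \<i> * cauchy_transform (\<lambda>z. of_real (Im (\<psi> z))) (of_real r * z)) powr p)"
      using r by (intro Bochner_Integration.integral_cong refl) (auto simp: eq norm_mult)
    then show "(LINT z|\<mm>. norm (cauchy_transform \<psi> (of_real r * z)) powr p) \<le> C"
      using C r by simp
  qed
qed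

section \<open>Uniform boundedness by a gliding hump\<close>

text \<open>
The uniform boundedness principle for functionals \<open>x \<mapsto> \<Sum>\<^sub>i x\<^sub>i a\<^sub>i(G)\<close> on the space of summable families, with the
pointwise hypothesis restricted to the families that assign weights \<open>s\<^sub>k 4\<^sup>-\<^sup>k\<close> with \<open>s\<^sub>k \<in> {0, 1}\<close> to a sequence of indices.

Let \<open>M\<^sub>k\<close> be the supremum of the \<open>|a\<^sub>i(G\<^sub>k)|\<close>, choose \<open>G\<^sub>k\<close> with \<open>M\<^sub>k \<ge> 8\<^sup>k\<close>, and choose the index \<open>n\<^sub>k\<close> so that it
nearly attains this supremum.  The \<open>s\<^sub>k\<close> are chosen
one after the other such that the partial sum up to \<open>k\<close>, evaluated at \<open>G\<^sub>k\<close>, has at least half the size of its last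
term.  The tail is at most a third of \<open>4\<^sup>-\<^sup>k M\<^sub>k\<close> and cannot compensate for this, so the sum at \<open>G\<^sub>k\<close> is at least of
order \<open>2\<^sup>k\<close>.
\<close>

lemma gliding_hump:
  fixes a :: "'i \<Rightarrow> 'g \<Rightarrow> complex"
  assumes bd: "\<And>G. G \<in> S \<Longrightarrow> \<exists>M. \<forall>i\<in>I. norm (a i G) \<le> M"
    and sums: "\<And>n s. (\<And>k. n k \<in> I) \<Longrightarrow> (\<And>k::nat. s k = 0 \<or> s k = (1::real)) \<Longrightarrow>
      \<exists>B. \<forall>G\<in>S. norm (\<Sum>k. of_real (s k * (1/4)^k) * a (n k) G) \<le> B"
  shows "\<exists>C. \<forall>i\<in>I. \<forall>G\<in>S. norm (a i G) \<le> C"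
proof (rule ccontr)
  assume unb: "\<nexists>C. \<forall>i\<in>I. \<forall>G\<in>S. norm (a i G) \<le> C"
  have "\<exists>i G M. i \<in> I \<and> G \<in> S \<and> 8 ^ k \<le> M \<and> (\<forall>j\<in>I. norm (a j G) \<le> M) \<and> 9 / 10 * M \<le> norm (a i G)" for k :: nat
  proof -
    obtain i0 G where G: "i0 \<in> I" "G \<in> S" "8 ^ k < norm (a i0 G)"
      using unb by (meson linorder_not_le)
    define M where "M = (SUP i\<in>I. norm (a i G))"
    have bdd: "bdd_above ((\<lambda>i. norm (a i G)) ` I)" using bd[OF G(2)] by (auto simp: bdd_above_def)
    have le: "norm (a j G) \<le> M" if "j \<in> I" for j unfolding M_def by (rule cSUP_upper[OF that bdd])
    have M8: "8 ^ k < M" using le[OF G(1)] G(3) by linarith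
    have "0 < M" by (rule less_trans[OF _ M8]) simp
    then have "9 / 10 * M < M" by simp
    then obtain i where "i \<in> I" "9 / 10 * M < norm (a i G)"
      unfolding M_def using less_cSUP_iff[OF _ bdd] G(1) by blast
    then show ?thesis using G(2) le M8 by (meson less_imp_le)
  qed
  then obtain n G M where n: "\<And>k. n k \<in> I" and G: "\<And>k. G k \<in> S" and M8: "\<And>k. 8 ^ k \<le> M k"
    and le: "\<And>k j. j \<in> I \<Longrightarrow> norm (a j (G k)) \<le> M k" and ge: "\<And>k. 9 / 10 * M k \<le> norm (a (n k) (G k))"
    by metis
  have Mpos: "0 < M k" for k by (rule less_le_trans[OF _ M8]) simp
  define t where "t k j = of_real ((1/4)^j) * a (n j) (G k)" for k j
  have "\<exists>s. \<forall>k. (s k = 0 \<or> s k = (1::real)) \<and> norm (t k k) / 2 \<le> norm ((\<Sum>j<k. of_real (s j) * t k j) + of_real (s k) * t k k)"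
  proof (rule dependent_wellorder_choice)
    fix s :: "nat \<Rightarrow> real" and k
    define x where "x = (\<Sum>j<k. of_real (s j) * t k j)"
    have "norm (t k k) \<le> norm (x + t k k) + norm x"
      using norm_triangle_ineq4[of "x + t k k" x] by simp
    then have "norm (t k k) / 2 \<le> norm x \<or> norm (t k k) / 2 \<le> norm (x + t k k)" by linarith
    then show "\<exists>r. (r = 0 \<or> r = (1::real)) \<and> norm (t k k) / 2 \<le> norm ((\<Sum>j<k. of_real (s j) * t k j) + of_real r * t k k)"
      unfolding x_def[symmetric] by (metis add.right_neutral mult_1 mult_zero_left of_real_0 of_real_1)
  qed auto
  then obtain s where s01: "\<And>k. s k = 0 \<or> s k = (1::real)"
    and s: "\<And>k. norm (t k k) / 2 \<le> norm ((\<Sum>j<k. of_real (s j) * t k j) + of_real (s k) * t k k)" by blast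
  obtain B where B: "\<And>H. H \<in> S \<Longrightarrow> norm (\<Sum>k. of_real (s k * (1/4)^k) * a (n k) H) \<le> B"
    using sums[of n s] n s01 by blast
  have main: "2 ^ k \<le> 10 * B" for k :: nat
  proof -
    define x where "x j = of_real (s j) * t k j" for j
    have xle: "norm (x j) \<le> M k * (1/4) ^ j" for j
    proof -
      have "norm (x j) \<le> (1/4) ^ j * norm (a (n j) (G k))"
        using s01[of j] by (auto simp: x_def t_def norm_mult norm_power norm_divide)
      also have "\<dots> \<le> (1/4) ^ j * M k" by (intro mult_left_mono le n) auto
      finally show ?thesis by (simp add: mult.commute)
    qed
    have geo: "summable (\<lambda>j. M k * (1/4::real) ^ j)" by (intro summable_mult summable_geometric) auto
    have sx: "summable (\<lambda>j. norm (x j))"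
      by (rule summable_comparison_test'[OF geo]) (use xle in auto)
    then have sx': "summable x" by (rule summable_norm_cancel)
    have "(\<Sum>j. x j) = (\<Sum>j. x (j + Suc k)) + (\<Sum>j<Suc k. x j)"
      by (rule suminf_split_initial_segment[OF sx'])
    then have split: "(\<Sum>j<Suc k. x j) = (\<Sum>j. x j) - (\<Sum>j. x (j + Suc k))" by simp
    have tail: "norm (\<Sum>j. x (j + Suc k)) \<le> M k * (1/4)^k / 3"
    proof -
      have g: "(\<lambda>j. M k * (1/4) ^ Suc k * (1/4::real) ^ j) sums (M k * (1/4) ^ Suc k * (1 / (1 - 1/4)))"
        by (intro sums_mult geometric_sums) auto
      have "norm (\<Sum>j. x (j + Suc k)) \<le> (\<Sum>j. M k * (1/4) ^ Suc k * (1/4::real) ^ j)"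
      proof (rule norm_suminf_le)
        show "norm (x (j + Suc k)) \<le> M k * (1/4) ^ Suc k * (1/4) ^ j" for j
          using xle[of "j + Suc k"] by (simp add: power_add mult_ac)
      qed (use g in \<open>auto simp: sums_iff\<close>)
      also have "\<dots> = M k * (1/4)^k / 3" using sums_unique[OF g] by simp
      finally show ?thesis .
    qed
    have "norm (t k k) = (1/4)^k * norm (a (n k) (G k))"
      by (simp add: t_def norm_mult norm_power norm_divide)
    then have "(1/4)^k * (9 / 10 * M k) \<le> norm (t k k)" using ge[of k] by (simp add: mult_left_mono)
    also have "norm (t k k) / 2 \<le> norm (\<Sum>j<Suc k. x j)" using s[of k] by (simp add: x_def)
    then have "norm (t k k) \<le> 2 * norm (\<Sum>j<Suc k. x j)" by simp
    also have "norm (\<Sum>j<Suc k. x j) \<le> norm (\<Sum>j. x j) + norm (\<Sum>j. x (j + Suc k))"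
      unfolding split by (rule norm_triangle_ineq4)
    finally have 1: "(1/4)^k * (9 / 10 * M k) \<le> 2 * (norm (\<Sum>j. x j) + norm (\<Sum>j. x (j + Suc k)))" by simp
    have "norm (\<Sum>j. x j) \<le> B"
      using B[OF G[of k]] by (simp add: x_def t_def mult.assoc)
    moreover define y where "y = (1/4)^k * M k"
    ultimately have "9 / 10 * y \<le> 2 * (B + y / 3)"
      using 1 tail by (simp add: mult_ac)
    moreover have "0 \<le> y" using Mpos[of k] by (simp add: y_def)
    ultimately have "y \<le> 10 * B" by argo
    then have "(1/4)^k * M k \<le> 10 * B" by (simp only: y_def)
    moreover have "(1/4)^k * 8^k \<le> (1/4)^k * M k" by (intro mult_left_mono M8) auto
    moreover have "(1/4)^k * 8^k = (2::real)^k" by (simp flip: power_mult_distrib)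
    ultimately show ?thesis by simp
  qed
  obtain k where "10 * B < 2 ^ k" using real_arch_pow[of 2 "10 * B"] by auto
  with main[of k] show False by simp
qed

section \<open>Geometrically weighted series in the Hardy space\<close>

lemma AE_summable_of_summable_integrals:
  fixes f :: "nat \<Rightarrow> 'a \<Rightarrow> real"
  assumes int: "\<And>n. integrable M (f n)" and nonneg: "\<And>n x. 0 \<le> f n x"
    and sum: "summable (\<lambda>n. LINT x|M. f n x)"
  shows "AE x in M. summable (\<lambda>n. f n x)"
proof -
  have [measurable]: "f n \<in> borel_measurable M" for n using int by auto
  have "(\<integral>\<^sup>+x. (\<Sum>n. ennreal (f n x)) \<partial>M) = (\<Sum>n. \<integral>\<^sup>+x. ennreal (f n x) \<partial>M)"
    by (intro nn_integral_suminf) auto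
  also have "\<dots> = (\<Sum>n. ennreal (LINT x|M. f n x))"
    using int nonneg by (intro arg_cong[where f=suminf] ext nn_integral_eq_integral) auto
  also have "\<dots> \<noteq> top"
    using sum nonneg by (intro ennreal_suminf_neq_top) auto
  finally have "AE x in M. (\<Sum>n. ennreal (f n x)) \<noteq> top"
    using nn_integral_noteq_infinite[of "\<lambda>x. \<Sum>n. ennreal (f n x)" M] by auto
  then show ?thesis
    by eventually_elim (rule summable_suminf_not_top[OF nonneg])
qed

text \<open>
The weights \<open>4\<^sup>-\<^sup>k\<close> have total mass \<open>4/3\<close>.  The claim says that the weighted variance of \<open>x\<close> is nonnegative; \<open>c\<close> in the
proof is the weighted mean.
\<close>

lemma geometric_quarter_cauchy_schwarz:
  fixes x :: "nat \<Rightarrow> real"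
  assumes s2: "summable (\<lambda>k. (1/4)^k * (x k)\<^sup>2)" and s1: "summable (\<lambda>k. (1/4)^k * x k)"
  shows "(\<Sum>k. (1/4)^k * x k)\<^sup>2 \<le> 4/3 * (\<Sum>k. (1/4)^k * (x k)\<^sup>2)"
proof -
  define m where "m = (\<Sum>k. (1/4)^k * x k)"
  \<comment> \<open>the weighted mean of \<open>x\<close>, as \<open>m\<close> has been formed with weights of total mass \<open>4/3\<close>\<close>
  define c where "c = 3/4 * m"
  have g: "(\<lambda>k. (1/4::real)^k) sums (4/3)" using geometric_sums[of "1/4::real"] by simp
  have "(\<lambda>k. (1/4)^k * (x k)\<^sup>2 - 2 * c * ((1/4)^k * x k) + c\<^sup>2 * (1/4)^k) sums
      ((\<Sum>k. (1/4)^k * (x k)\<^sup>2) - 2 * c * m + c\<^sup>2 * (4/3))"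
    unfolding m_def by (intro sums_add sums_diff sums_mult summable_sums s1 s2 g)
  moreover have "(1/4)^k * (x k)\<^sup>2 - 2 * c * ((1/4)^k * x k) + c\<^sup>2 * (1/4)^k = (1/4)^k * (x k - c)\<^sup>2" for k
    by (simp add: power2_diff algebra_simps)
  ultimately have "(\<lambda>k. (1/4)^k * (x k - c)\<^sup>2) sums
      ((\<Sum>k. (1/4)^k * (x k)\<^sup>2) - 2 * c * m + c\<^sup>2 * (4/3))" by simp
  then have "0 \<le> (\<Sum>k. (1/4)^k * (x k)\<^sup>2) - 2 * c * m + c\<^sup>2 * (4/3)"
    by (rule sums_le[OF _ sums_zero, rotated]) auto
  then show ?thesis unfolding m_def[symmetric] by (simp add: c_def power2_eq_square)
qed

text \<open>
By the Cauchy-Schwarz inequality for the weights, the square of the sum is dominated by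
\<open>4/3 D\<^sup>2 \<Sum>\<^sub>k 4\<^sup>-\<^sup>k |v\<^sub>k|\<^sup>2\<close>, whose integral is at most \<open>16/9 D\<^sup>2\<close>.
\<close>

lemma L2_series:
  fixes v :: "nat \<Rightarrow> complex \<Rightarrow> complex"
  assumes v: "\<And>k. v k \<in> Lp 2" "\<And>k. lpnorm 2 (v k) \<le> 1" and d: "\<And>k. norm (d k) \<le> D * (1/4)^k"
  shows "AE z in \<mm>. summable (\<lambda>k. norm (d k * v k z))"
    and "(\<lambda>z. \<Sum>k. d k * v k z) \<in> Lp 2"
    and "lpnorm 2 (\<lambda>z. \<Sum>k. d k * v k z) \<le> 2 * D"
    and "h \<in> Lp 2 \<Longrightarrow> (\<lambda>k. d k * (LINT z|\<mm>. v k z * h z)) sums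
           (LINT z|\<mm>. (\<Sum>k. d k * v k z) * h z)"
proof -
  have D: "0 \<le> D" using order_trans[OF norm_ge_zero d[of 0]] by simp
  have [measurable]: "v k \<in> borel_measurable \<mm>" for k using v(1) by (auto simp: Lp2_iff)
  have vint: "integrable \<mm> (\<lambda>z. (1/4)^k * (norm (v k z))\<^sup>2)" for k
    using v(1)[of k] by (simp add: Lp2_iff)
  have v1: "(LINT z|\<mm>. (1/4)^k * (norm (v k z))\<^sup>2) \<le> (1/4)^k" for k
  proof -
    have "(lpnorm 2 (v k))\<^sup>2 \<le> 1" using v(2)[of k] by (simp add: power_le_one)
    then show ?thesis by (simp add: lpnorm2_square mult_left_le)
  qed
  have geo: "summable (\<lambda>k. (1/4::real)^k)" by (intro summable_geometric) auto
  have sint: "summable (\<lambda>k. LINT z|\<mm>. (1/4)^k * (norm (v k z))\<^sup>2)"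
    by (rule summable_comparison_test'[OF geo]) (use v1 in auto)
  have ae2: "AE z in \<mm>. summable (\<lambda>k. (1/4)^k * (norm (v k z))\<^sup>2)"
    by (rule AE_summable_of_summable_integrals[OF vint _ sint]) auto
  define W where "W z = (\<Sum>k. (1/4)^k * (norm (v k z))\<^sup>2)" for z
  have Wint: "integrable \<mm> W"
    unfolding W_def using ae2 sint vint by (intro integrable_suminf) (auto simp: abs_mult)
  have W: "(LINT z|\<mm>. W z) \<le> 4/3"
  proof -
    have "(LINT z|\<mm>. W z) = (\<Sum>k. LINT z|\<mm>. (1/4)^k * (norm (v k z))\<^sup>2)"
      unfolding W_def using ae2 sint vint by (intro integral_suminf) (auto simp: abs_mult)
    also have "\<dots> \<le> (\<Sum>k. (1/4)^k)" by (intro suminf_le v1 sint geo)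
    also have "\<dots> = 4/3" by (subst suminf_geometric) auto
    finally show ?thesis .
  qed
  have pt: "AE z in \<mm>. summable (\<lambda>k. norm (d k * v k z)) \<and>
      (norm (\<Sum>k. d k * v k z))\<^sup>2 \<le> D\<^sup>2 * (4/3) * W z"
    using ae2
  proof eventually_elim
    case (elim z)
    have s1: "summable (\<lambda>k. (1/4)^k * norm (v k z))"
    proof (rule summable_comparison_test'[OF summable_add[OF geo elim]])
      fix k
      have "norm (v k z) \<le> 1 + (norm (v k z))\<^sup>2"
      proof (cases "norm (v k z) \<le> 1")
        case False
        then have "norm (v k z) * 1 \<le> norm (v k z) * norm (v k z)" by (intro mult_left_mono) auto
        then show ?thesis by (simp add: power2_eq_square)
      qed (simp add: add_increasing2)
      then have "(1/4)^k * norm (v k z) \<le> (1/4)^k * (1 + (norm (v k z))\<^sup>2)" by (intro mult_left_mono) auto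
      then show "norm ((1/4)^k * norm (v k z)) \<le> (1/4)^k + (1/4)^k * (norm (v k z))\<^sup>2"
        by (simp add: algebra_simps)
    qed
    have dle: "norm (d k * v k z) \<le> D * ((1/4)^k * norm (v k z))" for k
      using mult_right_mono[OF d[of k] norm_ge_zero[of "v k z"]] by (simp add: norm_mult mult.assoc)
    have sd: "summable (\<lambda>k. norm (d k * v k z))"
      by (rule summable_comparison_test'[OF summable_mult[OF s1, of D]]) (use dle in auto)
    have "norm (\<Sum>k. d k * v k z) \<le> (\<Sum>k. D * ((1/4)^k * norm (v k z)))"
      by (intro norm_suminf_le dle summable_mult s1)
    also have "\<dots> = D * (\<Sum>k. (1/4)^k * norm (v k z))" by (rule suminf_mult[OF s1])
    finally have "(norm (\<Sum>k. d k * v k z))\<^sup>2 \<le> (D * (\<Sum>k. (1/4)^k * norm (v k z)))\<^sup>2"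
      by (intro power_mono) auto
    also have "\<dots> = D\<^sup>2 * (\<Sum>k. (1/4)^k * norm (v k z))\<^sup>2" by (rule power_mult_distrib)
    also have "\<dots> \<le> D\<^sup>2 * (4/3 * W z)"
      unfolding W_def by (intro mult_left_mono geometric_quarter_cauchy_schwarz elim s1) auto
    finally show ?case using sd by simp
  qed
  show ae: "AE z in \<mm>. summable (\<lambda>k. norm (d k * v k z))"
    using pt by eventually_elim simp
  show V: "(\<lambda>z. \<Sum>k. d k * v k z) \<in> Lp 2"
    unfolding Lp2_iff
  proof
    show "integrable \<mm> (\<lambda>z. (norm (\<Sum>k. d k * v k z))\<^sup>2)"
    proof (rule Bochner_Integration.integrable_bound[of _ "\<lambda>z. D\<^sup>2 * (4/3) * W z"])
      show "AE z in \<mm>. norm ((norm (\<Sum>k. d k * v k z))\<^sup>2) \<le> norm (D\<^sup>2 * (4/3) * W z)"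
        using pt by eventually_elim (metis abs_ge_self order_trans power2_abs power2_norm_eq_inner real_norm_def abs_of_nonneg zero_le_power2)
    qed (use Wint in auto)
  qed measurable
  have "(LINT z|\<mm>. (norm (\<Sum>k. d k * v k z))\<^sup>2) \<le> (LINT z|\<mm>. D\<^sup>2 * (4/3) * W z)"
  proof (rule integral_mono_AE)
    show "AE z in \<mm>. (norm (\<Sum>k. d k * v k z))\<^sup>2 \<le> D\<^sup>2 * (4/3) * W z"
      using pt by eventually_elim simp
  qed (use V Wint in \<open>auto simp: Lp2_iff\<close>)
  also have "\<dots> = D\<^sup>2 * (4/3) * (LINT z|\<mm>. W z)" by simp
  also have "\<dots> \<le> D\<^sup>2 * (4/3) * (4/3)" using W by (intro mult_left_mono) auto
  also have "\<dots> \<le> D\<^sup>2 * 4" by (simp add: mult_left_mono)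
  finally have "(lpnorm 2 (\<lambda>z. \<Sum>k. d k * v k z))\<^sup>2 \<le> (2 * D)\<^sup>2"
    by (simp add: lpnorm2_square power_mult_distrib)
  then show "lpnorm 2 (\<lambda>z. \<Sum>k. d k * v k z) \<le> 2 * D"
    by (rule power2_le_imp_le) (use D in simp)
  show "(\<lambda>k. d k * (LINT z|\<mm>. v k z * h z)) sums
           (LINT z|\<mm>. (\<Sum>k. d k * v k z) * h z)" if h: "h \<in> Lp 2"
  proof -
    define u where "u k z = d k * (v k z * h z)" for k z
    have uint: "integrable \<mm> (u k)" for k
      unfolding u_def by (intro integrable_mult_right L2_mult_integrable v h)
    have aeu: "AE z in \<mm>. summable (\<lambda>k. norm (u k z))"
      using ae by eventually_elim (auto simp: u_def norm_mult mult.assoc[symmetric] intro!: summable_mult2)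
    have "(LINT z|\<mm>. norm (u k z)) \<le> D * lpnorm 2 h * (1/4)^k" for k
    proof -
      have "(LINT z|\<mm>. norm (u k z)) = norm (d k) * (LINT z|\<mm>. norm (v k z * h z))"
        by (simp add: u_def norm_mult)
      also have "\<dots> \<le> (D * (1/4)^k) * (1 * lpnorm 2 h)"
        using D by (intro mult_mono d order_trans[OF L2_cauchy_schwarz_abs[OF v(1) h]] mult_right_mono v) auto
      finally show ?thesis by (simp add: mult_ac)
    qed
    then have "summable (\<lambda>k. LINT z|\<mm>. norm (u k z))"
      by (intro summable_comparison_test'[OF summable_mult[OF geo, of "D * lpnorm 2 h"]]) auto
    from sums_integral[OF uint aeu this]
    have "(\<lambda>k. LINT z|\<mm>. u k z) sums (LINT z|\<mm>. (\<Sum>k. u k z))" .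
    moreover have "(LINT z|\<mm>. (\<Sum>k. u k z)) = (LINT z|\<mm>. (\<Sum>k. d k * v k z) * h z)"
    proof (rule integral_cong_AE)
      show "AE z in \<mm>. (\<Sum>k. u k z) = (\<Sum>k. d k * v k z) * h z"
        using ae by eventually_elim (auto simp: u_def mult.assoc[symmetric] summable_norm_cancel intro!: suminf_mult2[symmetric])
    qed (use uint h in \<open>auto simp: Lp2_iff\<close>)
    ultimately show ?thesis by (simp add: u_def)
  qed
qed

text \<open>
Cauchy's formula bounds \<open>|u\<^sub>k(w)|\<close> by \<open>1 / (1 - |w|)\<close>, so the sum is holomorphic; its integral means are
controlled by \<open>L2_series\<close>, applied on each circle.  The last hypothesis permits taking radial limits termwise.
\<close>

lemma hardy_series:
  fixes u v :: "nat \<Rightarrow> complex \<Rightarrow> complex"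
  assumes uv: "\<And>k. bdd_hardy (u k) (v k)" "\<And>k. lpnorm 2 (v k) \<le> 1" and d: "\<And>k. norm (d k) \<le> D * (1/4)^k"
    and radial: "AE z in \<mm>. \<exists>B. \<forall>\<^sub>F r in at_left (1::real). \<forall>k. norm (u k (of_real r * z)) \<le> B"
  shows "(\<lambda>w. \<Sum>k. d k * u k w) \<in> disc_hardy 2"
    and "has_boundary_values (\<lambda>w. \<Sum>k. d k * u k w) (\<lambda>z. \<Sum>k. d k * v k z)"
    and "(\<lambda>z. \<Sum>k. d k * v k z) \<in> Hp 2"
proof -
  have D: "0 \<le> D" using order_trans[OF norm_ge_zero d[of 0]] by simp
  have geo: "summable (\<lambda>k. (1/4::real)^k)" by (intro summable_geometric) auto
  have vL: "v k \<in> Lp 2" for k by (rule bdd_hardy_Lp2[OF uv(1)])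
  have uhol: "u k holomorphic_on ball 0 1" for k by (rule bdd_hardy_holomorphic[OF uv(1)])
  have ub: "norm (u k w) \<le> 1 / (1 - norm w)" if w: "norm w < 1" for k w
  proof -
    have S: "(\<lambda>z. 1 / (1 - w * cnj z)) \<in> borel_measurable \<mm>" by (rule szego_measurable[OF w])
    have Sle: "norm (1 / (1 - w * cnj z)) \<le> 1 / (1 - norm w)" if "norm z = 1" for z
    proof -
      have "1 - norm w \<le> norm (1 - w * cnj z)" using norm_triangle_ineq2[of 1 "w * cnj z"] that by (simp add: norm_mult)
      then show ?thesis using w by (simp add: norm_divide frac_le)
    qed
    have vint: "integrable \<mm> (v k)" by (rule bdd_hardy_integrable[OF uv(1)])
    have "norm (u k w) = norm (LINT z|\<mm>. v k z / (1 - w * cnj z))"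
      by (simp add: bdd_hardy_cauchy[OF uv(1) w])
    also have "\<dots> \<le> (LINT z|\<mm>. norm (v k z / (1 - w * cnj z)))" by (rule integral_norm_bound)
    also have "\<dots> \<le> (LINT z|\<mm>. 1 / (1 - norm w) * norm (v k z * 1))"
    proof (rule integral_mono)
      show "integrable \<mm> (\<lambda>z. norm (v k z / (1 - w * cnj z)))"
        by (intro integrable_norm cauchy_transform_integrable vint w)
      show "norm (v k z / (1 - w * cnj z)) \<le> 1 / (1 - norm w) * norm (v k z * 1)" if "z \<in> space \<mm>" for z
        using mult_right_mono[OF Sle norm_ge_zero[of "v k z"]] that by (simp add: norm_divide)
    qed (use vint in auto)
    also have "\<dots> = 1 / (1 - norm w) * (LINT z|\<mm>. norm (v k z * 1))" by simp
    also have "\<dots> \<le> 1 / (1 - norm w) * (1 * 1)"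
    proof (intro mult_left_mono)
      have "(LINT z|\<mm>. norm (v k z * 1)) \<le> lpnorm 2 (v k) * lpnorm 2 (\<lambda>_. 1)"
        by (intro L2_cauchy_schwarz_abs vL bdd_hardy_Lp2[OF bdd_hardy_const])
      also have "lpnorm 2 (\<lambda>_. 1) = 1" by (simp add: lpnorm2)
      finally show "(LINT z|\<mm>. norm (v k z * 1)) \<le> 1 * 1" using uv(2)[of k] by simp
    qed (use w in auto)
    finally show ?thesis by simp
  qed
  define F where "F w = (\<Sum>k. d k * u k w)" for w
  have hol: "F holomorphic_on ball 0 1"
  proof (rule holomorphic_uniform_sequence)
    show "(\<lambda>w. \<Sum>k<n. d k * u k w) holomorphic_on ball 0 1" for n
      by (intro holomorphic_intros uhol)
    fix w :: complex assume "w \<in> ball 0 1"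
    then have w: "norm w < 1" by simp
    define e where "e = (1 - norm w) / 2"
    have e: "0 < e" "norm w + e < 1" using w by (auto simp: e_def field_simps)
    have sub: "norm x \<le> norm w + e" if "x \<in> cball w e" for x
      using that norm_triangle_ineq4[of w "w - x"] by (simp add: dist_norm)
    have "uniform_limit (cball w e) (\<lambda>n x. \<Sum>k<n. d k * u k x) (\<lambda>x. \<Sum>k. d k * u k x) sequentially"
    proof (rule Weierstrass_m_test)
      show "norm (d k * u k x) \<le> D * (1 / (1 - (norm w + e))) * (1/4)^k" if "x \<in> cball w e" for k x
      proof -
        have "norm (u k x) \<le> 1 / (1 - norm x)" using sub[OF that] e by (intro ub) linarith
        also have "\<dots> \<le> 1 / (1 - (norm w + e))" using sub[OF that] e by (intro divide_left_mono) auto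
        finally have "norm (d k) * norm (u k x) \<le> (D * (1/4)^k) * (1 / (1 - (norm w + e)))"
          using D by (intro mult_mono d) auto
        then show ?thesis by (simp add: norm_mult mult_ac)
      qed
      show "summable (\<lambda>k. D * (1 / (1 - (norm w + e))) * (1/4)^k)" by (intro summable_mult geo)
    qed
    then show "\<exists>e>0. cball w e \<subseteq> ball 0 1 \<and> uniform_limit (cball w e) (\<lambda>n w. \<Sum>k<n. d k * u k w) F sequentially"
      using e sub unfolding F_def[abs_def] by (intro exI[of _ e]) fastforce
  qed auto
  have dF: "F \<in> disc_hardy 2"
  proof (rule disc_hardyI[OF hol])
    fix r :: real assume r: "0 \<le> r" "r < 1"
    define vr where "vr k z = u k (of_real r * z)" for k z
    have vr1: "vr k \<in> Lp 2" for k
      unfolding Lp_def vr_def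
      using disc_hardy_dilation_integrable[OF uhol r, of 2] dilation_measurable[OF uhol r] by simp
    have vr2: "lpnorm 2 (vr k) \<le> 1" for k
    proof -
      have "lpnorm 2 (vr k) \<le> lpnorm 2 (v k)"
        unfolding lpnorm2 vr_def using bdd_hardy_dilation_norm_le[OF uv(1) r] by simp
      then show ?thesis using uv(2)[of k] by linarith
    qed
    have "lpnorm 2 (\<lambda>z. F (of_real r * z)) \<le> 2 * D"
      unfolding F_def using L2_series(3)[OF vr1 vr2 d] by (simp add: vr_def)
    then have "(lpnorm 2 (\<lambda>z. F (of_real r * z)))\<^sup>2 \<le> (2 * D)\<^sup>2" by (intro power_mono) auto
    then show "(LINT z|\<mm>. norm (F (of_real r * z)) powr 2) \<le> (2 * D)\<^sup>2"
      by (simp add: lpnorm2_square)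
  qed
  have "AE z in \<mm>. \<forall>k. ((\<lambda>r::real. u k (of_real r * z)) \<longlongrightarrow> v k z) (at_left 1)"
    using bdd_hardy_boundary[OF uv(1)] by (simp add: AE_all_countable has_boundary_values_def)
  then have bF: "has_boundary_values F (\<lambda>z. \<Sum>k. d k * v k z)"
    unfolding has_boundary_values_def using radial
  proof eventually_elim
    case (elim z)
    then obtain B where B: "\<forall>\<^sub>F r in at_left (1::real). \<forall>k. norm (u k (of_real r * z)) \<le> B" by blast
    show ?case unfolding F_def
    proof (rule tannerys_theorem[THEN conjunct2, THEN conjunct2])
      show "((\<lambda>r. d k * u k (of_real r * z)) \<longlongrightarrow> d k * v k z) (at_left 1)" for k
        using elim by (intro tendsto_intros) auto
      show "\<forall>\<^sub>F (k, r) in at_top \<times>\<^sub>F at_left 1. norm (d k * u k (of_real r * z)) \<le> D * \<bar>B\<bar> * (1/4)^k"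
        unfolding eventually_prod_filter
      proof (intro exI conjI allI impI)
        show "\<forall>\<^sub>F k in at_top. (\<lambda>k. True) (k::nat)" by simp
        show "\<forall>\<^sub>F r in at_left 1. (\<lambda>r. \<forall>k. norm (u k (of_real r * z)) \<le> B) r" by (rule B)
        fix k and r :: real assume "\<forall>k. norm (u k (of_real r * z)) \<le> B"
        then have "norm (u k (of_real r * z)) \<le> \<bar>B\<bar>" by (meson abs_ge_self order_trans)
        then have "norm (d k) * norm (u k (of_real r * z)) \<le> (D * (1/4)^k) * \<bar>B\<bar>"
          using D by (intro mult_mono d) auto
        then show "case (k, r) of (k, r) \<Rightarrow> norm (d k * u k (of_real r * z)) \<le> D * \<bar>B\<bar> * (1/4)^k"
          by (simp add: norm_mult mult_ac)
      qed
      show "summable (\<lambda>k. D * \<bar>B\<bar> * (1/4)^k)" by (intro summable_mult geo)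
    qed auto
  qed
  show "(\<lambda>w. \<Sum>k. d k * u k w) \<in> disc_hardy 2" using dF unfolding F_def .
  show "has_boundary_values (\<lambda>w. \<Sum>k. d k * u k w) (\<lambda>z. \<Sum>k. d k * v k z)" using bF unfolding F_def .
  show "(\<lambda>z. \<Sum>k. d k * v k z) \<in> Hp 2"
    unfolding Hp_def using L2_series(2)[where v=v and d=d, OF vL uv(2) d] dF bF by blast
qed

section \<open>Duality of Lebesgue spaces\<close>

lemma lpnorm_cmult:
  assumes "0 < p"
  shows "lpnorm p (\<lambda>z. c * f z) = norm c * lpnorm p f"
proof -
  have "(LINT z|\<mm>. norm (c * f z) powr p) = norm c powr p * (LINT z|\<mm>. norm (f z) powr p)"
    by (simp add: norm_mult powr_mult)
  then show ?thesis using assms by (simp add: lpnorm_def powr_mult powr_powr)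
qed

text \<open>
The extremal function in Hoelder's inequality, \<open>cnj T |T|\<^sup>p\<^sup>-\<^sup>2\<close> up to normalization.
\<close>

lemma lpnorm_dual:
  assumes T: "T \<in> Linf" and p: "1 < p" and q: "1 / p + 1 / q = 1" and ne: "lpnorm p T \<noteq> 0"
  shows "\<exists>G\<in>Linf. (LINT z|\<mm>. norm (G z) powr q) \<le> 1 \<and> norm (LINT z|\<mm>. T z * G z) = lpnorm p T"
proof -
  have q1: "1 < q" "q * (p - 1) = p"
  proof -
    have "1 / q = (p - 1) / p" using p q by (simp add: field_simps)
    then have qe: "q = p / (p - 1)" using p by (metis divide_inverse inverse_divide inverse_inverse_eq mult_1)
    show "1 < q" unfolding qe using p by (simp add: less_divide_eq)
    show "q * (p - 1) = p" unfolding qe using p by simp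
  qed
  have [measurable]: "T \<in> borel_measurable \<mm>" using T by (simp add: Linf_def)
  obtain C where C: "AE z in \<mm>. norm (T z) \<le> C" using T by (auto simp: Linf_def)
  define J where "J = (LINT z|\<mm>. norm (T z) powr p)"
  have J0: "0 < J"
  proof -
    have "J \<noteq> 0" using ne p by (auto simp: lpnorm_def J_def)
    moreover have "0 \<le> J" by (simp add: J_def)
    ultimately show ?thesis by simp
  qed
  define G where "G z = cnj (T z) * of_real (norm (T z) powr (p - 2) / J powr (1 / q))" for z
  have nG: "norm (G z) = norm (T z) powr (p - 1) / J powr (1 / q)" for z
  proof (cases "T z = 0")
    case False
    then have "norm (T z) * norm (T z) powr (p - 2) = norm (T z) powr (1 + (p - 2))" by (subst powr_add) simp
    then show ?thesis using J0 by (simp add: G_def norm_mult norm_divide)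
  qed (use p in \<open>simp add: G_def\<close>)
  have [measurable]: "G \<in> borel_measurable \<mm>"
    unfolding G_def[abs_def] by (intro borel_measurable_times borel_measurable_cnj) measurable
  have "AE z in \<mm>. norm (G z) \<le> C powr (p - 1) / J powr (1 / q)"
    using C by eventually_elim (use p in \<open>auto simp: nG intro!: divide_right_mono powr_mono2\<close>)
  then have GL: "G \<in> Linf" by (auto simp: Linf_def)
  have "norm (G z) powr q = norm (T z) powr p / J" for z
  proof -
    have "norm (G z) powr q = norm (T z) powr ((p - 1) * q) / J powr (1 / q * q)"
      by (simp add: nG powr_divide powr_powr)
    then show ?thesis using q1 J0 by (simp add: mult.commute)
  qed
  then have "(LINT z|\<mm>. norm (G z) powr q) = J / J" by (simp add: J_def)
  then have 1: "(LINT z|\<mm>. norm (G z) powr q) \<le> 1" using J0 by simp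
  have TG: "T z * G z = of_real (norm (T z) powr p / J powr (1 / q))" for z
  proof (cases "T z = 0")
    case False
    have "T z * G z = (T z * cnj (T z)) * of_real (norm (T z) powr (p - 2) / J powr (1 / q))" by (simp add: G_def)
    also have "T z * cnj (T z) = of_real ((norm (T z))\<^sup>2)" by (rule complex_norm_square[symmetric])
    also have "(norm (T z))\<^sup>2 = norm (T z) powr 2" by simp
    also have "of_real (norm (T z) powr 2) * of_real (norm (T z) powr (p - 2) / J powr (1 / q))
        = complex_of_real (norm (T z) powr 2 * norm (T z) powr (p - 2) / J powr (1 / q))" by simp
    also have "norm (T z) powr 2 * norm (T z) powr (p - 2) = norm (T z) powr p" by (simp only: powr_add[symmetric]) simp
    finally show ?thesis .
  qed (use p in \<open>simp add: G_def\<close>)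
  have "(LINT z|\<mm>. T z * G z) = of_real (J / J powr (1 / q))"
    unfolding TG J_def by (simp del: of_real_divide)
  moreover have "J / J powr (1 / q) = lpnorm p T"
  proof -
    have "J / J powr (1 / q) = J powr (1 - 1 / q)" using J0 by (simp add: powr_diff)
    also have "1 - 1 / q = 1 / p" using q by simp
    finally show ?thesis by (simp add: lpnorm_def J_def)
  qed
  ultimately have "norm (LINT z|\<mm>. T z * G z) = lpnorm p T" by simp
  with GL 1 show ?thesis by blast
qed

lemma Linf_mult: "f \<in> Linf \<Longrightarrow> g \<in> Linf \<Longrightarrow> (\<lambda>z. f z * g z) \<in> Linf"
proof -
  assume "f \<in> Linf" "g \<in> Linf"
  then obtain A B where AB: "AE z in \<mm>. norm (f z) \<le> A" "AE z in \<mm>. norm (g z) \<le> B"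
    and [measurable]: "f \<in> borel_measurable \<mm>" "g \<in> borel_measurable \<mm>"
    by (auto simp: Linf_def)
  from AB have "AE z in \<mm>. norm (f z * g z) \<le> A * B"
    by eventually_elim (auto simp: norm_mult intro!: mult_mono')
  then show ?thesis by (auto simp: Linf_def)
qed

lemma Linf_cnj: "f \<in> Linf \<Longrightarrow> (\<lambda>z. cnj (f z)) \<in> Linf"
  by (auto simp: Linf_def borel_measurable_cnj)

lemma Linf_Lp2: "f \<in> Linf \<Longrightarrow> f \<in> Lp 2"
  by (rule Linf_Lp) auto

section \<open>Kernels of the model space\<close>

text \<open>
The value at \<open>a\<close> removes the singularity.
\<close>

definition difference_quotient :: "(complex \<Rightarrow> complex) \<Rightarrow> complex \<Rightarrow> complex \<Rightarrow> complex" where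
  "difference_quotient F a z = (if z = a then deriv F a else (F z - F a) / (z - a))"

lemma bdd_hardy_difference_quotient:
  assumes F: "bdd_hardy F f" and a: "norm a < 1"
  shows "bdd_hardy (difference_quotient F a) (\<lambda>z. (f z - F a) / (z - a))"
proof -
  obtain B where B: "0 \<le> B" "\<And>w. norm w < 1 \<Longrightarrow> norm (F w) \<le> B"
    using bdd_hardy_bound[OF F] by metis
  have hol: "difference_quotient F a holomorphic_on ball 0 1"
    unfolding difference_quotient_def[abs_def]
    using pole_lemma[OF bdd_hardy_holomorphic[OF F], of a] a by simp
  define \<rho> where "\<rho> = (1 + norm a) / 2"
  have \<rho>: "norm a < \<rho>" "\<rho> < 1" using a by (auto simp: \<rho>_def)
  have "compact (difference_quotient F a ` cball 0 \<rho>)"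
    using \<rho> by (intro compact_continuous_image continuous_on_subset[OF holomorphic_on_imp_continuous_on[OF hol]]) auto
  then obtain C where C: "\<forall>x\<in>difference_quotient F a ` cball 0 \<rho>. norm x \<le> C"
    using compact_imp_bounded bounded_iff by metis
  show ?thesis
  proof (rule bdd_hardyI[OF hol])
    show "norm (difference_quotient F a w) \<le> max C (2 * B / (\<rho> - norm a))" if w: "norm w < 1" for w
    proof (cases "norm w \<le> \<rho>")
      case True
      then have "norm (difference_quotient F a w) \<le> C" using C by auto
      then show ?thesis by simp
    next
      case False
      then have "\<rho> - norm a \<le> norm (w - a)" using norm_triangle_ineq2[of w a] by linarith
      moreover have "norm (F w - F a) \<le> 2 * B"
        using norm_triangle_ineq4[of "F w" "F a"] B(2)[OF w] B(2)[OF a] by linarith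
      ultimately have "norm (F w - F a) / norm (w - a) \<le> 2 * B / (\<rho> - norm a)"
        using \<rho> B(1) by (intro frac_le) auto
      moreover have "w \<noteq> a" using False \<rho> by auto
      ultimately show ?thesis by (simp add: difference_quotient_def norm_divide max_def)
    qed
    show "has_boundary_values (difference_quotient F a) (\<lambda>z. (f z - F a) / (z - a))"
      using bdd_hardy_boundary[OF F] AE_circle_norm unfolding has_boundary_values_def
    proof eventually_elim
      case (elim z)
      have za: "z \<noteq> a" using elim(2) a by auto
      have "((\<lambda>r. (F (of_real r * z) - F a) / (of_real r * z - a)) \<longlongrightarrow> (f z - F a) / (z - a)) (at_left 1)"
        using za by (intro tendsto_intros elim of_real_mult_at_left) auto
      moreover have "\<forall>\<^sub>F r in at_left 1. of_real r * z \<noteq> a"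
        using za by (intro tendsto_imp_eventually_ne[OF of_real_mult_at_left])
      then have "\<forall>\<^sub>F r in at_left 1. difference_quotient F a (of_real r * z) = (F (of_real r * z) - F a) / (of_real r * z - a)"
        by eventually_elim (simp add: difference_quotient_def)
      ultimately show ?case by (simp add: tendsto_cong)
    qed
    have "(\<lambda>z. 1 / (z - a)) \<in> borel_measurable \<mm>"
      using a by (intro continuous_imp_measurable_circle continuous_intros) auto
    then have "(\<lambda>z. (f z - F a) * (1 / (z - a))) \<in> borel_measurable \<mm>"
      using bdd_hardy_measurable[OF F] by (intro borel_measurable_times borel_measurable_diff) auto
    then show "(\<lambda>z. (f z - F a) / (z - a)) \<in> borel_measurable \<mm>" by simp
  qed
qed

text \<open>
Applied to points of the circle and to boundary values of \<open>\<Theta>\<close> alike, this identity relates the kernels to their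
conjugates.
\<close>

lemma circle_cauchy_denominator:
  "norm z = 1 \<Longrightarrow> 1 - cnj a * z = z * cnj (z - a)"
  using complex_norm_square[of z] by (simp add: algebra_simps)

lemma Linf_mult_Lp2:
  assumes "f \<in> Linf" "g \<in> Lp 2"
  shows "(\<lambda>z. f z * g z) \<in> Lp 2"
  using assms by (auto simp: Linf_def intro: Lp2_bounded_mult)

lemma Lp2_measurable: "f \<in> Lp 2 \<Longrightarrow> f \<in> borel_measurable \<mm>"
  by (simp add: Lp2_iff)

lemma integrable_L2_cnj:
  assumes "f \<in> Lp 2" "g \<in> Lp 2"
  shows "integrable \<mm> (\<lambda>z. f z * cnj (g z))"
  by (rule L2_mult_integrable[OF assms(1) Lp2_cnj[OF assms(2)]])

lemma lpnorm_cong_AE: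
  assumes "f \<in> borel_measurable \<mm>" "g \<in> borel_measurable \<mm>"
    "AE z in \<mm>. norm (f z) = norm (g z)"
  shows "lpnorm p f = lpnorm p g"
proof -
  have "(LINT z|\<mm>. norm (f z) powr p) = (LINT z|\<mm>. norm (g z) powr p)"
    by (rule integral_cong_AE) (use assms in \<open>auto elim: eventually_mono\<close>)
  then show ?thesis by (simp add: lpnorm_def)
qed

locale inner =
  fixes \<Theta> :: "complex \<Rightarrow> complex"
  assumes inner: "inner_function \<Theta>"
begin

abbreviation "\<theta> \<equiv> bv \<Theta>"

lemma bdd_hardy_theta: "bdd_hardy \<Theta> \<theta>"
proof -
  have "\<Theta> \<in> disc_hardy_inf" using inner by (simp add: inner_function_def)
  moreover from this have "\<theta> \<in> borel_measurable \<mm>"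
    by (intro bv_measurable) (simp add: disc_hardy_inf_def)
  moreover have "has_boundary_values \<Theta> \<theta>"
    using inner unfolding inner_function_def has_boundary_values_def by (auto elim: eventually_mono)
  ultimately show ?thesis by (simp add: bdd_hardy_def)
qed

lemma AE_norm_theta: "AE z in \<mm>. norm (\<theta> z) = 1"
  using inner unfolding inner_function_def by (auto elim: eventually_mono)

text \<open>
Cauchy's formula for the powers of \<open>\<Theta>\<close>, whose boundary values are unimodular as well, bounds all powers of
\<open>|\<Theta>(w)|\<close> by one constant.
\<close>

lemma norm_theta_le:
  assumes w: "norm w < 1"
  shows "norm (\<Theta> w) \<le> 1"
proof (rule ccontr)
  assume "\<not> norm (\<Theta> w) \<le> 1"
  then have "1 < norm (\<Theta> w)" by simp
  have pow: "bdd_hardy (\<lambda>z. \<Theta> z ^ n) (\<lambda>z. \<theta> z ^ n)" for n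
  proof (induction n)
    case (Suc n)
    then show ?case using bdd_hardy_mult[OF bdd_hardy_theta Suc] by simp
  qed (simp add: bdd_hardy_const)
  define K where "K = (LINT z|\<mm>. norm (1 / (1 - w * cnj z)))"
  have "norm (\<Theta> w) ^ n \<le> K" for n
  proof -
    have "norm (\<Theta> w) ^ n = norm (LINT z|\<mm>. \<theta> z ^ n / (1 - w * cnj z))"
      by (simp add: bdd_hardy_cauchy[OF pow w] norm_power)
    also have "\<dots> \<le> (LINT z|\<mm>. norm (\<theta> z ^ n / (1 - w * cnj z)))" by (rule integral_norm_bound)
    also have "\<dots> = K"
      unfolding K_def
    proof (rule integral_cong_AE)
      have 1: "(\<lambda>z. \<theta> z ^ n / (1 - w * cnj z)) \<in> borel_measurable \<mm>"
        by (rule borel_measurable_integrable[OF cauchy_transform_integrable[OF bdd_hardy_integrable[OF pow] w]])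
      then show "(\<lambda>z. norm (\<theta> z ^ n / (1 - w * cnj z))) \<in> borel_measurable \<mm>" by simp
      show "(\<lambda>z. norm (1 / (1 - w * cnj z))) \<in> borel_measurable \<mm>"
        using szego_measurable[OF w] by simp
      show "AE z in \<mm>. norm (\<theta> z ^ n / (1 - w * cnj z)) = norm (1 / (1 - w * cnj z))"
        using AE_norm_theta by eventually_elim (simp add: norm_divide norm_power)
    qed
    finally show ?thesis .
  qed
  moreover obtain n where "K < norm (\<Theta> w) ^ n" using real_arch_pow[OF \<open>1 < norm (\<Theta> w)\<close>] by blast
  ultimately show False by (meson linorder_not_le)
qed

lemma norm_theta_0: "norm (\<Theta> 0) < 1"
proof (rule ccontr)
  assume "\<not> norm (\<Theta> 0) < 1"
  then have "norm (\<Theta> z) \<le> norm (\<Theta> 0)" if "z \<in> ball 0 1" for z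
    using norm_theta_le[of z] that by simp
  then have "\<Theta> constant_on ball 0 1"
    by (intro maximum_modulus_principle[OF bdd_hardy_holomorphic[OF bdd_hardy_theta], where \<xi>=0 and U="ball 0 1"]) auto
  then show False using inner by (simp add: inner_function_def)
qed

definition boundary_kernel :: "complex \<Rightarrow> complex \<Rightarrow> complex" where
  "boundary_kernel a z = (1 - cnj (\<Theta> a) * \<theta> z) / (1 - cnj a * z)"

text \<open>
The image of the kernel under the conjugation \<open>f \<mapsto> \<Theta> cnj (z f)\<close> of the model space.
\<close>

definition conj_kernel :: "complex \<Rightarrow> complex \<Rightarrow> complex" where
  "conj_kernel a z = (\<theta> z - \<Theta> a) / (z - a)"

lemma bdd_hardy_boundary_kernel:
  assumes a: "norm a < 1"
  shows "bdd_hardy (model_kernel \<Theta> a) (boundary_kernel a)"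
proof -
  have "bdd_hardy (\<lambda>z. (1 - cnj (\<Theta> a) * \<Theta> z) * (1 / (1 - cnj a * z))) (\<lambda>z. (1 - cnj (\<Theta> a) * \<theta> z) * (1 / (1 - cnj a * z)))"
    by (intro bdd_hardy_mult bdd_hardy_diff bdd_hardy_const bdd_hardy_theta bdd_hardy_szego) (simp add: a)
  then show ?thesis by (simp add: model_kernel_def[abs_def] boundary_kernel_def[abs_def])
qed

lemma bdd_hardy_conj_kernel: "norm a < 1 \<Longrightarrow> bdd_hardy (difference_quotient \<Theta> a) (conj_kernel a)"
  unfolding conj_kernel_def[abs_def] by (rule bdd_hardy_difference_quotient[OF bdd_hardy_theta])

lemmas boundary_kernel_Lp2 = bdd_hardy_Lp2[OF bdd_hardy_boundary_kernel]
lemmas conj_kernel_Lp2 = bdd_hardy_Lp2[OF bdd_hardy_conj_kernel]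
lemmas boundary_kernel_measurable = bdd_hardy_measurable[OF bdd_hardy_boundary_kernel]
lemmas conj_kernel_measurable = bdd_hardy_measurable[OF bdd_hardy_conj_kernel]

lemma norm_conj_kernel_eq:
  assumes "norm z = 1" "norm (\<theta> z) = 1"
  shows "norm (conj_kernel a z) = norm (boundary_kernel a z)"
  using circle_cauchy_denominator[OF assms(1), of a] circle_cauchy_denominator[OF assms(2), of "\<Theta> a"] assms
  by (simp add: conj_kernel_def boundary_kernel_def norm_divide norm_mult flip: complex_cnj_diff)

lemma lpnorm_conj_kernel: "norm a < 1 \<Longrightarrow> lpnorm p (conj_kernel a) = lpnorm p (boundary_kernel a)"
  using AE_norm_theta AE_circle_norm
  by (intro lpnorm_cong_AE conj_kernel_measurable boundary_kernel_measurable) (auto elim!: eventually_elim2 intro: norm_conj_kernel_eq)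

lemma lpnorm_bv_model_kernel:
  assumes a: "norm a < 1"
  shows "lpnorm p (bv (model_kernel \<Theta> a)) = lpnorm p (boundary_kernel a)"
proof (rule lpnorm_cong_AE)
  show "bv (model_kernel \<Theta> a) \<in> borel_measurable \<mm>"
    by (rule bdd_hardy_measurable[OF bdd_hardy_bv[OF bdd_hardy_boundary_kernel[OF a]]])
  show "AE z in \<mm>. norm (bv (model_kernel \<Theta> a) z) = norm (boundary_kernel a z)"
    using AE_bv_eq[OF bdd_hardy_boundary[OF bdd_hardy_boundary_kernel[OF a]]] by eventually_elim simp
qed (rule boundary_kernel_measurable[OF a])

lemma theta_mult_Hp2: "h \<in> Hp 2 \<Longrightarrow> (\<lambda>z. \<theta> z * h z) \<in> Hp 2"
  by (rule bdd_hardy_mult_Hp2[OF bdd_hardy_theta])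

lemma Hp2_Lp2: "h \<in> Hp 2 \<Longrightarrow> h \<in> Lp 2"
  by (simp add: Hp_def)

lemma model_space_Hp2: "f \<in> model_space \<Theta> \<Longrightarrow> f \<in> Hp 2"
  by (simp add: model_space_def)

lemma model_space_Lp2: "f \<in> model_space \<Theta> \<Longrightarrow> f \<in> Lp 2"
  by (intro Hp2_Lp2 model_space_Hp2)

lemma model_space_orth:
  "f \<in> model_space \<Theta> \<Longrightarrow> h \<in> Hp 2 \<Longrightarrow> (LINT z|\<mm>. f z * cnj (\<theta> z * h z)) = 0"
  by (simp add: model_space_def l2inner_def)

lemma bdd_hardy_ident_mult: "bdd_hardy F f \<Longrightarrow> bdd_hardy (\<lambda>z. z * F z) (\<lambda>z. z * f z)"
  by (rule bdd_hardy_mult[OF bdd_hardy_ident])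

lemma integral_ident_mult_Hp2:
  assumes "bdd_hardy F f" "h \<in> Hp 2"
  shows "(LINT z|\<mm>. z * f z * h z) = 0"
  by (rule integral_bdd_hardy_mult_Hp2[OF bdd_hardy_ident_mult[OF assms(1)] _ assms(2)]) simp

text \<open>
This and the next identity move \<open>\<Theta>\<close> from one side of the inner product to the other: testing a kernel against
\<open>\<Theta> h\<close> amounts to integrating an analytic function that vanishes at the origin.
\<close>

lemma theta_conj_conj_kernel:
  assumes z: "norm z = 1" "norm (\<theta> z) = 1" and a: "norm a < 1"
  shows "conj_kernel a z * cnj (\<theta> z) = cnj (z * boundary_kernel a z)"
proof -
  have za: "z - a \<noteq> 0" using z a by auto
  have z0: "z \<noteq> 0" using z by auto
  have "1 - cnj (\<Theta> a) * \<theta> z = \<theta> z * cnj (\<theta> z - \<Theta> a)" by (rule circle_cauchy_denominator[OF z(2)])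
  then have "z * boundary_kernel a z = \<theta> z * cnj (\<theta> z - \<Theta> a) / cnj (z - a)"
    using circle_cauchy_denominator[OF z(1), of a] z0 by (simp add: boundary_kernel_def)
  then show ?thesis by (simp add: conj_kernel_def)
qed

lemma theta_conj_boundary_kernel:
  assumes z: "norm z = 1" "norm (\<theta> z) = 1" and a: "norm a < 1"
  shows "boundary_kernel a z * cnj (\<theta> z) = cnj (z * conj_kernel a z)"
proof -
  have 1: "\<theta> z * cnj (\<theta> z) = 1" "z * cnj z = 1" using z complex_norm_square[of z] complex_norm_square[of "\<theta> z"] by auto
  have "cnj (conj_kernel a z * cnj (\<theta> z)) = z * boundary_kernel a z" using theta_conj_conj_kernel[OF assms] by simp
  then have "cnj (conj_kernel a z) * \<theta> z = z * boundary_kernel a z" by simp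
  then have "cnj z * cnj (\<theta> z) * (cnj (conj_kernel a z) * \<theta> z) = cnj z * cnj (\<theta> z) * (z * boundary_kernel a z)" by simp
  moreover have "cnj z * cnj (\<theta> z) * (cnj (conj_kernel a z) * \<theta> z) = cnj z * cnj (conj_kernel a z) * (\<theta> z * cnj (\<theta> z))" by (simp add: mult_ac)
  moreover have "cnj z * cnj (\<theta> z) * (z * boundary_kernel a z) = (z * cnj z) * (boundary_kernel a z * cnj (\<theta> z))" by (simp add: mult_ac)
  ultimately show ?thesis by (simp add: 1)
qed

lemma AE_circle_theta: "AE z in \<mm>. norm z = 1 \<and> norm (\<theta> z) = 1"
  using AE_circle_norm AE_norm_theta by eventually_elim simp

lemma orth_theta_Hp2:
  assumes u: "u \<in> Lp 2" and F: "bdd_hardy F f" and h: "h \<in> Hp 2"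
    and eq: "AE z in \<mm>. u z * cnj (\<theta> z) = cnj (z * f z)"
  shows "(LINT z|\<mm>. u z * cnj (\<theta> z * h z)) = 0"
proof -
  have "(LINT z|\<mm>. u z * cnj (\<theta> z * h z)) = (LINT z|\<mm>. cnj (z * f z * h z))"
  proof (rule integral_cong_AE)
    show "AE z in \<mm>. u z * cnj (\<theta> z * h z) = cnj (z * f z * h z)"
      using eq by eventually_elim (simp flip: mult.assoc)
    show "(\<lambda>z. u z * cnj (\<theta> z * h z)) \<in> borel_measurable \<mm>"
      by (rule borel_measurable_integrable[OF integrable_L2_cnj[OF u Hp2_Lp2[OF theta_mult_Hp2[OF h]]]])
    show "(\<lambda>z. cnj (z * f z * h z)) \<in> borel_measurable \<mm>"
      by (rule borel_measurable_cnj[OF borel_measurable_times[OF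
            bdd_hardy_measurable[OF bdd_hardy_ident_mult[OF F]] Lp2_measurable[OF Hp2_Lp2[OF h]]]])
  qed
  also have "\<dots> = cnj (LINT z|\<mm>. z * f z * h z)" by (rule Bochner_Integration.integral_cnj)
  also have "\<dots> = 0" using integral_ident_mult_Hp2[OF F h] by simp
  finally show ?thesis .
qed

lemma conj_kernel_orth:
  assumes a: "norm a < 1" and h: "h \<in> Hp 2"
  shows "(LINT z|\<mm>. conj_kernel a z * cnj (\<theta> z * h z)) = 0"
proof (rule orth_theta_Hp2[OF conj_kernel_Lp2[OF a] bdd_hardy_boundary_kernel[OF a] h])
  show "AE z in \<mm>. conj_kernel a z * cnj (\<theta> z) = cnj (z * boundary_kernel a z)"
    using AE_circle_theta by eventually_elim (rule theta_conj_conj_kernel[OF _ _ a], auto)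
qed

lemma boundary_kernel_orth:
  assumes a: "norm a < 1" and h: "h \<in> Hp 2"
  shows "(LINT z|\<mm>. boundary_kernel a z * cnj (\<theta> z * h z)) = 0"
proof (rule orth_theta_Hp2[OF boundary_kernel_Lp2[OF a] bdd_hardy_conj_kernel[OF a] h])
  show "AE z in \<mm>. boundary_kernel a z * cnj (\<theta> z) = cnj (z * conj_kernel a z)"
    using AE_circle_theta by eventually_elim (rule theta_conj_boundary_kernel[OF _ _ a], auto)
qed

lemma boundary_kernel_model_space: "norm a < 1 \<Longrightarrow> boundary_kernel a \<in> model_space \<Theta>"
  unfolding model_space_def l2inner_def using boundary_kernel_orth bdd_hardy_Hp2[OF bdd_hardy_boundary_kernel] by auto

text \<open>
The value at \<open>a\<close> of the analytic extension of \<open>f\<close>, for \<open>f\<close> in the model space.  Written as an inner product it is linear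
on all of \<open>L\<^sup>2\<close>.
\<close>

definition point_value :: "(complex \<Rightarrow> complex) \<Rightarrow> complex \<Rightarrow> complex" where
  "point_value f a = (LINT z|\<mm>. f z * cnj (boundary_kernel a z))"

lemma norm_point_value_le: "f \<in> Lp 2 \<Longrightarrow> norm a < 1 \<Longrightarrow> norm (point_value f a) \<le> lpnorm 2 f * lpnorm 2 (boundary_kernel a)"
  unfolding point_value_def using L2_cauchy_schwarz[OF _ Lp2_cnj[OF boundary_kernel_Lp2], of f a] by simp

lemma point_value_reproducing:
  assumes f: "f \<in> model_space \<Theta>" "bdd_hardy F f" and a: "norm a < 1"
  shows "point_value f a = F a"
proof -
  define S where "S z = 1 / (1 - cnj a * z)" for z
  have S: "bdd_hardy S S" unfolding S_def by (rule bdd_hardy_szego) (simp add: a)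
  have SL: "S \<in> Lp 2" and SH: "S \<in> Hp 2" by (rule bdd_hardy_Lp2[OF S], rule bdd_hardy_Hp2[OF S])
  note fL = model_space_Lp2[OF f(1)]
  have I1: "integrable \<mm> (\<lambda>z. f z * cnj (S z))" by (rule integrable_L2_cnj[OF fL SL])
  have I2: "integrable \<mm> (\<lambda>z. f z * cnj (\<theta> z * S z))"
    by (rule integrable_L2_cnj[OF fL Hp2_Lp2[OF theta_mult_Hp2[OF SH]]])
  have "point_value f a = (LINT z|\<mm>. f z * cnj (S z) - \<Theta> a * (f z * cnj (\<theta> z * S z)))"
    unfolding point_value_def
  proof (rule Bochner_Integration.integral_cong[OF refl])
    fix z
    have eq: "boundary_kernel a z = S z - cnj (\<Theta> a) * (\<theta> z * S z)" by (simp add: boundary_kernel_def S_def diff_divide_distrib)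
    show "f z * cnj (boundary_kernel a z) = f z * cnj (S z) - \<Theta> a * (f z * cnj (\<theta> z * S z))"
      unfolding eq by (simp add: right_diff_distrib mult_ac)
  qed
  also have "\<dots> = (LINT z|\<mm>. f z * cnj (S z)) - \<Theta> a * (LINT z|\<mm>. f z * cnj (\<theta> z * S z))"
    using I1 I2 by (simp only: Bochner_Integration.integral_diff integrable_mult_right Bochner_Integration.integral_mult_right_zero)
  also have "\<dots> = (LINT z|\<mm>. f z / (1 - a * cnj z))"
    by (simp only: model_space_orth[OF f(1) SH]) (simp add: S_def)
  also have "\<dots> = F a" by (rule bdd_hardy_cauchy[OF f(2) a])
  finally show ?thesis .
qed

text \<open>
A symbol of the operator \<open>f \<mapsto> f(a) t\<^sub>a\<close>.  The more obvious symbol \<open>\<Theta> / (z - a)\<close> has an \<open>L\<^sup>2\<close> norm of order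
\<open>(1 - |a|)\<^sup>-\<^sup>1\<^sup>/\<^sup>2\<close>, which can be much larger than \<open>\<parallel>k\<^sub>a\<parallel>\<^sub>2\<^sup>2\<close>; a conjugate analytic multiple of \<open>cnj \<Theta>\<close>, which represents
the zero operator, has been subtracted from it.
\<close>

definition rank_one_symbol :: "complex \<Rightarrow> complex \<Rightarrow> complex" where
  "rank_one_symbol a z = conj_kernel a z + \<Theta> a * cnj (z * boundary_kernel a z)"

lemma rank_one_symbol_identity:
  assumes z: "norm z = 1" "norm (\<theta> z) = 1" and a: "norm a < 1"
  shows "rank_one_symbol a z = \<theta> z / (z - a) - (\<Theta> a)\<^sup>2 * cnj (\<theta> z * (z / (1 - cnj a * z)))"
    and "\<theta> z / (z - a) = conj_kernel a z + \<Theta> a * cnj (z / (1 - cnj a * z))"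
proof -
  have z0: "z \<noteq> 0" using z by auto
  have za: "z - a \<noteq> 0" using z a by auto
  have c: "z / (1 - cnj a * z) = 1 / cnj (z - a)"
    using circle_cauchy_denominator[OF z(1), of a] z0 by simp
  have c': "cnj (z / (1 - cnj a * z)) = 1 / (z - a)" unfolding c by simp
  show 2: "\<theta> z / (z - a) = conj_kernel a z + \<Theta> a * cnj (z / (1 - cnj a * z))"
    unfolding c' conj_kernel_def by (simp add: diff_divide_distrib)
  have eq: "z * boundary_kernel a z = (z / (1 - cnj a * z)) - cnj (\<Theta> a) * (\<theta> z * (z / (1 - cnj a * z)))"
    by (simp add: boundary_kernel_def algebra_simps diff_divide_distrib)
  have "\<Theta> a * cnj (z * boundary_kernel a z) = \<Theta> a * cnj (z / (1 - cnj a * z)) - (\<Theta> a)\<^sup>2 * cnj (\<theta> z * (z / (1 - cnj a * z)))"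
    unfolding eq complex_cnj_diff right_diff_distrib by (simp add: power2_eq_square)
  then show "rank_one_symbol a z = \<theta> z / (z - a) - (\<Theta> a)\<^sup>2 * cnj (\<theta> z * (z / (1 - cnj a * z)))"
    unfolding rank_one_symbol_def 2 by simp
qed

lemma rank_one_symbol_Lp2: "norm a < 1 \<Longrightarrow> rank_one_symbol a \<in> Lp 2"
  unfolding rank_one_symbol_def[abs_def]
  by (intro Lp2_add conj_kernel_Lp2 Lp2_cmult Lp2_cnj bdd_hardy_Lp2[OF bdd_hardy_ident_mult[OF bdd_hardy_boundary_kernel]])

lemma lpnorm_rank_one_symbol:
  assumes a: "norm a < 1"
  shows "lpnorm 2 (rank_one_symbol a) \<le> 2 * lpnorm 2 (boundary_kernel a)"
proof (rule power2_le_imp_le)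
  have "(LINT z|\<mm>. (norm (rank_one_symbol a z))\<^sup>2) \<le> (LINT z|\<mm>. 4 * (norm (boundary_kernel a z))\<^sup>2)"
  proof (rule integral_mono_AE)
    show "AE z in \<mm>. (norm (rank_one_symbol a z))\<^sup>2 \<le> 4 * (norm (boundary_kernel a z))\<^sup>2"
      using AE_circle_theta
    proof eventually_elim
      case (elim z)
      have "norm (rank_one_symbol a z) \<le> norm (conj_kernel a z) + norm (\<Theta> a) * norm (boundary_kernel a z)"
        unfolding rank_one_symbol_def using norm_triangle_ineq[of "conj_kernel a z" "\<Theta> a * cnj (z * boundary_kernel a z)"] elim
        by (simp add: norm_mult)
      also have "\<dots> \<le> norm (boundary_kernel a z) + 1 * norm (boundary_kernel a z)"
        using elim by (intro add_mono mult_right_mono norm_theta_le a) (auto simp: norm_conj_kernel_eq)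
      finally have "(norm (rank_one_symbol a z))\<^sup>2 \<le> (2 * norm (boundary_kernel a z))\<^sup>2" by (intro power_mono) auto
      then show ?case by (simp add: power_mult_distrib)
    qed
  qed (use rank_one_symbol_Lp2[OF a] boundary_kernel_Lp2[OF a] in \<open>auto simp: Lp2_iff\<close>)
  then show "(lpnorm 2 (rank_one_symbol a))\<^sup>2 \<le> (2 * lpnorm 2 (boundary_kernel a))\<^sup>2"
    by (simp add: lpnorm2_square power_mult_distrib)
qed simp

text \<open>
With \<open>q = (f - f(a)) / (z - a)\<close> and \<open>S = z / (1 - cnj a z)\<close>, the product of \<open>f\<close> with the symbol is
\<open>\<Theta> q + f(a) t\<^sub>a + f(a) \<Theta>(a) cnj S - \<Theta>(a)\<^sup>2 cnj (\<Theta> S) f\<close>.  The first term is orthogonal to \<open>h\<close>, the third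
times \<open>cnj h\<close> is conjugate analytic with mean value 0, and the last vanishes against \<open>h\<close> because \<open>f\<close> is orthogonal to \<open>\<Theta> S h\<close>.
\<close>

lemma rank_one_symbol_acts:
  assumes f: "f \<in> model_space \<Theta>" "f \<in> Hinf" and h: "h \<in> model_space \<Theta>" and a: "norm a < 1"
  shows "(LINT z|\<mm>. rank_one_symbol a z * f z * cnj (h z)) = point_value f a * (LINT z|\<mm>. conj_kernel a z * cnj (h z))"
proof -
  obtain F where F: "bdd_hardy F f"
    using f(2) by (auto simp: Hinf_def bdd_hardy_def Linf_def)
  define S where "S z = z * (1 / (1 - cnj a * z))" for z
  have S: "bdd_hardy S S"
    unfolding S_def by (intro bdd_hardy_ident_mult bdd_hardy_szego) (simp add: a)
  define q where "q z = (f z - F a) / (z - a)" for z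
  have q: "bdd_hardy (difference_quotient F a) q"
    unfolding q_def[abs_def] by (rule bdd_hardy_difference_quotient[OF F a])
  note hH = model_space_Hp2[OF h] and hL = model_space_Lp2[OF h] and fL = model_space_Lp2[OF f(1)]
  have evF: "point_value f a = F a" by (rule point_value_reproducing[OF f(1) F a])
  define T1 where "T1 z = cnj (h z * cnj (\<theta> z * q z))" for z
  define T2 where "T2 z = conj_kernel a z * cnj (h z)" for z
  define T3 where "T3 z = cnj (S z * h z)" for z
  define T4 where "T4 z = f z * cnj (\<theta> z * (S z * h z))" for z
  have ShH: "(\<lambda>z. S z * h z) \<in> Hp 2" by (rule bdd_hardy_mult_Hp2[OF S hH])
  have i1: "integrable \<mm> T1"
    unfolding T1_def by (intro integrable_cnj integrable_L2_cnj[OF hL Hp2_Lp2[OF theta_mult_Hp2[OF bdd_hardy_Hp2[OF q]]]])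
  have i2: "integrable \<mm> T2" unfolding T2_def by (rule integrable_L2_cnj[OF conj_kernel_Lp2[OF a] hL])
  have i3: "integrable \<mm> T3"
    unfolding T3_def by (intro integrable_cnj L2_mult_integrable[OF bdd_hardy_Lp2[OF S] hL])
  have i4: "integrable \<mm> T4"
    unfolding T4_def by (rule integrable_L2_cnj[OF fL Hp2_Lp2[OF theta_mult_Hp2[OF ShH]]])
  have z1: "(LINT z|\<mm>. T1 z) = 0"
    unfolding T1_def Bochner_Integration.integral_cnj model_space_orth[OF h bdd_hardy_Hp2[OF q]] by simp
  have z3: "(LINT z|\<mm>. T3 z) = 0"
    unfolding T3_def Bochner_Integration.integral_cnj
    using integral_bdd_hardy_mult_Hp2[OF S _ hH] by (simp add: S_def)
  have z4: "(LINT z|\<mm>. T4 z) = 0"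
    unfolding T4_def by (rule model_space_orth[OF f(1) ShH])
  have fb: "f \<in> Linf" using f(2) by (simp add: Hinf_def)
  have "(LINT z|\<mm>. rank_one_symbol a z * f z * cnj (h z))
      = (LINT z|\<mm>. T1 z + F a * T2 z + F a * \<Theta> a * T3 z - (\<Theta> a)\<^sup>2 * T4 z)"
  proof (rule integral_cong_AE)
    have "(\<lambda>z. f z * rank_one_symbol a z) \<in> Lp 2" by (rule Linf_mult_Lp2[OF fb rank_one_symbol_Lp2[OF a]])
    from borel_measurable_integrable[OF integrable_L2_cnj[OF this hL]]
    show "(\<lambda>z. rank_one_symbol a z * f z * cnj (h z)) \<in> borel_measurable \<mm>" by (simp add: mult.commute)
    show "(\<lambda>z. T1 z + F a * T2 z + F a * \<Theta> a * T3 z - (\<Theta> a)\<^sup>2 * T4 z) \<in> borel_measurable \<mm>"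
      using i1 i2 i3 i4 by auto
    show "AE z in \<mm>. rank_one_symbol a z * f z * cnj (h z) = T1 z + F a * T2 z + F a * \<Theta> a * T3 z - (\<Theta> a)\<^sup>2 * T4 z"
      using AE_circle_theta
    proof eventually_elim
      case (elim z)
      note id = rank_one_symbol_identity[of z a] 
      have za: "z - a \<noteq> 0" using elim a by auto
      have fq: "f z = (z - a) * q z + F a" using za by (simp add: q_def)
      have Sz: "z / (1 - cnj a * z) = S z" by (simp add: S_def)
      define t where "t = \<theta> z / (z - a)"
      have "rank_one_symbol a z * f z = t * f z - (\<Theta> a)\<^sup>2 * cnj (\<theta> z * S z) * f z"
        using id(1) elim a by (simp add: Sz t_def left_diff_distrib)
      also have "t * f z = t * ((z - a) * q z) + t * F a" by (subst fq) (rule distrib_left)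
      also have "t * ((z - a) * q z) = \<theta> z * q z" using za by (simp add: t_def)
      also have "t = conj_kernel a z + \<Theta> a * cnj (S z)"
        using id(2) elim a by (simp add: Sz t_def)
      finally have E: "rank_one_symbol a z * f z = \<theta> z * q z + (conj_kernel a z + \<Theta> a * cnj (S z)) * F a - (\<Theta> a)\<^sup>2 * cnj (\<theta> z * S z) * f z" .
      show ?case unfolding E T1_def T2_def T3_def T4_def by (simp add: algebra_simps)
    qed
  qed
  also have "\<dots> = (LINT z|\<mm>. T1 z) + F a * (LINT z|\<mm>. T2 z)
      + F a * \<Theta> a * (LINT z|\<mm>. T3 z) - (\<Theta> a)\<^sup>2 * (LINT z|\<mm>. T4 z)"
    using i1 i2 i3 i4
    by (simp only: Bochner_Integration.integral_diff Bochner_Integration.integral_add Bochner_Integration.integrable_add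
        integrable_mult_right Bochner_Integration.integral_mult_right_zero)
  finally show ?thesis by (simp add: z1 z3 z4 evF T2_def)
qed

text \<open>
The integral of \<open>k\<^sub>a\<close> over the circle is \<open>k\<^sub>a(0)\<close>.
\<close>

lemma boundary_kernel_norm_lower:
  assumes a: "norm a < 1"
  shows "1 - norm (\<Theta> 0) \<le> lpnorm 2 (boundary_kernel a)"
proof -
  have "(LINT z|\<mm>. boundary_kernel a z * 1) = 1 - cnj (\<Theta> a) * \<Theta> 0"
    using bdd_hardy_cauchy[OF bdd_hardy_boundary_kernel[OF a], of 0] by (simp add: model_kernel_def)
  moreover have "norm (LINT z|\<mm>. boundary_kernel a z * 1) \<le> lpnorm 2 (boundary_kernel a) * lpnorm 2 (\<lambda>_. 1)"
    by (rule L2_cauchy_schwarz[OF boundary_kernel_Lp2[OF a] bdd_hardy_Lp2[OF bdd_hardy_const]])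
  moreover have "lpnorm 2 (\<lambda>_. 1) = 1" by (simp add: lpnorm2)
  ultimately have "norm (1 - cnj (\<Theta> a) * \<Theta> 0) \<le> lpnorm 2 (boundary_kernel a)" by simp
  moreover have "1 - norm (cnj (\<Theta> a) * \<Theta> 0) \<le> norm (1 - cnj (\<Theta> a) * \<Theta> 0)"
    using norm_triangle_ineq2[of 1 "cnj (\<Theta> a) * \<Theta> 0"] by simp
  moreover have "norm (cnj (\<Theta> a) * \<Theta> 0) \<le> 1 * norm (\<Theta> 0)"
    unfolding norm_mult complex_mod_cnj by (intro mult_right_mono norm_theta_le a) simp
  ultimately show ?thesis by linarith
qed

lemma lpnorm_boundary_kernel_pos: "norm a < 1 \<Longrightarrow> 0 < lpnorm 2 (boundary_kernel a)"
  using boundary_kernel_norm_lower[of a] norm_theta_0 by linarith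

end

section \<open>Sums of rank one truncated Toeplitz operators\<close>

context inner
begin

text \<open>
A point of the circle other than \<open>\<zeta>\<close> has positive distance from \<open>L\<close>, and the numerator of the difference quotient is at most 2.
\<close>

lemma radial_bound:
  assumes L: "L \<subseteq> ball 0 1" "compact (insert \<zeta> L)" and z: "norm z = 1" "z \<noteq> \<zeta>"
  shows "\<exists>B. \<forall>\<^sub>F r in at_left (1::real). \<forall>a\<in>L. norm (difference_quotient \<Theta> a (of_real r * z)) \<le> B"
proof -
  have "z \<notin> insert \<zeta> L" using L(1) z by auto
  moreover have "open (- insert \<zeta> L)" using compact_imp_closed[OF L(2)] by (rule open_Compl)
  ultimately obtain \<delta> where \<delta>: "0 < \<delta>" "ball z \<delta> \<subseteq> - insert \<zeta> L"
    by (metis ComplI openE)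
  have far: "\<delta> \<le> dist z a" if "a \<in> L" for a
  proof (rule ccontr)
    assume "\<not> \<delta> \<le> dist z a"
    then have "a \<in> ball z \<delta>" by simp
    with \<delta>(2) that show False by blast
  qed
  have "\<forall>\<^sub>F r in at_left 1. dist (of_real r * z) z < \<delta> / 2"
    using \<delta>(1) by (intro tendstoD[OF of_real_mult_at_left]) simp
  then have "\<forall>\<^sub>F r in at_left (1::real). \<forall>a\<in>L. norm (difference_quotient \<Theta> a (of_real r * z)) \<le> 2 / (\<delta> / 2)"
    using eventually_at_left_1
  proof eventually_elim
    case (elim r)
    show ?case
    proof
      fix a assume a: "a \<in> L"
      have "dist z a \<le> dist (of_real r * z) z + dist (of_real r * z) a" by (rule dist_triangle3)
      with far[OF a] elim(1) have d: "\<delta> / 2 \<le> norm (of_real r * z - a)" by (simp add: dist_norm)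
      have "norm (\<Theta> (of_real r * z) - \<Theta> a) \<le> norm (\<Theta> (of_real r * z)) + norm (\<Theta> a)" by (rule norm_triangle_ineq4)
      also have "\<dots> \<le> 1 + 1"
        using a L(1) z elim(2) by (intro add_mono norm_theta_le) (auto simp: norm_mult)
      finally have n: "norm (\<Theta> (of_real r * z) - \<Theta> a) \<le> 2" by simp
      have "norm (\<Theta> (of_real r * z) - \<Theta> a) / norm (of_real r * z - a) \<le> 2 / (\<delta> / 2)"
        using n d \<delta>(1) by (intro frac_le) auto
      moreover have "of_real r * z \<noteq> a" using d \<delta>(1) by auto
      ultimately show "norm (difference_quotient \<Theta> a (of_real r * z)) \<le> 2 / (\<delta> / 2)"
        by (simp add: difference_quotient_def norm_divide)
    qed
  qed
  then show ?thesis by blast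
qed

lemma point_value_add:
  assumes "f \<in> Lp 2" "g \<in> Lp 2" "norm a < 1"
  shows "point_value (\<lambda>z. f z + g z) a = point_value f a + point_value g a"
  using integrable_L2_cnj[OF assms(1) boundary_kernel_Lp2[OF assms(3)]] integrable_L2_cnj[OF assms(2) boundary_kernel_Lp2[OF assms(3)]]
  by (simp add: point_value_def distrib_right)

lemma point_value_cmult: "point_value (\<lambda>z. c * f z) a = c * point_value f a"
  by (simp add: point_value_def mult.assoc)

definition unit_conj_kernel :: "complex \<Rightarrow> complex \<Rightarrow> complex" where
  "unit_conj_kernel a z = of_real (1 / lpnorm 2 (boundary_kernel a)) * conj_kernel a z"

text \<open>
The operator \<open>f \<mapsto> \<Sum>\<^sub>k s\<^sub>k 4\<^sup>-\<^sup>k f(\<mu>\<^sub>k) t / \<parallel>k\<parallel>\<^sub>2\<^sup>2\<close>; one of the two factors \<open>1 / \<parallel>k\<parallel>\<^sub>2\<close> is part of the unit vector.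
\<close>

definition rank_one_sum :: "(nat \<Rightarrow> complex) \<Rightarrow> (nat \<Rightarrow> real) \<Rightarrow> (complex \<Rightarrow> complex) \<Rightarrow> complex \<Rightarrow> complex" where
  "rank_one_sum \<mu> s f z =
     (\<Sum>k. of_real (s k * (1/4)^k / lpnorm 2 (boundary_kernel (\<mu> k))) * point_value f (\<mu> k) * unit_conj_kernel (\<mu> k) z)"

lemma unit_conj_kernel_hardy:
  assumes a: "norm a < 1"
  shows "bdd_hardy (\<lambda>w. of_real (1 / lpnorm 2 (boundary_kernel a)) * difference_quotient \<Theta> a w) (unit_conj_kernel a)"
  unfolding unit_conj_kernel_def[abs_def] by (intro bdd_hardy_mult bdd_hardy_const bdd_hardy_conj_kernel a)

lemma unit_conj_kernel_norm:
  assumes a: "norm a < 1"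
  shows "lpnorm 2 (unit_conj_kernel a) = 1"
proof -
  have "lpnorm 2 (unit_conj_kernel a) = norm (complex_of_real (1 / lpnorm 2 (boundary_kernel a))) * lpnorm 2 (conj_kernel a)"
    unfolding unit_conj_kernel_def by (rule lpnorm_cmult) simp
  then show ?thesis using lpnorm_boundary_kernel_pos[OF a] by (simp add: lpnorm_conj_kernel[OF a] norm_divide)
qed

lemma unit_conj_kernel_model_space:
  assumes a: "norm a < 1"
  shows "unit_conj_kernel a \<in> model_space \<Theta>"
proof -
  have "(LINT z|\<mm>. unit_conj_kernel a z * cnj (\<theta> z * h z)) = 0" if "h \<in> Hp 2" for h
    using conj_kernel_orth[OF a that] by (simp add: unit_conj_kernel_def mult.assoc)
  then show ?thesis
    using bdd_hardy_Hp2[OF unit_conj_kernel_hardy[OF a]] by (simp add: model_space_def l2inner_def)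
qed

end

text \<open>
The compactness hypothesis says that \<open>L\<close> can accumulate at no point of the circle other than \<open>\<zeta>\<close>.  The weights
\<open>s\<close> select a subsequence of the points \<open>\<mu>\<close>, as the gliding hump requires.
\<close>

locale radial_sum = inner +
  fixes L :: "complex set" and \<zeta> :: complex and \<mu> :: "nat \<Rightarrow> complex" and s :: "nat \<Rightarrow> real"
  assumes L: "L \<subseteq> ball 0 1" "compact (insert \<zeta> L)"
    and \<mu>: "\<And>k. \<mu> k \<in> L" and s: "\<And>k. s k = 0 \<or> s k = 1"
begin

lemma \<mu>1: "norm (\<mu> k) < 1"
  using L(1) \<mu>[of k] by auto

abbreviation "A \<equiv> rank_one_sum \<mu> s"
abbreviation "c k \<equiv> s k * (1/4)^k / lpnorm 2 (boundary_kernel (\<mu> k))"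
abbreviation "U k w \<equiv> of_real (1 / lpnorm 2 (boundary_kernel (\<mu> k))) * difference_quotient \<Theta> (\<mu> k) w"

lemma coeff_bound:
  assumes f: "f \<in> Lp 2"
  shows "norm (of_real (c k) * point_value f (\<mu> k)) \<le> lpnorm 2 f * (1/4)^k"
proof -
  have N: "0 < lpnorm 2 (boundary_kernel (\<mu> k))" by (rule lpnorm_boundary_kernel_pos[OF \<mu>1])
  have "norm (of_real (c k) * point_value f (\<mu> k)) \<le> ((1/4)^k / lpnorm 2 (boundary_kernel (\<mu> k))) * (lpnorm 2 f * lpnorm 2 (boundary_kernel (\<mu> k)))"
    unfolding norm_mult using s[of k] N
    by (intro mult_mono norm_point_value_le[OF f \<mu>1]) (auto simp: norm_divide norm_power norm_mult)
  then show ?thesis using N by (simp add: field_simps)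
qed

lemma radial:
  "AE z in \<mm>. \<exists>B. \<forall>\<^sub>F r in at_left (1::real). \<forall>k. norm (U k (of_real r * z)) \<le> B"
  using AE_circle_norm AE_circle_neq[of \<zeta>]
proof eventually_elim
  case (elim z)
  obtain B where B: "\<forall>\<^sub>F r in at_left (1::real). \<forall>a\<in>L. norm (difference_quotient \<Theta> a (of_real r * z)) \<le> B"
    using radial_bound[OF L elim] by blast
  have "\<forall>\<^sub>F r in at_left (1::real). \<forall>k. norm (U k (of_real r * z)) \<le> 1 / (1 - norm (\<Theta> 0)) * \<bar>B\<bar>"
    using B
  proof eventually_elim
    case (elim r)
    show ?case
    proof
      fix k
      have 1: "norm (complex_of_real (1 / lpnorm 2 (boundary_kernel (\<mu> k)))) \<le> 1 / (1 - norm (\<Theta> 0))"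
        using boundary_kernel_norm_lower[OF \<mu>1[of k]] norm_theta_0 by (simp add: norm_divide frac_le)
      have "norm (difference_quotient \<Theta> (\<mu> k) (of_real r * z)) \<le> \<bar>B\<bar>"
        using elim \<mu>[of k] by (meson abs_ge_self order_trans)
      with 1 show "norm (U k (of_real r * z)) \<le> 1 / (1 - norm (\<Theta> 0)) * \<bar>B\<bar>"
        unfolding norm_mult using norm_theta_0 by (intro mult_mono) auto
    qed
  qed
  then show ?case by blast
qed

lemmas series_facts =
  hardy_series[where u="\<lambda>k. U k" and v="\<lambda>k. unit_conj_kernel (\<mu> k)", OF unit_conj_kernel_hardy[OF \<mu>1] eq_refl[OF unit_conj_kernel_norm[OF \<mu>1]] coeff_bound radial]
lemmas L2_facts =
  L2_series[where v="\<lambda>k. unit_conj_kernel (\<mu> k)", OF bdd_hardy_Lp2[OF unit_conj_kernel_hardy[OF \<mu>1]] eq_refl[OF unit_conj_kernel_norm[OF \<mu>1]] coeff_bound]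

lemma A_eq: "A f = (\<lambda>z. \<Sum>k. (of_real (c k) * point_value f (\<mu> k)) * unit_conj_kernel (\<mu> k) z)"
  by (simp add: rank_one_sum_def fun_eq_iff)

lemma A_sums:
  assumes "f \<in> Lp 2" "h \<in> Lp 2"
  shows "(\<lambda>k. of_real (c k) * point_value f (\<mu> k) * (LINT z|\<mm>. unit_conj_kernel (\<mu> k) z * h z)) sums
    (LINT z|\<mm>. A f z * h z)"
  unfolding A_eq by (rule L2_facts(4)[OF assms])

lemma A_model_space:
  assumes f: "f \<in> Lp 2"
  shows "A f \<in> model_space \<Theta>"
proof -
  have "A f \<in> Hp 2" unfolding A_eq by (rule series_facts(3)[OF f])
  moreover have "(LINT z|\<mm>. A f z * cnj (\<theta> z * h z)) = 0" if h: "h \<in> Hp 2" for h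
  proof -
    have "(LINT z|\<mm>. unit_conj_kernel (\<mu> k) z * cnj (\<theta> z * h z)) = 0" for k
      by (rule model_space_orth[OF unit_conj_kernel_model_space[OF \<mu>1] h])
    then have "(\<lambda>k. 0) sums (LINT z|\<mm>. A f z * cnj (\<theta> z * h z))"
      using A_sums[OF f Lp2_cnj[OF Hp2_Lp2[OF theta_mult_Hp2[OF h]]]] by simp
    then show ?thesis using sums_unique2[OF sums_zero] by metis
  qed
  ultimately show ?thesis by (simp add: model_space_def l2inner_def)
qed

lemma A_bounded_operator: "bounded_operator_on (model_space \<Theta>) A"
  unfolding bounded_operator_on_def
proof (intro conjI ballI allI)
  fix f g assume "f \<in> model_space \<Theta>" "g \<in> model_space \<Theta>"
  then have f: "f \<in> Lp 2" and g: "g \<in> Lp 2" by (auto intro: model_space_Lp2)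
  show "AE z in \<mm>. A (\<lambda>w. f w + g w) z = A f z + A g z"
    using L2_facts(1)[OF f] L2_facts(1)[OF g]
  proof eventually_elim
    case (elim z)
    from suminf_add[OF summable_norm_cancel[OF elim(1)] summable_norm_cancel[OF elim(2)]]
    show ?case unfolding A_eq point_value_add[OF f g \<mu>1] distrib_left distrib_right by (rule HOL.sym)
  qed
next
  fix f and b :: complex assume "f \<in> model_space \<Theta>"
  then have f: "f \<in> Lp 2" by (rule model_space_Lp2)
  show "AE z in \<mm>. A (\<lambda>w. b * f w) z = b * A f z"
    using L2_facts(1)[OF f]
  proof eventually_elim
    case (elim z)
    from suminf_mult[OF summable_norm_cancel[OF elim], of b]
    show ?case unfolding A_eq by (simp add: point_value_cmult mult_ac)
  qed
next
  show "\<exists>C. \<forall>f\<in>model_space \<Theta>. lpnorm 2 (A f) \<le> C * lpnorm 2 f"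
    unfolding A_eq using L2_facts(3)[OF model_space_Lp2] by blast
qed (intro A_model_space model_space_Lp2)

text \<open>
The corresponding sum of symbols; the factors 2 and \<open>1/2\<close> normalize the summands to \<open>L\<^sup>2\<close> norm at most 1.
\<close>

definition sum_symbol :: "complex \<Rightarrow> complex" where
  "sum_symbol z = (\<Sum>k. of_real (2 * c k) * (of_real (1 / (2 * lpnorm 2 (boundary_kernel (\<mu> k)))) * rank_one_symbol (\<mu> k) z))"

lemma sum_symbol_facts:
  shows "sum_symbol \<in> Lp 2"
    and "h \<in> Lp 2 \<Longrightarrow> (\<lambda>k. of_real (c k) * (of_real (1 / lpnorm 2 (boundary_kernel (\<mu> k))) * (LINT z|\<mm>. rank_one_symbol (\<mu> k) z * h z)))
           sums (LINT z|\<mm>. sum_symbol z * h z)"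
proof -
  define v where "v k z = of_real (1 / (2 * lpnorm 2 (boundary_kernel (\<mu> k)))) * rank_one_symbol (\<mu> k) z" for k z
  define d where "d k = complex_of_real (2 * c k)" for k
  have N: "0 < lpnorm 2 (boundary_kernel (\<mu> k))" for k by (rule lpnorm_boundary_kernel_pos[OF \<mu>1])
  have v: "v k \<in> Lp 2" for k unfolding v_def by (intro Lp2_cmult rank_one_symbol_Lp2 \<mu>1)
  have v1: "lpnorm 2 (v k) \<le> 1" for k
  proof -
    have "lpnorm 2 (v k) = lpnorm 2 (rank_one_symbol (\<mu> k)) / (2 * lpnorm 2 (boundary_kernel (\<mu> k)))"
      unfolding v_def using N[of k] by (subst lpnorm_cmult) (auto simp: norm_divide norm_mult)
    then show ?thesis using lpnorm_rank_one_symbol[OF \<mu>1[of k]] N[of k] by simp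
  qed
  have d: "norm (d k) \<le> 2 / (1 - norm (\<Theta> 0)) * (1/4)^k" for k
  proof -
    have "norm (d k) \<le> 2 * (1/4)^k / lpnorm 2 (boundary_kernel (\<mu> k))"
      using s[of k] N[of k] by (auto simp: d_def norm_mult norm_divide norm_power)
    also have "\<dots> \<le> 2 * (1/4)^k / (1 - norm (\<Theta> 0))"
      using boundary_kernel_norm_lower[OF \<mu>1[of k]] norm_theta_0 by (intro divide_left_mono mult_pos_pos N) auto
    finally show ?thesis by simp
  qed
  have eq: "sum_symbol = (\<lambda>z. \<Sum>k. d k * v k z)" by (simp add: sum_symbol_def fun_eq_iff d_def v_def)
  show "sum_symbol \<in> Lp 2" unfolding eq by (rule L2_series(2)[where v=v and d=d, OF v v1 d])
  show "(\<lambda>k. of_real (c k) * (of_real (1 / lpnorm 2 (boundary_kernel (\<mu> k))) * (LINT z|\<mm>. rank_one_symbol (\<mu> k) z * h z)))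
           sums (LINT z|\<mm>. sum_symbol z * h z)" if h: "h \<in> Lp 2"
  proof -
    have "d k * (LINT z|\<mm>. v k z * h z)
        = of_real (c k) * (of_real (1 / lpnorm 2 (boundary_kernel (\<mu> k))) * (LINT z|\<mm>. rank_one_symbol (\<mu> k) z * h z))" for k
      by (simp add: d_def v_def mult.assoc)
    then show ?thesis
      using L2_series(4)[where v=v and d=d, OF v v1 d h] unfolding eq by simp
  qed
qed

lemma A_bounded_tto: "bounded_tto \<Theta> A"
  unfolding bounded_tto_def
proof (intro conjI exI)
  show "tto_symbol \<Theta> A sum_symbol"
    unfolding tto_symbol_def
  proof (intro conjI ballI)
    fix f assume f: "f \<in> model_space \<Theta> \<inter> Hinf"
    then have fK: "f \<in> model_space \<Theta>" and fH: "f \<in> Hinf" by auto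
    note fL = model_space_Lp2[OF fK]
    have fb: "f \<in> Linf" using fH by (simp add: Hinf_def)
    show "model_proj \<Theta> (\<lambda>z. sum_symbol z * f z) (A f)"
      unfolding model_proj_def l2inner_def
    proof (intro conjI ballI)
      show AK: "A f \<in> model_space \<Theta>" by (rule A_model_space[OF fL])
      fix h assume h: "h \<in> model_space \<Theta>"
      note hL = Lp2_cnj[OF model_space_Lp2[OF h]]
      have fh: "(\<lambda>z. f z * cnj (h z)) \<in> Lp 2" by (rule Linf_mult_Lp2[OF fb hL])
      have "of_real (c k) * (of_real (1 / lpnorm 2 (boundary_kernel (\<mu> k))) * (LINT z|\<mm>. rank_one_symbol (\<mu> k) z * (f z * cnj (h z))))
          = of_real (c k) * point_value f (\<mu> k) * (LINT z|\<mm>. unit_conj_kernel (\<mu> k) z * cnj (h z))" for k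
        using rank_one_symbol_acts[OF fK fH h \<mu>1[of k]] by (simp add: unit_conj_kernel_def mult.assoc)
      then have "(\<lambda>k. of_real (c k) * point_value f (\<mu> k) * (LINT z|\<mm>. unit_conj_kernel (\<mu> k) z * cnj (h z)))
          sums (LINT z|\<mm>. sum_symbol z * (f z * cnj (h z)))"
        using sum_symbol_facts(2)[OF fh] by simp
      \<comment> \<open>both sides have the same expansion, term by term\<close>
      from sums_unique2[OF this A_sums[OF fL hL]]
      have eq: "(LINT z|\<mm>. sum_symbol z * (f z * cnj (h z))) = (LINT z|\<mm>. A f z * cnj (h z))" .
      have "(LINT z|\<mm>. (sum_symbol z * f z - A f z) * cnj (h z))
          = (LINT z|\<mm>. sum_symbol z * (f z * cnj (h z)) - A f z * cnj (h z))"
        by (simp add: left_diff_distrib mult.assoc)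
      also have "\<dots> = (LINT z|\<mm>. sum_symbol z * (f z * cnj (h z))) - (LINT z|\<mm>. A f z * cnj (h z))"
        by (intro Bochner_Integration.integral_diff L2_mult_integrable sum_symbol_facts(1) fh hL model_space_Lp2[OF AK])
      finally show "(LINT z|\<mm>. (sum_symbol z * f z - A f z) * cnj (h z)) = 0" using eq by simp
    qed
  qed (rule sum_symbol_facts(1))
qed (rule A_bounded_operator)

text \<open>
If the sum has a bounded symbol \<open>\<phi>\<close>, its value at \<open>k\<^sub>0\<close> is the projection of the bounded function \<open>g = \<phi> k\<^sub>0\<close>.
Testing against the kernel at \<open>w\<close> expresses its analytic extension as \<open>C(g) - \<Theta> C(g cnj \<Theta>)\<close>, which belongs to \<open>H\<^sup>p\<close>.
\<close>

lemma rank_one_sum_boundary_kernel_0_Lp: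
  assumes \<phi>: "\<phi> \<in> Linf" "tto_symbol \<Theta> A \<phi>" and p: "0 < p"
  shows "A (boundary_kernel 0) \<in> Lp p"
proof -
  have k0: "boundary_kernel 0 \<in> model_space \<Theta>" "boundary_kernel 0 \<in> Hinf" "boundary_kernel 0 \<in> Linf"
    using boundary_kernel_model_space[of 0] bdd_hardy_Hinf[OF bdd_hardy_boundary_kernel[of 0]] bdd_hardy_Linf[OF bdd_hardy_boundary_kernel[of 0]] by auto
  note k0L = model_space_Lp2[OF k0(1)]
  define g where "g z = \<phi> z * boundary_kernel 0 z" for z
  have gb: "g \<in> Linf" unfolding g_def by (rule Linf_mult[OF \<phi>(1) k0(3)])
  have gL: "g \<in> Lp 2" by (rule Linf_Lp2[OF gb])
  have AK: "A (boundary_kernel 0) \<in> model_space \<Theta>" by (rule A_model_space[OF k0L])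
  note AL = model_space_Lp2[OF AK]
  define Q where "Q w = (\<Sum>k. (of_real (c k) * point_value (boundary_kernel 0) (\<mu> k)) * U k w)" for w
  have bQ: "has_boundary_values Q (A (boundary_kernel 0))"
    unfolding Q_def A_eq by (rule series_facts(2)[OF k0L])
  have Qw: "Q w = cauchy_transform g w + (- \<Theta> w) * cauchy_transform (\<lambda>z. g z * cnj (\<theta> z)) w" if w: "norm w < 1" for w
  proof -
    have kw: "boundary_kernel w \<in> model_space \<Theta>" by (rule boundary_kernel_model_space[OF w])
    have kwL: "(\<lambda>z. cnj (boundary_kernel w z)) \<in> Lp 2" by (rule Lp2_cnj[OF boundary_kernel_Lp2[OF w]])
    have "(LINT z|\<mm>. unit_conj_kernel (\<mu> k) z * cnj (boundary_kernel w z)) = U k w" for k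
      using point_value_reproducing[OF unit_conj_kernel_model_space[OF \<mu>1] unit_conj_kernel_hardy[OF \<mu>1] w] unfolding point_value_def .
    then have "(\<lambda>k. of_real (c k) * point_value (boundary_kernel 0) (\<mu> k) * U k w) sums (LINT z|\<mm>. A (boundary_kernel 0) z * cnj (boundary_kernel w z))"
      using A_sums[OF k0L kwL] by simp
    then have 1: "Q w = (LINT z|\<mm>. A (boundary_kernel 0) z * cnj (boundary_kernel w z))"
      unfolding Q_def by (rule sums_unique[symmetric])
    have "model_proj \<Theta> g (A (boundary_kernel 0))"
      using \<phi>(2) k0 unfolding tto_symbol_def g_def by blast
    then have "(LINT z|\<mm>. (g z - A (boundary_kernel 0) z) * cnj (boundary_kernel w z)) = 0"
      using kw unfolding model_proj_def l2inner_def by blast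
    moreover have "(LINT z|\<mm>. (g z - A (boundary_kernel 0) z) * cnj (boundary_kernel w z))
        = (LINT z|\<mm>. g z * cnj (boundary_kernel w z)) - (LINT z|\<mm>. A (boundary_kernel 0) z * cnj (boundary_kernel w z))"
      unfolding left_diff_distrib by (intro Bochner_Integration.integral_diff L2_mult_integrable gL AL kwL)
    ultimately have 2: "Q w = (LINT z|\<mm>. g z * cnj (boundary_kernel w z))" using 1 by simp
    have i1: "integrable \<mm> (\<lambda>z. g z / (1 - w * cnj z))"
      by (intro cauchy_transform_integrable w) (use L2_mult_integrable[OF gL Linf_Lp2[OF bdd_hardy_Linf[OF bdd_hardy_const[of 1]]]] in simp)
    have "integrable \<mm> (\<lambda>z. g z * cnj (\<theta> z))"
      by (rule integrable_L2_cnj[OF gL bdd_hardy_Lp2[OF bdd_hardy_theta]])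
    then have i2: "integrable \<mm> (\<lambda>z. g z * cnj (\<theta> z) / (1 - w * cnj z))"
      by (intro cauchy_transform_integrable w)
    have "(LINT z|\<mm>. g z * cnj (boundary_kernel w z))
        = (LINT z|\<mm>. g z / (1 - w * cnj z) + (- \<Theta> w) * (g z * cnj (\<theta> z) / (1 - w * cnj z)))"
      by (intro Bochner_Integration.integral_cong refl) (simp add: boundary_kernel_def diff_divide_distrib algebra_simps)
    also have "\<dots> = (LINT z|\<mm>. g z / (1 - w * cnj z))
        + (LINT z|\<mm>. (- \<Theta> w) * (g z * cnj (\<theta> z) / (1 - w * cnj z)))"
      by (intro Bochner_Integration.integral_add i1 integrable_mult_right i2)
    also have "(LINT z|\<mm>. (- \<Theta> w) * (g z * cnj (\<theta> z) / (1 - w * cnj z)))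
        = (- \<Theta> w) * (LINT z|\<mm>. g z * cnj (\<theta> z) / (1 - w * cnj z))"
      by (rule Bochner_Integration.integral_mult_right_zero)
    finally show ?thesis unfolding 2 cauchy_transform_def .
  qed
  define G where "G w = cauchy_transform g w + (- \<Theta> w) * cauchy_transform (\<lambda>z. g z * cnj (\<theta> z)) w" for w
  have ct: "cauchy_transform f \<in> disc_hardy p" if "f \<in> Linf" for f
    using that p cauchy_transform_disc_hardy[of f _ p] by (auto simp: Linf_def)
  have "(\<lambda>w. (- \<Theta> w) * cauchy_transform (\<lambda>z. g z * cnj (\<theta> z)) w) \<in> disc_hardy p"
    by (rule disc_hardy_bounded_mult[where B=1])
       (use p bdd_hardy_holomorphic[OF bdd_hardy_theta] norm_theta_le in
         \<open>auto intro!: ct Linf_mult gb Linf_cnj bdd_hardy_Linf[OF bdd_hardy_theta] holomorphic_intros\<close>)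
  then have dG: "G \<in> disc_hardy p"
    unfolding G_def using p by (intro disc_hardy_add ct gb) auto
  have bG: "has_boundary_values G (A (boundary_kernel 0))"
    using bQ AE_circle_norm unfolding has_boundary_values_def
  proof eventually_elim
    case (elim z)
    have "\<forall>\<^sub>F r in at_left 1. Q (of_real r * z) = G (of_real r * z)"
      using eventually_at_left_1
    proof eventually_elim
      case (elim r)
      then show ?case unfolding G_def using \<open>norm z = 1\<close> by (intro Qw) (simp add: norm_mult)
    qed
    with elim(1) show ?case by (simp add: tendsto_cong)
  qed
  show ?thesis
    by (rule disc_hardy_boundary_Lp[OF dG bG Lp2_measurable[OF AL] p])
qed

end

section \<open>The norm estimate for the kernels\<close>

context inner
begin

lemma point_value_boundary_kernel_0:
  assumes a: "norm a < 1"
  shows "1 - norm (\<Theta> 0) \<le> norm (point_value (boundary_kernel 0) a)"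
proof -
  have "point_value (boundary_kernel 0) a = model_kernel \<Theta> 0 a"
    by (rule point_value_reproducing[OF boundary_kernel_model_space bdd_hardy_boundary_kernel a]) auto
  then have "point_value (boundary_kernel 0) a = 1 - cnj (\<Theta> 0) * \<Theta> a" by (simp add: model_kernel_def)
  moreover have "norm (\<Theta> 0) * norm (\<Theta> a) \<le> norm (\<Theta> 0) * 1"
    by (intro mult_left_mono norm_theta_le a) simp
  moreover have "1 - norm (cnj (\<Theta> 0) * \<Theta> a) \<le> norm (1 - cnj (\<Theta> 0) * \<Theta> a)"
    using norm_triangle_ineq2[of 1 "cnj (\<Theta> 0) * \<Theta> a"] by simp
  ultimately show ?thesis by (simp add: norm_mult)
qed

text \<open>
The functions \<open>T\<^sub>a = k\<^sub>0(a) t\<^sub>a / \<parallel>k\<^sub>a\<parallel>\<^sub>2\<^sup>2\<close> are tested against the bounded functions \<open>G\<close> in the unit ball of the dual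
Lebesgue space.  Their weighted sums belong to \<open>L\<^sup>p\<close>, so the integrals of these sums against \<open>G\<close> are bounded by Young's
inequality, and the gliding hump yields a common bound for the \<open>L\<^sup>p\<close> norms of the \<open>T\<^sub>a\<close>.
\<close>

lemma ratio_bounded_near_point:
  assumes hyp: "\<And>A. bounded_tto \<Theta> A \<Longrightarrow> \<exists>\<phi> \<in> Linf. tto_symbol \<Theta> A \<phi>"
    and L: "L \<subseteq> ball 0 1" "compact (insert \<zeta> L)" and p: "1 < p"
  shows "\<exists>C. \<forall>a\<in>L. lpnorm p (boundary_kernel a) / (lpnorm 2 (boundary_kernel a))\<^sup>2 \<le> C"
proof -
  define q where "q = p / (p - 1)"
  have q: "1 / p + 1 / q = 1" "1 < q" using p by (auto simp: q_def field_simps)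
  define S where "S = {G \<in> Linf. (LINT z|\<mm>. norm (G z) powr q) \<le> 1}"
  define t where "t a = point_value (boundary_kernel 0) a / of_real ((lpnorm 2 (boundary_kernel a))\<^sup>2)" for a
  define T where "T a z = t a * conj_kernel a z" for a z
  define I where "I a G = (LINT z|\<mm>. T a z * G z)" for a G
  have L1: "norm a < 1" if "a \<in> L" for a using that L(1) by auto
  have TL: "T a \<in> Linf" if "a \<in> L" for a
    unfolding T_def using bdd_hardy_Linf[OF bdd_hardy_mult[OF bdd_hardy_const bdd_hardy_conj_kernel[OF L1[OF that]]]] .
  have k0: "boundary_kernel 0 \<in> Lp 2" by (rule boundary_kernel_Lp2) simp
  have "\<exists>C. \<forall>a\<in>L. \<forall>G\<in>S. norm (I a G) \<le> C"
  proof (rule gliding_hump)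
    fix G assume "G \<in> S"
    then have G: "G \<in> Lp 2" by (auto simp: S_def intro: Linf_Lp2)
    show "\<exists>M. \<forall>a\<in>L. norm (I a G) \<le> M"
    proof (intro exI ballI)
      fix a assume a: "a \<in> L"
      have N: "0 < lpnorm 2 (boundary_kernel a)" by (rule lpnorm_boundary_kernel_pos[OF L1[OF a]])
      have "norm (I a G) \<le> lpnorm 2 (T a) * lpnorm 2 G"
        unfolding I_def by (rule L2_cauchy_schwarz[OF Linf_Lp2[OF TL[OF a]] G])
      also have "lpnorm 2 (T a) = norm (point_value (boundary_kernel 0) a) / lpnorm 2 (boundary_kernel a)"
        unfolding T_def using N
        by (subst lpnorm_cmult) (auto simp: t_def lpnorm_conj_kernel[OF L1[OF a]] norm_divide norm_mult power2_eq_square)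
      also have "\<dots> \<le> lpnorm 2 (boundary_kernel 0)"
        using norm_point_value_le[OF k0 L1[OF a]] N by (simp add: pos_divide_le_eq)
      finally show "norm (I a G) \<le> lpnorm 2 (boundary_kernel 0) * lpnorm 2 G" by (simp add: mult_right_mono)
    qed
  next
    fix \<mu> :: "nat \<Rightarrow> complex" and s :: "nat \<Rightarrow> real"
    assume \<mu>: "\<And>k. \<mu> k \<in> L" and s: "\<And>k. s k = 0 \<or> s k = 1"
    interpret radial_sum \<Theta> L \<zeta> \<mu> s
      using L \<mu> s by unfold_locales auto
    obtain \<phi> where \<phi>: "\<phi> \<in> Linf" "tto_symbol \<Theta> A \<phi>"
      using hyp[OF A_bounded_tto] by blast
    define Q where "Q = A (boundary_kernel 0)"
    have QLp: "Q \<in> Lp p" unfolding Q_def using \<phi> p by (intro rank_one_sum_boundary_kernel_0_Lp) auto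
    have QL: "Q \<in> Lp 2" unfolding Q_def by (intro model_space_Lp2 A_model_space k0)
    show "\<exists>B. \<forall>G\<in>S. norm (\<Sum>k. of_real (s k * (1/4)^k) * I (\<mu> k) G) \<le> B"
    proof (intro exI ballI)
      fix G assume GS: "G \<in> S"
      then have GI: "G \<in> Linf" and Gq: "(LINT z|\<mm>. norm (G z) powr q) \<le> 1" by (auto simp: S_def)
      note GL = Linf_Lp2[OF GI]
      have "of_real (c k) * point_value (boundary_kernel 0) (\<mu> k) * (LINT z|\<mm>. unit_conj_kernel (\<mu> k) z * G z)
          = of_real (s k * (1/4)^k) * I (\<mu> k) G" for k
        by (simp add: unit_conj_kernel_def I_def T_def t_def power2_eq_square mult.assoc)
      then have "(\<lambda>k. of_real (s k * (1/4)^k) * I (\<mu> k) G) sums (LINT z|\<mm>. Q z * G z)"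
        using A_sums[OF k0 GL] unfolding Q_def by simp
      then have "norm (\<Sum>k. of_real (s k * (1/4)^k) * I (\<mu> k) G) = norm (LINT z|\<mm>. Q z * G z)"
        by (simp add: sums_iff)
      also have "\<dots> \<le> (LINT z|\<mm>. norm (Q z * G z))" by (rule integral_norm_bound)
      also have "\<dots> \<le> (LINT z|\<mm>. norm (Q z) powr p + norm (G z) powr q)"
      proof (rule integral_mono)
        show "integrable \<mm> (\<lambda>z. norm (Q z * G z))"
          by (intro integrable_norm L2_mult_integrable QL GL)
        show "integrable \<mm> (\<lambda>z. norm (Q z) powr p + norm (G z) powr q)"
          using QLp Linf_Lp[OF GI, of q] q by (auto simp: Lp_def)
        fix z
        have "norm (Q z) * norm (G z) \<le> norm (Q z) powr p / p + norm (G z) powr q / q"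
          using p q by (intro Youngs_inequality) auto
        also have "\<dots> \<le> norm (Q z) powr p / 1 + norm (G z) powr q / 1"
          using p q by (intro add_mono divide_left_mono) auto
        finally show "norm (Q z * G z) \<le> norm (Q z) powr p + norm (G z) powr q" by (simp add: norm_mult)
      qed
      also have "\<dots> = (LINT z|\<mm>. norm (Q z) powr p) + (LINT z|\<mm>. norm (G z) powr q)"
        using QLp Linf_Lp[OF GI, of q] q by (intro Bochner_Integration.integral_add) (auto simp: Lp_def)
      also have "\<dots> \<le> (LINT z|\<mm>. norm (Q z) powr p) + 1" using Gq by simp
      finally show "norm (\<Sum>k. of_real (s k * (1/4)^k) * I (\<mu> k) G) \<le> (LINT z|\<mm>. norm (Q z) powr p) + 1" .
    qed
  qed
  then obtain C where C: "\<And>a G. a \<in> L \<Longrightarrow> G \<in> S \<Longrightarrow> norm (I a G) \<le> C" by blast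
  have "lpnorm p (boundary_kernel a) / (lpnorm 2 (boundary_kernel a))\<^sup>2 \<le> \<bar>C\<bar> / (1 - norm (\<Theta> 0))" if a: "a \<in> L" for a
  proof -
    have N: "0 < lpnorm 2 (boundary_kernel a)" by (rule lpnorm_boundary_kernel_pos[OF L1[OF a]])
    have "lpnorm p (T a) \<le> \<bar>C\<bar>"
    proof (cases "lpnorm p (T a) = 0")
      case False
      obtain G where "G \<in> S" "norm (I a G) = lpnorm p (T a)"
        using lpnorm_dual[OF TL[OF a] p q(1) False] by (auto simp: S_def I_def)
      with C[OF a] show ?thesis by fastforce
    qed simp
    moreover have "lpnorm p (T a) = norm (point_value (boundary_kernel 0) a) * (lpnorm p (boundary_kernel a) / (lpnorm 2 (boundary_kernel a))\<^sup>2)"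
      unfolding T_def using p
      by (subst lpnorm_cmult) (auto simp: t_def lpnorm_conj_kernel[OF L1[OF a]] norm_divide norm_power)
    moreover have "(1 - norm (\<Theta> 0)) * (lpnorm p (boundary_kernel a) / (lpnorm 2 (boundary_kernel a))\<^sup>2)
        \<le> norm (point_value (boundary_kernel 0) a) * (lpnorm p (boundary_kernel a) / (lpnorm 2 (boundary_kernel a))\<^sup>2)"
      by (intro mult_right_mono point_value_boundary_kernel_0 L1[OF a]) auto
    ultimately have "(1 - norm (\<Theta> 0)) * (lpnorm p (boundary_kernel a) / (lpnorm 2 (boundary_kernel a))\<^sup>2) \<le> \<bar>C\<bar>" by linarith
    then show ?thesis using norm_theta_0 by (simp add: pos_le_divide_eq mult.commute)
  qed
  then show ?thesis by blast
qed

end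

theorem theorem5p6:
  fixes \<Theta> :: "complex \<Rightarrow> complex"
  assumes "inner_function \<Theta>"
    and "\<And>A. bounded_tto \<Theta> A \<Longrightarrow> \<exists>\<phi> \<in> Linf. tto_symbol \<Theta> A \<phi>"
  shows "\<forall>p::real. 2 < p \<longrightarrow>
    bdd_above ((\<lambda>w. lpnorm p (bv (model_kernel \<Theta> w)) / (lpnorm 2 (bv (model_kernel \<Theta> w)))\<^sup>2) ` ball 0 1)"
proof (intro allI impI)
  interpret inner \<Theta> by unfold_locales (rule assms(1))
  fix p :: real assume p: "2 < p"
  define R where "R w = lpnorm p (boundary_kernel w) / (lpnorm 2 (boundary_kernel w))\<^sup>2" for w
  have "bdd_above (R ` ball 0 1)"
  proof (rule ccontr)
    assume unb: "\<not> bdd_above (R ` ball 0 1)"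
    have "\<exists>w. norm w < 1 \<and> real n < R w" for n
    proof (rule ccontr)
      assume "\<nexists>w. norm w < 1 \<and> real n < R w"
      then have "\<And>x. x \<in> R ` ball 0 1 \<Longrightarrow> x \<le> real n" by fastforce
      then have "bdd_above (R ` ball 0 1)" by (rule bdd_aboveI)
      with unb show False by contradiction
    qed
    then obtain w where w: "\<And>n. norm (w n) < 1" "\<And>n. real n < R (w n)" by metis
    have "compact (cball (0::complex) 1)" by simp
    moreover have "\<forall>n. w n \<in> cball 0 1" using w(1) by (simp add: less_imp_le)
    ultimately obtain \<zeta> r where r: "strict_mono r" "(w \<circ> r) \<longlonglongrightarrow> \<zeta>"
      unfolding compact_def by meson
    define L where "L = range (w \<circ> r)"
    have L: "L \<subseteq> ball 0 1" "compact (insert \<zeta> L)"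
      using w(1) compact_sequence_with_limit[OF r(2)] by (auto simp: L_def)
    obtain C where C: "\<And>a. a \<in> L \<Longrightarrow> R a \<le> C"
      using ratio_bounded_near_point[OF assms(2) L, of p] p unfolding R_def by auto
    obtain n where n: "C < real n" using reals_Archimedean2 by blast
    have "real n \<le> real (r n)" using seq_suble[OF r(1), of n] by simp
    also have "\<dots> < R (w (r n))" by (rule w(2))
    also have "\<dots> \<le> C" by (rule C) (simp add: L_def)
    finally show False using n by simp
  qed
  also have "R ` ball 0 1 = (\<lambda>w. lpnorm p (bv (model_kernel \<Theta> w)) / (lpnorm 2 (bv (model_kernel \<Theta> w)))\<^sup>2) ` ball 0 1"
    by (intro image_cong refl) (simp add: R_def lpnorm_bv_model_kernel)
  finally show "bdd_above ((\<lambda>w. lpnorm p (bv (model_kernel \<Theta> w)) / (lpnorm 2 (bv (model_kernel \<Theta> w)))\<^sup>2) ` ball 0 1)" .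
qed

end
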